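(* Let $(X,\mathcal B,\mu,f,T_f)$ be a dissipative composition dynamical system of bounded distortion, generated by $W$, with $T_f:L^p(X)\to L^p(X)$, $1\le p<\infty$, invertible. If the operator $T_f$ has the shadowing property or, equivalently, is generalized hyperbolic, then $T_f$ is strongly structurally stable.
   Context: All Banach spaces are complex; $\mathbb D$ is the open unit disk in $\mathbb C$. A composition dynamical system is a quintuple $(X,\mathcal B,\mu,f,T_f)$ where: $(X,\mathcal B,\mu)$ is a $\sigma$-finite measure space; $f:X\to X$ is an injective bimeasurable transformation, i.e. $f(B)\in\mathcal B$ and $f^{-1}(B)\in\mathcal B$ for every $B\in\mathcal B$; there is $c>0$ such that $\mu(f^{-1}(B))\le c\,\mu(B)$ for every $B\in\mathcal B$; and $T_f:L^p(X)\to L^p(X)$, $1\le p<\infty$, is the composition operator $T_f\varphi=\varphi\circ f$ (a bounded linear operator). It is dissipative, of bounded distortion, generated by $W$ if: $f$ is invertible (bijective) and non-singular (for each $B\in\mathcal B$, $\mu(f^{-1}(B))=0$ iff $\mu(B)=0$); $W\in\mathcal B$ with $0<\mu(W)<\infty$ and $X=\bigcup_{k\in\mathbb Z}f^k(W)$ is a pairwise disjoint union; and there exists $K>0$ such that $$\frac1K\mu(f^k(W))\mu(B)\le\mu(f^k(B))\mu(W)\le K\mu(f^k(W))\mu(B)$$ for all $k\in\mathbb Z$ and all $B\in\mathcal B(W)=\{B\cap W:B\in\mathcal B\}$. Invertibility of $T_f$: $f$ is bijective and there is $c'>0$ such that $\mu(f(B))\le c'\mu(B)$ for every $B\in\mathcal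 B$; then $T_f^{-1}=T_{f^{-1}}$ is bounded. Let $T$ be an invertible bounded linear operator on a Banach space $E$. - $T$ has the shadowing property if for each $\epsilon>0$ there exists $\delta>0$ such that for every sequence $\{x_n\}_{n\in\mathbb Z}$ in $E$ with $\|Tx_n-x_{n+1}\|\le\delta$ for all $n\in\mathbb Z$ there exists $x\in E$ with $\|T^nx-x_n\|<\epsilon$ for all $n\in\mathbb Z$. - $T$ is generalized hyperbolic if $E=M\oplus N$ with $M,N$ closed subspaces, $T(M)\subseteq M$, $T^{-1}(N)\subseteq N$, $\sigma(T|_M)\subset\mathbb D$ and $\sigma(T^{-1}|_N)\subset\mathbb D$. - $T$ is strongly structurally stable if for every $\gamma>0$ there exists $\epsilon>0$ such that for any bounded Lipschitz map $\phi:E\to E$ with $\|\phi\|_\infty\le\epsilon$ and $\mathrm{Lip}(\phi)\le\epsilon$ there is a homeomorphism $h:E\to E$ with $h\circ T=(T+\phi)\circ h$ and $\|h-I\|_\infty\le\gamma$. *)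

theory Defs
  imports "HOL-Analysis.Analysis"
begin

text \<open>
  \<open>int_iter S f k\<close> is the \<open>k\<close>-th iterate, \<open>k\<close> an integer, of a bijection \<open>f\<close> of \<open>S\<close> onto itself.
\<close>

definition int_iter :: "'b set \<Rightarrow> ('b \<Rightarrow> 'b) \<Rightarrow> int \<Rightarrow> 'b \<Rightarrow> 'b" where
  "int_iter S f k = (if 0 \<le> k then f ^^ nat k else inv_into S f ^^ nat (- k))"


section \<open>Operators on complex normed spaces\<close>

text \<open>
  \<open>L\<^sup>p\<close> depends on a measure and an exponent and so cannot be a type; normed spaces are therefore
  structures with an explicit carrier. Maps are only relevant on the carrier, and a subspace \<open>A\<close> of
  \<open>E\<close> is the structure \<open>E\<lparr>carr := A\<rparr>\<close>.
\<close>

record 'e cnormed =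
  carr :: "'e set"
  vadd :: "'e \<Rightarrow> 'e \<Rightarrow> 'e"
  vzero :: 'e
  vscale :: "complex \<Rightarrow> 'e \<Rightarrow> 'e"
  vnorm :: "'e \<Rightarrow> real"

definition vdiff :: "'e cnormed \<Rightarrow> 'e \<Rightarrow> 'e \<Rightarrow> 'e" where
  "vdiff E x y = vadd E x (vscale E (-1) y)"

text \<open>
  The locale \<open>Metric_space\<close> asks for symmetry off the carrier too, hence the value \<open>0\<close> there.
\<close>

definition vdist :: "'e cnormed \<Rightarrow> 'e \<Rightarrow> 'e \<Rightarrow> real" where
  "vdist E x y = (if x \<in> carr E \<and> y \<in> carr E then vnorm E (vdiff E x y) else 0)"

definition norm_topology :: "'e cnormed \<Rightarrow> 'e topology" where
  "norm_topology E = Metric_space.mtopology (carr E) (vdist E)"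

definition bounded_operator :: "'e cnormed \<Rightarrow> ('e \<Rightarrow> 'e) \<Rightarrow> bool" where
  "bounded_operator E T \<longleftrightarrow>
     T \<in> carr E \<rightarrow> carr E \<and>
     (\<forall>x\<in>carr E. \<forall>y\<in>carr E. T (vadd E x y) = vadd E (T x) (T y)) \<and>
     (\<forall>a. \<forall>x\<in>carr E. T (vscale E a x) = vscale E a (T x)) \<and>
     (\<exists>C. \<forall>x\<in>carr E. vnorm E (T x) \<le> C * vnorm E x)"

definition invertible_operator :: "'e cnormed \<Rightarrow> ('e \<Rightarrow> 'e) \<Rightarrow> bool" where
  "invertible_operator E T \<longleftrightarrow>
     bounded_operator E T \<and> bij_betw T (carr E) (carr E) \<and>
     bounded_operator E (inv_into (carr E) T)"

definition spectrum :: "'e cnormed \<Rightarrow> ('e \<Rightarrow> 'e) \<Rightarrow> complex set" where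
  "spectrum E T = {z. \<not> invertible_operator E (\<lambda>x. vdiff E (vscale E z x) (T x))}"

definition closed_subspace :: "'e cnormed \<Rightarrow> 'e set \<Rightarrow> bool" where
  "closed_subspace E A \<longleftrightarrow>
     A \<subseteq> carr E \<and> vzero E \<in> A \<and>
     (\<forall>x\<in>A. \<forall>y\<in>A. vadd E x y \<in> A) \<and>
     (\<forall>a. \<forall>x\<in>A. vscale E a x \<in> A) \<and>
     closedin (norm_topology E) A"

definition direct_sum :: "'e cnormed \<Rightarrow> 'e set \<Rightarrow> 'e set \<Rightarrow> bool" where
  "direct_sum E A B \<longleftrightarrow>
     A \<inter> B = {vzero E} \<and> carr E = {vadd E a b | a b. a \<in> A \<and> b \<in> B}"

definition shadowing_property :: "'e cnormed \<Rightarrow> ('e \<Rightarrow> 'e) \<Rightarrow> bool" where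
  "shadowing_property E T \<longleftrightarrow>
     (\<forall>\<epsilon>>0. \<exists>\<delta>>0. \<forall>x :: int \<Rightarrow> 'e.
        (\<forall>n. x n \<in> carr E) \<and> (\<forall>n. vnorm E (vdiff E (T (x n)) (x (n + 1))) \<le> \<delta>) \<longrightarrow>
        (\<exists>y\<in>carr E. \<forall>n. vnorm E (vdiff E (int_iter (carr E) T n y) (x n)) < \<epsilon>))"

definition generalized_hyperbolic :: "'e cnormed \<Rightarrow> ('e \<Rightarrow> 'e) \<Rightarrow> bool" where
  "generalized_hyperbolic E T \<longleftrightarrow>
     (\<exists>A B. closed_subspace E A \<and> closed_subspace E B \<and> direct_sum E A B \<and>
        T ` A \<subseteq> A \<and> inv_into (carr E) T ` B \<subseteq> B \<and>
        spectrum (E\<lparr>carr := A\<rparr>) T \<subseteq> ball 0 1 \<and>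
        spectrum (E\<lparr>carr := B\<rparr>) (inv_into (carr E) T) \<subseteq> ball 0 1)"

definition strongly_structurally_stable :: "'e cnormed \<Rightarrow> ('e \<Rightarrow> 'e) \<Rightarrow> bool" where
  "strongly_structurally_stable E T \<longleftrightarrow>
     (\<forall>\<gamma>>0. \<exists>\<epsilon>>0. \<forall>\<phi> \<in> carr E \<rightarrow> carr E.
        (\<forall>x\<in>carr E. vnorm E (\<phi> x) \<le> \<epsilon>) \<and>
        (\<forall>x\<in>carr E. \<forall>y\<in>carr E. vdist E (\<phi> x) (\<phi> y) \<le> \<epsilon> * vdist E x y) \<longrightarrow>
        (\<exists>h. homeomorphic_map (norm_topology E) (norm_topology E) h \<and>
             (\<forall>x\<in>carr E. h (T x) = vadd E (T (h x)) (\<phi> (h x))) \<and>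
             (\<forall>x\<in>carr E. vnorm E (vdiff E (h x) x) \<le> \<gamma>)))"


section \<open>The complex space \<open>L\<^sup>p\<close> and composition operators\<close>

text \<open>
  Elements of \<open>L\<^sup>p\<close> are classes of measurable functions modulo equality almost everywhere. The
  operations are computed on an arbitrary representative \<open>rep\<close> of a class.
\<close>

definition ae_class :: "'a measure \<Rightarrow> ('a \<Rightarrow> complex) \<Rightarrow> ('a \<Rightarrow> complex) set" where
  "ae_class M \<phi> = {\<psi> \<in> borel_measurable M. AE x in M. \<psi> x = \<phi> x}"

definition rep :: "('a \<Rightarrow> complex) set \<Rightarrow> 'a \<Rightarrow> complex" where
  "rep \<Phi> = (SOME \<phi>. \<phi> \<in> \<Phi>)"

definition Lp :: "'a measure \<Rightarrow> real \<Rightarrow> ('a \<Rightarrow> complex) set cnormed" where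
  "Lp M p =
    \<lparr> carr = ae_class M ` {\<phi> \<in> borel_measurable M. integrable M (\<lambda>x. cmod (\<phi> x) powr p)},
      vadd = (\<lambda>\<Phi> \<Psi>. ae_class M (\<lambda>x. rep \<Phi> x + rep \<Psi> x)),
      vzero = ae_class M (\<lambda>x. 0),
      vscale = (\<lambda>a \<Phi>. ae_class M (\<lambda>x. a * rep \<Phi> x)),
      vnorm = (\<lambda>\<Phi>. (LINT x|M. cmod (rep \<Phi> x) powr p) powr (1 / p)) \<rparr>"

definition composition_operator ::
    "'a measure \<Rightarrow> ('a \<Rightarrow> 'a) \<Rightarrow> ('a \<Rightarrow> complex) set \<Rightarrow> ('a \<Rightarrow> complex) set" where
  "composition_operator M f \<Phi> = ae_class M (rep \<Phi> \<circ> f)"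

locale composition_system = sigma_finite_measure M
  for M :: "'a measure" +
  fixes f :: "'a \<Rightarrow> 'a"
  assumes inj: "inj_on f (space M)"
    and meas: "f \<in> measurable M M"
    and meas_image: "\<And>B. B \<in> sets M \<Longrightarrow> f ` B \<in> sets M"
    and vimage_bound: "\<exists>c::real. c > 0 \<and>
      (\<forall>B\<in>sets M. emeasure M (f -` B \<inter> space M) \<le> ennreal c * emeasure M B)"

locale dissipative_bounded_distortion = composition_system M f
  for M :: "'a measure" and f :: "'a \<Rightarrow> 'a" +
  fixes W :: "'a set"
  assumes bij: "bij_betw f (space M) (space M)"
    and nonsingular: "\<And>B. B \<in> sets M \<Longrightarrow>
      emeasure M (f -` B \<inter> space M) = 0 \<longleftrightarrow> emeasure M B = 0"
    and W_sets: "W \<in> sets M"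
    and W_pos: "0 < emeasure M W"
    and W_finite: "emeasure M W < \<infinity>"
    and W_disjoint: "disjoint_family (\<lambda>k. int_iter (space M) f k ` W)"
    and W_cover: "space M = (\<Union>k. int_iter (space M) f k ` W)"
    and distortion: "\<exists>K::real. K > 0 \<and> (\<forall>k. \<forall>B\<in>sets M. B \<subseteq> W \<longrightarrow>
      ennreal (1 / K) * emeasure M (int_iter (space M) f k ` W) * emeasure M B
        \<le> emeasure M (int_iter (space M) f k ` B) * emeasure M W \<and>
      emeasure M (int_iter (space M) f k ` B) * emeasure M W
        \<le> ennreal K * emeasure M (int_iter (space M) f k ` W) * emeasure M B)"

text \<open>
  The condition on \<open>f\<close> under which the composition operator is invertible on \<open>L\<^sup>p\<close>, with
  inverse the composition operator of the inverse of \<open>f\<close>.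
\<close>

definition invertible_composition :: "'a measure \<Rightarrow> ('a \<Rightarrow> 'a) \<Rightarrow> bool" where
  "invertible_composition M f \<longleftrightarrow>
     bij_betw f (space M) (space M) \<and>
     (\<exists>c::real. c > 0 \<and> (\<forall>B\<in>sets M. emeasure M (f ` B) \<le> ennreal c * emeasure M B))"

end

(*
The space L^p embeds isometrically into a space of bounded functions, by evaluating integrals against
the functions of norm at most one in the dual. For an invertible operator T, generalized hyperbolicity
means that the space is a direct sum A + B of closed subspaces with T A inside A, T^-1 B inside B, and
with the norms of the powers of T on A and of T^-1 on B summable. (The powers are read off from the
resolvent by Cauchy's inequality; the converse is the Neumann series.) By Baire's theorem the
projection P onto A is bounded, so for a bounded sequence z over the integers the series
  Lambda z = (SUM k >= 0. T^k P z(-k)) - (SUM k >= 1. T^-k (1 - P) z(k))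
converges, and T (Lambda z) + z(1) = Lambda (shift z): the equation d(n+1) = T d(n) + z(n) has a bounded
solution depending linearly on z. This is shadowing. For S = T + phi the maps
  h x = x + Lambda (n |-> phi (h (T^(n-1) x))),    g x = x - Lambda (n |-> phi (S^(n-1) x))
satisfy h T = S h and g S = T g; inserting one into the other gives g h = 1 at once, and q = h g - 1
satisfies |q| <= |q| / 2 in the supremum norm, so that h g = 1. This is strong structural stability.

Only the step from shadowing to generalized hyperbolicity uses the system. Put w(k) = mu (f^k W) and
u(n) = w(-n)^(-1/p), which is the inverse of the norm of T^n 1_W. The pseudo-orbit s(n) T^n 1_W with
s(n+1) - s(n) = delta u(n+1) is shadowed by an orbit T^n y, and bounded distortion turns this into
|s(n) - c| <= K u(n) for the mean c of y over W. An increasing sequence that is dominated by its own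
increments grows geometrically on both sides of its sign change, hence so does u; the splitting is that
into functions supported on the levels f^k W on either side of the sign change.
*)
theory Submission
  imports Defs "HOL-Complex_Analysis.Cauchy_Integral_Formula" "HOL-Probability.Discrete_Topology"
begin

section \<open>Integer iterates\<close>

text \<open>The carrier of \<open>Lp M p\<close> is not a type, whereas series, the M-test and the
  contraction principle live in Banach types. Bounded functions on a discrete index set form such a
  type and contain a copy of the space as a closed subspace \<open>V\<close>; the general argument
  takes place there, with operators that are constrained only on \<open>V\<close>. The obstacle on
  the spectral side is that no bound beyond the unit circle is available at the outset. Compactness
  of the closed disk bounds the resolvent uniformly, hence also its derivative, and Cauchy's
  inequality applied to the derivative gains a factor \<open>n\<close>:
  \<open>n * norm (S^n y)\<close> stays below a fixed multiple of \<open>norm y\<close>. So some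
  power has norm at most 1/2, and the decay is geometric. Evaluation at an index reduces all of this
  to scalar holomorphic functions. On the system side the reduction to scalars rests on one fact: a
  shift between two levels acts on measures, up to a constant, as multiplication by the ratio of the
  measures of these levels. One sequence \<open>u\<close> therefore governs the norms of the
  iterates on functions supported on unions of levels.\<close>

lemma funpow_mem: "f \<in> S \<rightarrow> S \<Longrightarrow> x \<in> S \<Longrightarrow> (f ^^ n) x \<in> S"
  by (induction n) auto

lemma int_iter_0 [simp]: "int_iter S f 0 x = x"
  by (simp add: int_iter_def)

lemma int_iter_of_nat: "int_iter S f (int n) = f ^^ n"
  by (simp add: int_iter_def)

lemma int_iter_minus_of_nat: "int_iter S f (- int n) = inv_into S f ^^ n"
  by (cases n) (auto simp: int_iter_def simp del: of_nat_Suc)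

context
  fixes f :: "'b \<Rightarrow> 'b" and S
  assumes bij: "bij_betw f S S"
begin

lemma self_bij_inv_mem: "x \<in> S \<Longrightarrow> inv_into S f x \<in> S"
  using bij by (metis bij_betw_def inv_into_into)

lemma self_bij_mem: "x \<in> S \<Longrightarrow> f x \<in> S"
  using bij by (auto simp: bij_betw_def)

lemma self_bij_right_inv: "x \<in> S \<Longrightarrow> f (inv_into S f x) = x"
  using bij by (simp add: bij_betw_inv_into_right)

lemma self_bij_left_inv: "x \<in> S \<Longrightarrow> inv_into S f (f x) = x"
  using bij by (simp add: bij_betw_inv_into_left)

lemma int_iter_mem: "x \<in> S \<Longrightarrow> int_iter S f k x \<in> S"
  unfolding int_iter_def using self_bij_mem self_bij_inv_mem by (auto intro!: funpow_mem)

lemma int_iter_add_1: "x \<in> S \<Longrightarrow> int_iter S f (k + 1) x = f (int_iter S f k x)"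
proof (cases "0 \<le> k")
  case True
  then show ?thesis by (simp add: int_iter_def nat_add_distrib)
next
  case False
  assume x: "x \<in> S"
  \<comment> \<open>For negative \<open>k\<close> both \<open>k\<close> and \<open>k + 1\<close> are
    at most 0, so only iterates of the inverse occur and \<open>f\<close> cancels one of
    them.\<close>
  define n where "n = nat (- k - 1)"
  have k: "k = - int (Suc n)" "k + 1 = - int n" using False by (auto simp: n_def)
  have "(inv_into S f ^^ n) x \<in> S" using x self_bij_inv_mem by (auto intro: funpow_mem)
  then have "f (int_iter S f (- int (Suc n)) x) = int_iter S f (- int n) x"
    unfolding int_iter_minus_of_nat by (simp add: self_bij_right_inv)
  then show ?thesis unfolding k(2) unfolding k(1) by (simp only:)
qed

lemma int_iter_diff_1: "x \<in> S \<Longrightarrow> int_iter S f (k - 1) x = inv_into S f (int_iter S f k x)"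
  using int_iter_add_1[of x "k - 1"] by (simp add: int_iter_mem self_bij_left_inv)

lemma int_iter_add: "x \<in> S \<Longrightarrow> int_iter S f (j + k) x = int_iter S f j (int_iter S f k x)"
proof (induction j rule: int_induct[where k = 0])
  case base
  then show ?case by simp
next
  case (step1 i)
  then show ?case using int_iter_add_1[of x "i + k"] int_iter_add_1[of "int_iter S f k x" i]
    by (simp add: int_iter_mem algebra_simps)
next
  case (step2 i)
  then show ?case using int_iter_diff_1[of x "i + k"] int_iter_diff_1[of "int_iter S f k x" i]
    by (simp add: int_iter_mem algebra_simps)
qed

lemma int_iter_1: "int_iter S f 1 x = f x"
  by (simp add: int_iter_def)

lemma int_iter_minus_1: "int_iter S f (- 1) x = inv_into S f x"
  by (simp add: int_iter_def)

lemma int_iter_add_1': "x \<in> S \<Longrightarrow> int_iter S f (k + 1) x = int_iter S f k (f x)"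
  using int_iter_add[of x k 1] by (simp add: int_iter_1)

lemma int_iter_cancel: "x \<in> S \<Longrightarrow> int_iter S f (- k) (int_iter S f k x) = x"
  "x \<in> S \<Longrightarrow> int_iter S f k (int_iter S f (- k) x) = x"
  using int_iter_add[of x "-k" k] int_iter_add[of x k "-k"] by simp_all

end

text \<open>A semiconjugacy between bijections also intertwines their inverses, because
  \<open>f'\<close> can be cancelled from \<open>f' (k y) = k (f y)\<close>. It is applied to the
  conjugacies \<open>h\<close> and \<open>g\<close> and to the embedding \<open>J\<close>.\<close>

lemma conj_int_iter:
  assumes f: "bij_betw f S S" and f': "bij_betw f' S' S'"
    and k: "\<And>x. x \<in> S \<Longrightarrow> k x \<in> S'" "\<And>x. x \<in> S \<Longrightarrow> k (f x) = f' (k x)" and x: "x \<in> S"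
  shows "k (int_iter S f n x) = int_iter S' f' n (k x)"
proof (induction n rule: int_induct[where k = 0])
  case base
  then show ?case by simp
next
  case (step1 i)
  then show ?case by (simp add: int_iter_add_1[OF f] int_iter_add_1[OF f'] k x int_iter_mem[OF f])
next
  case (step2 i)
  let ?y = "int_iter S f (i - 1) x"
  have y: "?y \<in> S" "f ?y = int_iter S f i x"
    using x int_iter_add_1[OF f x, of "i - 1"] by (auto intro: int_iter_mem[OF f])
  have "f' (k ?y) = int_iter S' f' i (k x)" using k(2)[OF y(1)] y(2) step2.IH by simp
  then show ?case
    by (metis int_iter_diff_1[OF f'] self_bij_left_inv[OF f'] k(1) x y(1))
qed

section \<open>Bounded solutions of the inhomogeneous equation\<close>

text \<open>\<open>P\<close> stands for the projection onto the contracting subspace along the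
  expanding one; it enters through additivity and the decay of \<open>T^n P\<close> and
  \<open>T^-n (1 - P)\<close>, which is what makes the series of \<open>\<Lambda>\<close> converge.
  The setting is a closed subspace \<open>V\<close> of a Banach type because the space to be treated
  is the image of an embedding.\<close>

locale splitting =
  fixes V :: "'v::banach set" and T :: "'v \<Rightarrow> 'v" and P :: "'v \<Rightarrow> 'v" and a :: "nat \<Rightarrow> real"
    and c :: real
  assumes subspace: "subspace V" and closed: "closed V"
    and bij: "bij_betw T V V"
    and T_add: "\<And>x y. x \<in> V \<Longrightarrow> y \<in> V \<Longrightarrow> T (x + y) = T x + T y"
    and T_bound: "\<And>x. x \<in> V \<Longrightarrow> norm (T x) \<le> c * norm x"
    and Tinv_bound: "\<And>x. x \<in> V \<Longrightarrow> norm (inv_into V T x) \<le> c * norm x"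
    and P_mem: "\<And>x. x \<in> V \<Longrightarrow> P x \<in> V"
    and P_add: "\<And>x y. x \<in> V \<Longrightarrow> y \<in> V \<Longrightarrow> P (x + y) = P x + P y"
    and c_nonneg: "0 \<le> c"
    and a_nonneg: "\<And>n. 0 \<le> a n"
    and summable_a: "summable a"
    and P_decay: "\<And>x n. x \<in> V \<Longrightarrow> norm ((T ^^ n) (P x)) \<le> a n * norm x"
    and Q_decay: "\<And>x n. x \<in> V \<Longrightarrow> norm ((inv_into V T ^^ n) (x - P x)) \<le> a n * norm x"
begin

abbreviation "T' \<equiv> inv_into V T"

lemma V_closure: "0 \<in> V" "x \<in> V \<Longrightarrow> y \<in> V \<Longrightarrow> x + y \<in> V" "x \<in> V \<Longrightarrow> y \<in> V \<Longrightarrow> x - y \<in> V"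
  "x \<in> V \<Longrightarrow> - x \<in> V"
  using subspace by (auto simp: subspace_0 subspace_add subspace_diff subspace_neg)

lemmas T_mem = self_bij_mem[OF bij] and T'_mem = self_bij_inv_mem[OF bij] and T_T' = self_bij_right_inv[OF bij]
  and T'_T = self_bij_left_inv[OF bij]

lemma diff_of_add:
  assumes "\<And>x y. x \<in> V \<Longrightarrow> y \<in> V \<Longrightarrow> g (x + y) = g x + (g y :: 'v)" "x \<in> V" "y \<in> V"
  shows "g (x - y) = g x - g y"
  using assms(1)[of "x - y" y] assms(2,3) by (simp add: V_closure)

lemma zero_of_add:
  assumes "\<And>x y. x \<in> V \<Longrightarrow> y \<in> V \<Longrightarrow> g (x + y) = g x + (g y :: 'v)"
  shows "g 0 = 0"
  using assms[of 0 0] by (simp add: V_closure)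

lemmas T_diff = diff_of_add[of T, OF T_add] and P_diff = diff_of_add[of P, OF P_add]

lemma T'_add: "x \<in> V \<Longrightarrow> y \<in> V \<Longrightarrow> T' (x + y) = T' x + T' y"
  by (metis T_T' T'_T T'_mem T_add V_closure(2))

lemma iterate_mem: "x \<in> V \<Longrightarrow> (T ^^ n) x \<in> V" "x \<in> V \<Longrightarrow> (T' ^^ n) x \<in> V"
  using T_mem T'_mem by (auto intro!: funpow_mem)

lemma iterate_diff: "x \<in> V \<Longrightarrow> y \<in> V \<Longrightarrow> (T ^^ n) (x - y) = (T ^^ n) x - (T ^^ n) y"
  "x \<in> V \<Longrightarrow> y \<in> V \<Longrightarrow> (T' ^^ n) (x - y) = (T' ^^ n) x - (T' ^^ n) y"
  by (induction n) (auto simp: iterate_mem T_diff diff_of_add[of T', OF T'_add])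

lemma sums_mem: "(\<And>n. x n \<in> V) \<Longrightarrow> x sums s \<Longrightarrow> s \<in> V"
  unfolding sums_def using closed subspace
  by (auto intro!: closed_sequentially[of V "\<lambda>n. \<Sum>i<n. x i" s] subspace_sum)

text \<open>\<open>T\<close> is additive and bounded on \<open>V\<close> only, so the exchange with
  the sum uses that the partial sums and, by closedness, their limit stay in
  \<open>V\<close>.\<close>

lemma T_sums:
  assumes x: "\<And>n. x n \<in> V" and s: "x sums s"
  shows "(\<lambda>n. T (x n)) sums T s"
proof -
  have sV: "s \<in> V" by (rule sums_mem[OF x s])
  have pV: "(\<Sum>i<n. x i) \<in> V" for n using x subspace by (auto intro: subspace_sum)
  have eq: "T (\<Sum>i<n. x i) = (\<Sum>i<n. T (x i))" for n
    by (induction n) (use x pV in \<open>auto simp: T_add zero_of_add[of T, OF T_add]\<close>)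
  have le: "norm ((\<Sum>i<n. T (x i)) - T s) \<le> c * norm ((\<Sum>i<n. x i) - s)" for n
    using T_bound[OF V_closure(3)[OF pV sV], of n] by (simp add: eq T_diff pV sV)
  have "(\<lambda>n. c * norm ((\<Sum>i<n. x i) - s)) \<longlonglongrightarrow> c * 0"
    using s unfolding sums_def by (intro tendsto_intros) (simp add: LIM_zero tendsto_norm_zero)
  then have "(\<lambda>n. (\<Sum>i<n. T (x i)) - T s) \<longlonglongrightarrow> 0"
    using Lim_null_comparison[OF always_eventually[OF allI[OF le]]] by simp
  then show ?thesis unfolding sums_def by (rule LIM_zero_cancel)
qed

section \<open>The bounded solution operator\<close>

definition stable_term :: "(int \<Rightarrow> 'v) \<Rightarrow> nat \<Rightarrow> 'v" where
  "stable_term z k = (T ^^ k) (P (z (- int k)))"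

text \<open>The future part of the series starts with the entry at 1; the index is shifted, so that
  term \<open>k\<close> carries the power \<open>k + 1\<close> of the inverse.\<close>

definition unstable_term :: "(int \<Rightarrow> 'v) \<Rightarrow> nat \<Rightarrow> 'v" where
  "unstable_term z k = (T' ^^ Suc k) (z (1 + int k) - P (z (1 + int k)))"

definition \<Lambda> :: "(int \<Rightarrow> 'v) \<Rightarrow> 'v" where
  "\<Lambda> z = suminf (stable_term z) - suminf (unstable_term z)"

lemma term_mem: "range z \<subseteq> V \<Longrightarrow> stable_term z k \<in> V" "range z \<subseteq> V \<Longrightarrow> unstable_term z k \<in> V"
  unfolding stable_term_def unstable_term_def
  by (intro iterate_mem P_mem V_closure; blast)+


lemma term_bound:
  assumes "range z \<subseteq> V" "\<And>n. norm (z n) \<le> \<beta>"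
  shows "norm (stable_term z k) \<le> a k * \<beta>" "norm (unstable_term z k) \<le> a (Suc k) * \<beta>"
proof -
  have "norm (stable_term z k) \<le> a k * norm (z (- int k))"
    unfolding stable_term_def using assms(1) by (intro P_decay) auto
  also have "\<dots> \<le> a k * \<beta>" by (intro mult_left_mono assms a_nonneg)
  finally show "norm (stable_term z k) \<le> a k * \<beta>" .
  have "norm (unstable_term z k) \<le> a (Suc k) * norm (z (1 + int k))"
    unfolding unstable_term_def using assms(1) by (intro Q_decay) auto
  also have "\<dots> \<le> a (Suc k) * \<beta>" by (intro mult_left_mono assms a_nonneg)
  finally show "norm (unstable_term z k) \<le> a (Suc k) * \<beta>" .
qed

lemma summable_a_mult: "summable (\<lambda>k. a k * \<beta>)" "summable (\<lambda>k. a (Suc k) * \<beta>)"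
  using summable_a by (auto intro!: summable_mult2 simp: summable_Suc_iff)

lemma summable_term:
  assumes "range z \<subseteq> V" "\<And>n. norm (z n) \<le> \<beta>"
  shows "summable (stable_term z)" "summable (unstable_term z)"
  using summable_comparison_test'[OF summable_a_mult(1)[of \<beta>], of 0 "stable_term z"]
    summable_comparison_test'[OF summable_a_mult(2)[of \<beta>], of 0 "unstable_term z"]
    term_bound[of z \<beta>, OF assms] by auto

text \<open>Each of the two series contributes at most \<open>suminf a\<close>; the added 1 makes
  \<open>K\<close> positive, since later constants are obtained by dividing by it.\<close>

definition K :: real where "K = 2 * suminf a + 1"

lemma K_pos: "0 < K"
  unfolding K_def using suminf_nonneg[OF summable_a] a_nonneg by (simp add: add_nonneg_pos)

lemma \<Lambda>_bound:
  assumes "range z \<subseteq> V" "\<And>n. norm (z n) \<le> \<beta>"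
  shows "norm (\<Lambda> z) \<le> K * \<beta>"
proof -
  have \<beta>: "0 \<le> \<beta>" using assms(2)[of 0] norm_ge_zero order_trans by blast
  have "norm (suminf (stable_term z)) \<le> (\<Sum>k. a k * \<beta>)"
    by (intro norm_suminf_le term_bound assms summable_a_mult)
  moreover have "norm (suminf (unstable_term z)) \<le> (\<Sum>k. a (Suc k) * \<beta>)"
    by (intro norm_suminf_le term_bound assms summable_a_mult)
  moreover have "(\<Sum>k. a k * \<beta>) = suminf a * \<beta>"
    using suminf_mult2[OF summable_a] by simp
  moreover have "(\<Sum>k. a (Suc k) * \<beta>) = (suminf a - a 0) * \<beta>"
    using suminf_mult2[of "\<lambda>k. a (Suc k)" \<beta>] summable_a suminf_split_head[OF summable_a]
    by (simp add: summable_Suc_iff)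
  ultimately have "norm (\<Lambda> z) \<le> suminf a * \<beta> + (suminf a - a 0) * \<beta>"
    unfolding \<Lambda>_def using norm_triangle_ineq4 order_trans add_mono by metis
  also have "\<dots> \<le> K * \<beta>"
    using mult_nonneg_nonneg[OF a_nonneg[of 0] \<beta>] \<beta> by (simp add: K_def algebra_simps)
  finally show ?thesis .
qed

lemma \<Lambda>_mem:
  assumes "range z \<subseteq> V" "\<And>n. norm (z n) \<le> \<beta>"
  shows "\<Lambda> z \<in> V"
  unfolding \<Lambda>_def
  by (intro V_closure(3) sums_mem[OF _ summable_sums] term_mem summable_term[where \<beta>=\<beta>] assms)

text \<open>Shifting adds the new head \<open>P (z 1)\<close> to the stable series, while applying
  \<open>T\<close> to the unstable series frees its head as \<open>z 1 - P (z 1)\<close>. The two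
  heads together give \<open>z 1\<close>.\<close>

lemma \<Lambda>_shift:
  assumes z: "range z \<subseteq> V" "\<And>n. norm (z n) \<le> \<beta>"
  shows "\<Lambda> (\<lambda>n. z (n + 1)) = T (\<Lambda> z) + z 1"
proof -
  let ?z = "\<lambda>n. z (n + 1)"
  have z': "range ?z \<subseteq> V" "\<And>n. norm (?z n) \<le> \<beta>" using z by auto
  have zV: "z n \<in> V" for n using z by auto
  note sz = summable_term[OF z] and sz' = summable_term[OF z']
  have mem: "suminf (stable_term z) \<in> V" "suminf (unstable_term z) \<in> V"
    by (intro sums_mem[OF _ summable_sums] term_mem sz z)+
  have s0: "stable_term ?z 0 = P (z 1)" by (simp add: stable_term_def)
  have s1: "stable_term ?z (Suc k) = T (stable_term z k)" for k
    by (simp add: stable_term_def)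
  have "T (suminf (stable_term z)) = (\<Sum>k. stable_term ?z (Suc k))"
    using T_sums[OF term_mem(1)[OF z(1)] summable_sums[OF sz(1)]] by (simp add: s1 sums_iff)
  also have "\<dots> = suminf (stable_term ?z) - P (z 1)"
    using suminf_split_head[OF sz'(1)] s0 by simp
  finally have 1: "T (suminf (stable_term z)) = suminf (stable_term ?z) - P (z 1)" .
  have u0: "T (unstable_term z 0) = z 1 - P (z 1)"
    by (simp add: unstable_term_def T_T' V_closure zV P_mem)
  have u1: "T (unstable_term z (Suc k)) = unstable_term ?z k" for k
  proof -
    have "T (T' ((T' ^^ Suc k) (z (1 + int k + 1) - P (z (1 + int k + 1))))) =
      (T' ^^ Suc k) (z (1 + int k + 1) - P (z (1 + int k + 1)))"
      by (intro T_T' iterate_mem V_closure zV P_mem)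
    then show ?thesis by (simp add: unstable_term_def algebra_simps)
  qed
  have T_u: "(\<lambda>k. T (unstable_term z k)) sums T (suminf (unstable_term z))"
    by (intro T_sums term_mem summable_sums sz z)
  have "T (suminf (unstable_term z)) = z 1 - P (z 1) + suminf (unstable_term ?z)"
    using suminf_split_head[OF sums_summable[OF T_u]] T_u by (simp add: u0 u1 sums_iff)
  with 1 show ?thesis unfolding \<Lambda>_def by (simp add: T_diff mem)
qed

lemma \<Lambda>_diff:
  assumes z: "range z \<subseteq> V" "\<And>n. norm (z n) \<le> \<beta>" and y: "range y \<subseteq> V" "\<And>n. norm (y n) \<le> \<beta>"
  shows "\<Lambda> (\<lambda>n. z n - y n) = \<Lambda> z - \<Lambda> y"
proof -
  have V: "z n \<in> V" "y n \<in> V" for n using z y by auto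
  have "stable_term (\<lambda>n. z n - y n) = (\<lambda>k. stable_term z k - stable_term y k)"
    by (simp add: stable_term_def fun_eq_iff V P_diff P_mem iterate_diff)
  moreover have "unstable_term (\<lambda>n. z n - y n) = (\<lambda>k. unstable_term z k - unstable_term y k)"
  proof
    fix k
    have "z (1 + int k) - y (1 + int k) - P (z (1 + int k) - y (1 + int k)) =
      (z (1 + int k) - P (z (1 + int k))) - (y (1 + int k) - P (y (1 + int k)))"
      by (simp add: V P_diff)
    then show "unstable_term (\<lambda>n. z n - y n) k = unstable_term z k - unstable_term y k"
      unfolding unstable_term_def by (simp only: iterate_diff(2)[OF V_closure(3)[OF V(1) P_mem[OF V(1)]]
          V_closure(3)[OF V(2) P_mem[OF V(2)]]])
  qed
  ultimately show ?thesis
    unfolding \<Lambda>_def using summable_term[OF z] summable_term[OF y] by (simp add: suminf_diff[symmetric])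
qed

lemma \<Lambda>_lipschitz:
  assumes z: "range z \<subseteq> V" "\<And>n. norm (z n) \<le> \<beta>" and y: "range y \<subseteq> V" "\<And>n. norm (y n) \<le> \<beta>"
    and zy: "\<And>n. norm (z n - y n) \<le> \<eta>"
  shows "norm (\<Lambda> z - \<Lambda> y) \<le> K * \<eta>"
proof -
  have "range (\<lambda>n. z n - y n) \<subseteq> V" using z y V_closure by blast
  from \<Lambda>_bound[OF this zy] show ?thesis by (simp add: \<Lambda>_diff[OF z y])
qed

text \<open>Continuity for each \<open>n\<close> separately suffices: the common bound
  \<open>\<beta>\<close> makes the tails of both series uniformly small. No uniformity in
  \<open>n\<close> could be expected in the applications, where \<open>z x n\<close> involves the
  iterates \<open>T^n x\<close>.\<close>

lemma \<Lambda>_continuous: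
  assumes z: "\<And>x n. x \<in> X \<Longrightarrow> z x n \<in> V" "\<And>x n. x \<in> X \<Longrightarrow> norm (z x n) \<le> \<beta>"
    and cont: "\<And>n. continuous_on X (\<lambda>x. z x n)"
  shows "continuous_on X (\<lambda>x. \<Lambda> (z x))"
proof -
  have lip: "continuous_on X (\<lambda>x. g (z x n))"
    if g: "\<And>x y. x \<in> V \<Longrightarrow> y \<in> V \<Longrightarrow> norm (g x - g y) \<le> C * norm (x - y)"
    for g :: "'v \<Rightarrow> 'v" and C n
  proof -
    have C: "norm (g x - g y) \<le> max C 0 * norm (x - y)" if "x \<in> V" "y \<in> V" for x y
      using g[OF that] by (smt (verit) max.cobounded1 mult_right_mono norm_ge_zero)
    have "continuous_on V g"
      by (rule lipschitz_on_continuous_on[where L="max C 0"])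
         (auto simp: lipschitz_on_def dist_norm C)
    then show ?thesis using cont z by (auto intro: continuous_on_compose2)
  qed
  have V1: "stable_term (z x) k \<in> V" "unstable_term (z x) k \<in> V" if "x \<in> X" for x k
    using z that by (auto intro!: term_mem)
  have cs: "continuous_on X (\<lambda>x. stable_term (z x) k)" for k
  proof (unfold stable_term_def, rule lip)
    fix x y assume "x \<in> V" "y \<in> V"
    then show "norm ((T ^^ k) (P x) - (T ^^ k) (P y)) \<le> a k * norm (x - y)"
      using P_decay[of "x - y" k] by (simp add: V_closure iterate_diff P_diff P_mem)
  qed
  have cu: "continuous_on X (\<lambda>x. unstable_term (z x) k)" for k
  proof (unfold unstable_term_def, rule lip)
    fix x y assume xy: "x \<in> V" "y \<in> V"
    have e: "x - y - P (x - y) = (x - P x) - (y - P y)" using xy by (simp add: P_diff)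
    show "norm ((T' ^^ Suc k) (x - P x) - (T' ^^ Suc k) (y - P y)) \<le> a (Suc k) * norm (x - y)"
      using Q_decay[of "x - y" "Suc k"] xy
      by (simp only: e V_closure iterate_diff P_mem)
  qed
  have b: "norm (stable_term (z x) k) \<le> a k * \<beta>" "norm (unstable_term (z x) k) \<le> a (Suc k) * \<beta>"
    if "x \<in> X" for x k using z that by (auto intro!: term_bound)
  have "uniform_limit X (\<lambda>n x. \<Sum>i<n. stable_term (z x) i) (\<lambda>x. suminf (stable_term (z x))) sequentially"
    by (rule Weierstrass_m_test[OF b(1) summable_a_mult(1)])
  then have 1: "continuous_on X (\<lambda>x. suminf (stable_term (z x)))"
    by (rule uniform_limit_theorem[rotated]) (auto intro!: always_eventually continuous_intros cs)
  have "uniform_limit X (\<lambda>n x. \<Sum>i<n. unstable_term (z x) i) (\<lambda>x. suminf (unstable_term (z x))) sequentially"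
    by (rule Weierstrass_m_test[OF b(2) summable_a_mult(2)])
  then have 2: "continuous_on X (\<lambda>x. suminf (unstable_term (z x)))"
    by (rule uniform_limit_theorem[rotated]) (auto intro!: always_eventually continuous_intros cu)
  show ?thesis unfolding \<Lambda>_def by (intro continuous_intros 1 2)
qed

end

section \<open>Structural stability\<close>

text \<open>The two smallness conditions have different tasks:
  \<open>c * \<epsilon> \<le> 1/2\<close> makes \<open>T + \<phi>\<close> invertible with a
  Lipschitz inverse, and \<open>K * \<epsilon> \<le> 1/2\<close> makes the fixed point equation for
  the conjugacy a contraction.\<close>

locale perturbation = splitting +
  fixes \<phi> :: "'a \<Rightarrow> 'a" and \<epsilon> :: real
  assumes \<phi>_mem: "\<And>x. x \<in> V \<Longrightarrow> \<phi> x \<in> V"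
    and \<phi>_bound: "\<And>x. x \<in> V \<Longrightarrow> norm (\<phi> x) \<le> \<epsilon>"
    and \<phi>_lipschitz: "\<And>x y. x \<in> V \<Longrightarrow> y \<in> V \<Longrightarrow> norm (\<phi> x - \<phi> y) \<le> \<epsilon> * norm (x - y)"
    and eps: "0 \<le> \<epsilon>" "c * \<epsilon> \<le> 1 / 2" "K * \<epsilon> \<le> 1 / 2"
begin

section \<open>The perturbed map and its inverse\<close>

definition S where "S x = T x + \<phi> x"

lemma T_lipschitz: "x \<in> V \<Longrightarrow> y \<in> V \<Longrightarrow> norm (T x - T y) \<le> c * norm (x - y)"
  "x \<in> V \<Longrightarrow> y \<in> V \<Longrightarrow> norm (T' x - T' y) \<le> c * norm (x - y)"
  using T_bound[of "x - y"] Tinv_bound[of "x - y"]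
  by (simp_all add: V_closure T_diff diff_of_add[of T', OF T'_add])

lemma S_eq_iff: "x \<in> V \<Longrightarrow> y \<in> V \<Longrightarrow> S x = y \<longleftrightarrow> T' (y - \<phi> x) = x"
  unfolding S_def by (metis T'_T T_T' V_closure(3) \<phi>_mem add_diff_cancel_right' diff_add_cancel)

text \<open>By \<open>S_eq_iff\<close>, solving \<open>S x = y\<close> means finding a fixed point
  of \<open>x |-> T' (y - \<phi> x)\<close>, which contracts by the factor
  \<open>c * \<epsilon>\<close>.\<close>

lemma S_bij: "bij_betw S V V"
proof -
  have ex1: "\<exists>!x\<in>V. T' (y - \<phi> x) = x" if y: "y \<in> V" for y
  proof (rule Banach_fix[where c="1/2"])
    fix x x' assume x: "x \<in> V" "x' \<in> V"
    have "norm (T' (y - \<phi> x) - T' (y - \<phi> x')) \<le> c * norm ((y - \<phi> x) - (y - \<phi> x'))"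
      by (intro T_lipschitz V_closure y x \<phi>_mem)
    also have "\<dots> = c * norm (\<phi> x' - \<phi> x)" by simp
    also have "\<dots> \<le> c * (\<epsilon> * norm (x' - x))"
      by (intro mult_left_mono \<phi>_lipschitz x c_nonneg)
    also have "\<dots> = c * \<epsilon> * norm (x - x')" by (simp add: norm_minus_commute)
    also have "\<dots> \<le> 1 / 2 * norm (x - x')" by (intro mult_right_mono eps) auto
    finally show "dist (T' (y - \<phi> x)) (T' (y - \<phi> x')) \<le> 1 / 2 * dist x x'"
      by (simp add: dist_norm)
  qed (use closed V_closure y in \<open>auto simp: complete_eq_closed intro!: T'_mem V_closure \<phi>_mem\<close>)
  show ?thesis
    unfolding bij_betw_def
  proof
    show "inj_on S V"
    proof (rule inj_onI)
      fix x x' assume x: "x \<in> V" "x' \<in> V" "S x = S x'"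
      then have "S x' \<in> V" by (simp add: S_def V_closure T_mem \<phi>_mem)
      then show "x = x'" using ex1[of "S x'"] S_eq_iff[of x "S x'"] S_eq_iff[of x' "S x'"] x by blast
    qed
    show "S ` V = V"
    proof
      show "S ` V \<subseteq> V" by (auto simp: S_def V_closure T_mem \<phi>_mem)
      show "V \<subseteq> S ` V" using ex1 S_eq_iff by (metis image_eqI subsetI)
    qed
  qed
qed

text \<open>The contribution of \<open>\<phi>\<close> is at most half of \<open>norm (x - y)\<close>
  and is absorbed by the left side. This makes the negative iterates of \<open>S\<close> continuous,
  as \<open>g\<close> requires.\<close>

lemma S_inv_lipschitz:
  assumes "x \<in> V" "y \<in> V"
  shows "norm (x - y) \<le> 2 * c * norm (S x - S y)"
proof -
  have Sx: "T x = S x - \<phi> x" "T y = S y - \<phi> y" by (simp_all add: S_def)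
  have "norm (x - y) \<le> c * norm (T x - T y)"
    using T_lipschitz(2)[of "T x" "T y"] assms by (simp add: T'_T T_mem)
  also have "T x - T y = (S x - S y) - (\<phi> x - \<phi> y)" unfolding Sx by simp
  also have "c * norm \<dots> \<le> c * (norm (S x - S y) + \<epsilon> * norm (x - y))"
    by (intro mult_left_mono c_nonneg norm_triangle_le_diff add_mono order_refl \<phi>_lipschitz assms)
  also have "\<dots> = c * norm (S x - S y) + c * \<epsilon> * norm (x - y)" by (simp add: algebra_simps)
  also have "\<dots> \<le> c * norm (S x - S y) + 1 / 2 * norm (x - y)"
    by (intro add_left_mono mult_right_mono eps) auto
  finally show ?thesis by simp
qed

lemma continuous_on_lipschitz:
  assumes "\<And>x y. x \<in> V \<Longrightarrow> y \<in> V \<Longrightarrow> norm (g x - g y) \<le> L * norm (x - y)" "0 \<le> L"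
  shows "continuous_on V g"
  using assms by (intro lipschitz_on_continuous_on[where L=L]) (auto simp: lipschitz_on_def dist_norm)

lemma continuous_\<phi>: "continuous_on V \<phi>"
  by (rule continuous_on_lipschitz[OF \<phi>_lipschitz]) (use eps in auto)

lemma continuous_T: "continuous_on V T" "continuous_on V T'"
  by (rule continuous_on_lipschitz[OF T_lipschitz(1)] continuous_on_lipschitz[OF T_lipschitz(2)];
      use c_nonneg in simp)+

lemma continuous_S: "continuous_on V S" "continuous_on V (inv_into V S)"
proof -
  show "continuous_on V S" unfolding S_def by (intro continuous_intros continuous_T continuous_\<phi>)
  show "continuous_on V (inv_into V S)"
  proof (rule continuous_on_lipschitz)
    fix x y assume "x \<in> V" "y \<in> V"
    then show "norm (inv_into V S x - inv_into V S y) \<le> 2 * c * norm (x - y)"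
      using S_inv_lipschitz[of "inv_into V S x" "inv_into V S y"]
      by (simp add: self_bij_right_inv[OF S_bij] self_bij_inv_mem[OF S_bij])
  qed (use c_nonneg in simp)
qed

lemma continuous_funpow: "continuous_on V g \<Longrightarrow> g ` V \<subseteq> V \<Longrightarrow> continuous_on V (g ^^ n)"
proof (induction n)
  case (Suc n)
  then have "(g ^^ n) ` V \<subseteq> V" using funpow_mem[of g V] by blast
  with Suc show ?case unfolding funpow.simps by (intro continuous_on_compose) (auto intro: continuous_on_subset)
qed auto

lemma continuous_int_iter:
  "continuous_on V (int_iter V T n)" "continuous_on V (int_iter V S n)"
  unfolding int_iter_def
  using continuous_funpow[OF continuous_T(1)] continuous_funpow[OF continuous_T(2)]
    continuous_funpow[OF continuous_S(1)] continuous_funpow[OF continuous_S(2)]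
    T_mem T'_mem self_bij_mem[OF S_bij] self_bij_inv_mem[OF S_bij] by (auto simp: image_subset_iff)

text \<open>The conjugacy \<open>h\<close> solves \<open>h x = x + \<Lambda> (\<lambda>n. \<phi> (h (T\<^sup>n\<^sup>-\<^sup>1 x)))\<close> and is the limit of Picard
  iterates.\<close>

definition picard :: "('a \<Rightarrow> 'a) \<Rightarrow> 'a \<Rightarrow> 'a" where
  "picard k x = x + \<Lambda> (\<lambda>n. \<phi> (k (int_iter V T (n - 1) x)))"

abbreviation "hh j \<equiv> (picard ^^ j) (\<lambda>x. x)"

lemma orbit_mem: "x \<in> V \<Longrightarrow> int_iter V T n x \<in> V" "x \<in> V \<Longrightarrow> int_iter V S n x \<in> V"
  by (rule int_iter_mem[OF bij] int_iter_mem[OF S_bij]; assumption)+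

lemma picard_mem:
  assumes "k \<in> V \<rightarrow> V" "x \<in> V"
  shows "picard k x \<in> V"
proof -
  have "k (int_iter V T (n - 1) x) \<in> V" for n
    using assms orbit_mem by blast
  then show ?thesis unfolding picard_def using assms(2)
    by (intro V_closure(2) \<Lambda>_mem[where \<beta>=\<epsilon>]) (auto intro!: \<phi>_mem \<phi>_bound)
qed

lemma picard_continuous:
  assumes "k \<in> V \<rightarrow> V" "continuous_on V k"
  shows "continuous_on V (picard k)"
proof -
  have k: "k (int_iter V T (n - 1) x) \<in> V" if "x \<in> V" for n x
    using assms orbit_mem that by blast
  have "continuous_on V (\<lambda>x. k (int_iter V T (n - 1) x))" for n
    by (rule continuous_on_compose2[OF assms(2) continuous_int_iter(1)]) (auto intro: orbit_mem)
  then have "continuous_on V (\<lambda>x. \<phi> (k (int_iter V T (n - 1) x)))" for n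
    by (rule continuous_on_compose2[OF continuous_\<phi>]) (auto intro: k)
  then show ?thesis unfolding picard_def using k
    by (intro continuous_intros \<Lambda>_continuous[where \<beta>=\<epsilon>]) (auto intro!: \<phi>_mem \<phi>_bound)
qed

lemma picard_contraction:
  assumes "k \<in> V \<rightarrow> V" "l \<in> V \<rightarrow> V" "x \<in> V" and kl: "\<And>y. y \<in> V \<Longrightarrow> norm (k y - l y) \<le> \<eta>"
  shows "norm (picard k x - picard l x) \<le> \<eta> / 2"
proof -
  have V: "k (int_iter V T (n - 1) x) \<in> V" "l (int_iter V T (n - 1) x) \<in> V" for n
    using assms orbit_mem by blast+
  have \<eta>: "0 \<le> \<eta>" using kl[OF assms(3)] norm_ge_zero order_trans by blast
  have "norm (picard k x - picard l x) \<le> K * (\<epsilon> * \<eta>)"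
    unfolding picard_def add_diff_cancel_left
  proof (rule \<Lambda>_lipschitz[where \<beta>=\<epsilon>])
    fix n
    have "norm (\<phi> (k (int_iter V T (n - 1) x)) - \<phi> (l (int_iter V T (n - 1) x)))
      \<le> \<epsilon> * norm (k (int_iter V T (n - 1) x) - l (int_iter V T (n - 1) x))"
      by (intro \<phi>_lipschitz V)
    also have "\<dots> \<le> \<epsilon> * \<eta>" by (intro mult_left_mono kl orbit_mem assms eps)
    finally show "norm (\<phi> (k (int_iter V T (n - 1) x)) - \<phi> (l (int_iter V T (n - 1) x))) \<le> \<epsilon> * \<eta>" .
  qed (auto intro!: \<phi>_mem \<phi>_bound V)
  also have "\<dots> \<le> \<eta> / 2" using mult_right_mono[OF eps(3) \<eta>] by (simp add: mult.assoc)
  finally show ?thesis .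
qed

lemma hh_mem: "hh j \<in> V \<rightarrow> V"
  by (induction j) (auto intro: picard_mem)

lemma hh_continuous: "continuous_on V (hh j)"
  by (induction j) (simp, simp only: funpow.simps o_apply, rule picard_continuous[OF hh_mem])

lemma hh_step: "x \<in> V \<Longrightarrow> norm (hh (Suc j) x - hh j x) \<le> (1 / 2) ^ j"
proof (induction j arbitrary: x)
  case 0
  have "norm (\<Lambda> (\<lambda>n. \<phi> (int_iter V T (n - 1) x))) \<le> K * \<epsilon>"
    using 0 by (intro \<Lambda>_bound) (auto intro!: \<phi>_bound \<phi>_mem orbit_mem)
  then show ?case using eps by (simp add: picard_def)
next
  case (Suc j)
  show ?case using picard_contraction[OF hh_mem hh_mem Suc.prems Suc.IH] by simp
qed

text \<open>The limit of the iterates \<open>hh\<close>, written as a telescoping series so that the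
  M-test yields convergence uniformly on \<open>V\<close>, and with it continuity.\<close>

definition h where "h x = x + (\<Sum>i. hh (Suc i) x - hh i x)"

lemma hh_limit: "uniform_limit V hh h sequentially"
proof -
  have "uniform_limit V (\<lambda>n x. \<Sum>i<n. hh (Suc i) x - hh i x) (\<lambda>x. \<Sum>i. hh (Suc i) x - hh i x) sequentially"
    by (rule Weierstrass_m_test[OF hh_step]) (auto intro: summable_geometric)
  moreover have "(\<Sum>i<n. hh (Suc i) x - hh i x) = hh n x - x" for n x
    using sum_lessThan_telescope[of "\<lambda>i. hh i x" n] by simp
  ultimately have "uniform_limit V (\<lambda>n x. hh n x - x) (\<lambda>x. \<Sum>i. hh (Suc i) x - hh i x) sequentially"
    by simp
  from uniform_limit_add[OF uniform_limit_const[where S = V and c = "\<lambda>x. x"] this] show ?thesis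
    by (simp add: h_def[abs_def])
qed

lemma h_continuous: "continuous_on V h"
  by (rule uniform_limit_theorem[OF _ hh_limit]) (intro always_eventually allI hh_continuous, simp)

lemma h_mem: "x \<in> V \<Longrightarrow> h x \<in> V"
  using tendsto_uniform_limitI[OF hh_limit, of x] hh_mem closed_sequentially[OF closed, of "\<lambda>n. hh n x"]
  by blast

lemma h_fixed: "x \<in> V \<Longrightarrow> h x = picard h x"
proof -
  assume x: "x \<in> V"
  have hV: "h \<in> V \<rightarrow> V" using h_mem by blast
  have 1: "(\<lambda>n. hh (Suc n) x) \<longlonglongrightarrow> h x"
    using tendsto_uniform_limitI[OF hh_limit x] by (rule LIMSEQ_Suc)
  have "(\<lambda>n. hh (Suc n) x) \<longlonglongrightarrow> picard h x"
  proof (rule tendstoI)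
    fix e :: real assume e: "0 < e"
    have "\<forall>\<^sub>F n in sequentially. \<forall>y\<in>V. dist (hh n y) (h y) < e"
      using hh_limit e by (rule uniform_limitD)
    then show "\<forall>\<^sub>F n in sequentially. dist (hh (Suc n) x) (picard h x) < e"
    proof eventually_elim
      case (elim n)
      have "norm (picard (hh n) x - picard h x) \<le> e / 2"
        by (rule picard_contraction[OF hh_mem hV x]) (use elim in \<open>auto simp: dist_norm intro: less_imp_le\<close>)
      then show ?case using e by (simp add: dist_norm)
    qed
  qed
  with 1 show ?thesis by (rule LIMSEQ_unique)
qed

text \<open>In this direction the formula is explicit: the perturbation is evaluated along the orbit
  of \<open>S\<close>, which is given, so no fixed point has to be found.\<close>

definition g where "g x = x - \<Lambda> (\<lambda>n. \<phi> (int_iter V S (n - 1) x))"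

lemma g_mem: "x \<in> V \<Longrightarrow> g x \<in> V"
  unfolding g_def by (intro V_closure(3) \<Lambda>_mem[where \<beta>=\<epsilon>]) (auto intro!: \<phi>_mem \<phi>_bound orbit_mem)

lemma g_continuous: "continuous_on V g"
  unfolding g_def
  by (intro continuous_intros \<Lambda>_continuous[where \<beta>=\<epsilon>] continuous_on_compose2[OF continuous_\<phi> continuous_int_iter(2)])
     (auto intro!: \<phi>_mem \<phi>_bound orbit_mem)

text \<open>Replacing \<open>x\<close> by \<open>T x\<close> shifts the forcing sequence by one, and
  \<open>\<Lambda>_shift\<close> converts the shift into \<open>T\<close> plus the entry at 1. The
  offset \<open>n - 1\<close> in \<open>picard\<close> makes this entry equal to
  \<open>\<phi> (h x)\<close>.\<close>

lemma h_T:
  assumes x: "x \<in> V"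
  shows "h (T x) = S (h x)"
proof -
  let ?z = "\<lambda>n. \<phi> (h (int_iter V T (n - 1) x))"
  have z: "range ?z \<subseteq> V" "\<And>n. norm (?z n) \<le> \<epsilon>"
    by (auto intro!: \<phi>_mem \<phi>_bound h_mem orbit_mem x)
  have "int_iter V T n x = int_iter V T (n - 1) (T x)" for n
    using int_iter_add_1'[OF bij x, of "n - 1"] by simp
  then have "h (T x) = T x + \<Lambda> (\<lambda>n. ?z (n + 1))"
    using h_fixed[OF T_mem[OF x]] by (simp add: picard_def)
  also have "\<dots> = T x + T (\<Lambda> ?z) + \<phi> (h x)" using \<Lambda>_shift[OF z] by simp
  also have "T x + T (\<Lambda> ?z) = T (x + \<Lambda> ?z)" using x \<Lambda>_mem[OF z] by (simp add: T_add)
  also have "x + \<Lambda> ?z = h x" using h_fixed[OF x] by (simp add: picard_def)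
  finally show ?thesis by (simp add: S_def)
qed

lemma g_S:
  assumes x: "x \<in> V"
  shows "g (S x) = T (g x)"
proof -
  let ?z = "\<lambda>n. \<phi> (int_iter V S (n - 1) x)"
  have z: "range ?z \<subseteq> V" "\<And>n. norm (?z n) \<le> \<epsilon>"
    by (auto intro!: \<phi>_mem \<phi>_bound orbit_mem x)
  have "int_iter V S n x = int_iter V S (n - 1) (S x)" for n
    using int_iter_add_1'[OF S_bij x, of "n - 1"] by simp
  then have "g (S x) = S x - \<Lambda> (\<lambda>n. ?z (n + 1))" by (simp add: g_def)
  also have "\<dots> = T x - T (\<Lambda> ?z)" using \<Lambda>_shift[OF z] by (simp add: S_def)
  also have "\<dots> = T (g x)" using x \<Lambda>_mem[OF z] by (simp add: T_diff g_def)
  finally show ?thesis .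
qed

text \<open>Since \<open>h\<close> carries the orbit of \<open>x\<close> under \<open>T\<close> to
  the orbit of \<open>h x\<close> under \<open>S\<close>, the correction subtracted by
  \<open>g\<close> is the very one added by \<open>h\<close>.\<close>

lemma g_h: "x \<in> V \<Longrightarrow> g (h x) = x"
  using h_fixed[of x] conj_int_iter[OF bij S_bij, of h x] h_mem h_T
  by (simp add: g_def picard_def) (metis add_diff_cancel_right')

lemma h_g:
  assumes x: "x \<in> V"
  shows "h (g x) = x"
proof -
  define q where "q y = h (g y) - y" for y
  have q_le: "norm (q y) \<le> K * \<eta>"
    if y: "y \<in> V" and \<eta>: "\<And>w. w \<in> V \<Longrightarrow> norm (\<phi> (h (g w)) - \<phi> w) \<le> \<eta>" for y \<eta>
  proof -
    let ?z = "\<lambda>n. \<phi> (h (g (int_iter V S (n - 1) y)))"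
    have "g (int_iter V S n y) = int_iter V T n (g y)" for n
      using conj_int_iter[OF S_bij bij, of g y n] g_mem g_S y by auto
    then have "h (g y) = g y + \<Lambda> ?z"
      using h_fixed[OF g_mem[OF y]] by (simp add: picard_def)
    then have "q y = \<Lambda> ?z - \<Lambda> (\<lambda>n. \<phi> (int_iter V S (n - 1) y))" by (simp add: q_def g_def)
    also have "norm \<dots> \<le> K * \<eta>"
      by (rule \<Lambda>_lipschitz[where \<beta>=\<epsilon>])
         (auto intro!: \<phi>_mem \<phi>_bound h_mem g_mem orbit_mem y \<eta>)
    finally show ?thesis .
  qed
  \<comment> \<open>Instead of a supremum norm, an induction is used: the bound on
    \<open>\<phi>\<close> gives \<open>2 * K * \<epsilon> \<le> 1\<close> at the start, and each
    application of \<open>q_le\<close> halves the bound for all points at once.\<close>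
  have bound: "norm (q y) \<le> (1 / 2) ^ n" if "y \<in> V" for y n
    using that
  proof (induction n arbitrary: y)
    case 0
    have "norm (\<phi> (h (g w)) - \<phi> w) \<le> 2 * \<epsilon>" if "w \<in> V" for w
      using norm_triangle_ineq4[of "\<phi> (h (g w))" "\<phi> w"] \<phi>_bound[OF that] \<phi>_bound[OF h_mem[OF g_mem[OF that]]]
      by linarith
    from q_le[OF 0 this] show ?case using eps by simp
  next
    case (Suc n)
    have "norm (\<phi> (h (g w)) - \<phi> w) \<le> \<epsilon> * (1 / 2) ^ n" if "w \<in> V" for w
    proof -
      have "norm (\<phi> (h (g w)) - \<phi> w) \<le> \<epsilon> * norm (q w)"
        unfolding q_def by (intro \<phi>_lipschitz h_mem g_mem that)
      also have "\<dots> \<le> \<epsilon> * (1 / 2) ^ n" by (intro mult_left_mono Suc.IH that eps)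
      finally show ?thesis .
    qed
    from q_le[OF Suc.prems this] have "norm (q y) \<le> K * \<epsilon> * (1 / 2) ^ n" by (simp add: mult.assoc)
    also have "\<dots> \<le> 1 / 2 * (1 / 2) ^ n" by (intro mult_right_mono eps) simp
    finally show ?case by simp
  qed
  have "(\<lambda>n. (1 / 2 :: real) ^ n) \<longlonglongrightarrow> 0" by (rule LIMSEQ_realpow_zero) auto
  then have "norm (q x) \<le> 0"
    by (rule LIMSEQ_le_const) (use bound[OF x] in blast)
  then show ?thesis by (simp add: q_def)
qed

lemma h_close: "x \<in> V \<Longrightarrow> norm (h x - x) \<le> K * \<epsilon>"
  using h_fixed[of x] \<Lambda>_bound[of "\<lambda>n. \<phi> (h (int_iter V T (n - 1) x))" \<epsilon>]
  by (auto simp: picard_def intro!: \<phi>_mem \<phi>_bound h_mem orbit_mem)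

end

section \<open>Direct sums of closed subspaces\<close>

text \<open>Category is used inside \<open>V\<close> with the restricted metric, since
  \<open>V\<close> may well have empty interior in the surrounding type.\<close>

lemma Baire_complete_cover:
  fixes V :: "'v::metric_space set"
  assumes V: "complete V" "V \<noteq> {}" and F: "\<And>n :: nat. closed (F n)" "V \<subseteq> (\<Union>n. F n)"
  obtains n x r where "x \<in> V" "0 < r" "V \<inter> ball x r \<subseteq> F n"
proof -
  interpret sub: Metric_space V dist by unfold_locales (auto simp: dist_commute dist_triangle)
  have mb: "sub.mball x r = V \<inter> ball x r" if "x \<in> V" for x r
    using that by (auto simp: sub.mball_def)
  have "sub.mcomplete"
    unfolding sub.mcomplete_def
  proof (intro allI impI)
    fix \<sigma> assume "sub.MCauchy \<sigma>"
    then have "range \<sigma> \<subseteq> V" "Cauchy \<sigma>" by (auto simp: sub.MCauchy_def Cauchy_def)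
    then obtain l where l: "l \<in> V" "\<sigma> \<longlonglongrightarrow> l" using V(1) unfolding complete_def by (metis range_subsetD)
    then have "limitin sub.mtopology \<sigma> l sequentially"
      using \<open>range \<sigma> \<subseteq> V\<close> by (auto simp: sub.limitin_metric tendsto_iff image_subset_iff)
    then show "\<exists>x. limitin sub.mtopology \<sigma> x sequentially" ..
  qed
  have cl: "closedin sub.mtopology (V \<inter> F n)" for n
  proof -
    have "\<exists>r>0. sub.mball x r \<subseteq> V - F n" if "x \<in> V - F n" for x
    proof -
      have "open (- F n)" "x \<in> - F n" using F(1) that by auto
      then obtain r where "0 < r" "ball x r \<subseteq> - F n" by (rule openE)
      then show ?thesis using that mb[of x r] by (intro exI[of _ r]) auto
    qed
    moreover have "V - (V \<inter> F n) = V - F n" by auto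
    ultimately have "openin sub.mtopology (V - (V \<inter> F n))"
      unfolding sub.openin_mtopology by auto
    then show ?thesis by (simp add: closedin_def)
  qed
  have "\<exists>n. sub.mtopology interior_of (V \<inter> F n) \<noteq> {}"
  proof (rule ccontr)
    assume "\<not> ?thesis"
    then have "sub.mtopology interior_of \<Union>(range (\<lambda>n. V \<inter> F n)) = {}"
      using cl by (intro sub.metric_Baire_category_alt[OF \<open>sub.mcomplete\<close>]) auto
    moreover have "\<Union>(range (\<lambda>n. V \<inter> F n)) = V" using F(2) by auto
    ultimately show False using V(2) interior_of_topspace[of sub.mtopology] by simp
  qed
  then obtain n x where x: "x \<in> sub.mtopology interior_of (V \<inter> F n)" by blast
  then obtain U where "openin sub.mtopology U" "x \<in> U" "U \<subseteq> V \<inter> F n"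
    by (auto simp: interior_of_def)
  then obtain r where r: "0 < r" "sub.mball x r \<subseteq> F n" "x \<in> V"
    by (metis IntD2 sub.openin_mtopology subset_iff)
  then show ?thesis using that[of x r n] mb[of x r] by auto
qed

text \<open>This is the open mapping argument for addition from the product of \<open>A\<close> and
  \<open>B\<close>. Baire provides a ball in the closure of sums with bounded first component;
  differences move the ball to the origin, scaling gives approximate decompositions of every vector,
  and summing successive corrections makes them exact.\<close>

lemma direct_sum_projection_bounded:
  fixes A B :: "'v::banach set"
  assumes A: "subspace A" "closed A" and B: "subspace B" "closed B" and AB: "A \<inter> B = {0}"
    and V: "closed {a + b | a b. a \<in> A \<and> b \<in> B}"
  shows "\<exists>C\<ge>0. \<forall>a\<in>A. \<forall>b\<in>B. norm a \<le> C * norm (a + b)"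
proof -
  let ?V = "{a + b | a b. a \<in> A \<and> b \<in> B}"
  \<comment> \<open>Only the component in \<open>A\<close> is bounded. The component in
    \<open>B\<close> never needs a norm bound of its own.\<close>
  define G where "G n = {a + b | a b. a \<in> A \<and> b \<in> B \<and> norm a \<le> real n}" for n
  have zero: "0 \<in> A" "0 \<in> B" using A B by (auto simp: subspace_0)
  have cover: "?V \<subseteq> (\<Union>n. closure (G n))"
  proof
    fix v assume "v \<in> ?V"
    then obtain a b where "v = a + b" "a \<in> A" "b \<in> B" by auto
    moreover obtain n where "norm a \<le> real n" using real_arch_simple by blast
    ultimately have "v \<in> G n" by (auto simp: G_def)
    then show "v \<in> (\<Union>n. closure (G n))" using closure_subset by blast
  qed
  have "?V \<noteq> {}" using zero by auto
  then obtain n x r where x: "x \<in> ?V" and r: "0 < r" and sub: "?V \<inter> ball x r \<subseteq> closure (G n)"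
    using Baire_complete_cover[of ?V "\<lambda>n. closure (G n)", OF _ _ closed_closure cover] V
    by (metis (no_types, lifting) complete_eq_closed)
  have add: "v + w \<in> ?V" if vw: "v \<in> ?V" "w \<in> ?V" for v w
  proof -
    obtain a b a' b' where e: "v = a + b" "w = a' + b'" "a \<in> A" "b \<in> B" "a' \<in> A" "b' \<in> B"
      using vw by auto
    then have "v + w = (a + a') + (b + b')" "a + a' \<in> A" "b + b' \<in> B"
      using A B by (auto intro: subspace_add)
    then show ?thesis by blast
  qed
  have near: "\<exists>a\<in>A. \<exists>b\<in>B. norm a \<le> 2 * real n \<and> norm (v - (a + b)) < e"
    if v: "v \<in> ?V" "norm v < r" and e: "0 < e" for v e
  proof -
    \<comment> \<open>The vector \<open>v\<close> is the difference of two points of the ball, both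
      approximated by elements of \<open>G n\<close>; subtracting these gives the bound
      \<open>2 * real n\<close>.\<close>
    have "x \<in> ?V \<inter> ball x r" "x + v \<in> ?V \<inter> ball x r"
      using x r v add[OF x v(1)] by (simp_all add: dist_norm del: mem_Collect_eq)
    then have "x \<in> closure (G n)" "x + v \<in> closure (G n)"
      using sub by blast+
    then obtain y y' where y: "y \<in> G n" "dist y x < e / 2" "y' \<in> G n" "dist y' (x + v) < e / 2"
      using e unfolding closure_approachable by (metis half_gt_zero)
    then obtain a b a' b' where ab: "y = a + b" "a \<in> A" "b \<in> B" "norm a \<le> real n"
      "y' = a' + b'" "a' \<in> A" "b' \<in> B" "norm a' \<le> real n" by (auto simp: G_def)
    have "norm (a' - a) \<le> 2 * real n" using ab norm_triangle_ineq4[of a' a] by linarith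
    moreover have "norm (v - ((a' - a) + (b' - b))) < e"
    proof -
      have eq: "v - ((a' - a) + (b' - b)) = (y - x) - (y' - (x + v))" using ab by simp
      show ?thesis unfolding eq
        using y(2,4) norm_triangle_ineq4[of "y - x" "y' - (x + v)"] by (simp only: dist_norm)
    qed
    ultimately show ?thesis using ab A B by (intro bexI[of _ "a' - a"] bexI[of _ "b' - b"]) (auto intro: subspace_diff)
  qed
  \<comment> \<open>A nonzero \<open>v\<close> is scaled by \<open>s = r / (2 * norm v)\<close> to
    norm \<open>r / 2\<close>; undoing this turns the bound \<open>2 * real n\<close> into
    \<open>C * norm v\<close>.\<close>
  define C where "C = 4 * real n / r"
  have C: "0 \<le> C" using r by (simp add: C_def)
  have scaled: "\<exists>a b. a \<in> A \<and> b \<in> B \<and> norm a \<le> C * norm v \<and> norm (v - (a + b)) < e"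
    if v: "v \<in> ?V" and e: "0 < e" for v e
  proof (cases "v = 0")
    case True
    then show ?thesis using zero e by (intro exI[of _ 0]) auto
  next
    case False
    define s where "s = r / (2 * norm v)"
    have s: "0 < s" using False r by (simp add: s_def)
    have scale: "t *\<^sub>R a \<in> A" "t *\<^sub>R b \<in> B" if "a \<in> A" "b \<in> B" for a b t
      using that A B by (auto intro: subspace_scale)
    obtain a0 b0 where "v = a0 + b0" "a0 \<in> A" "b0 \<in> B" using v by auto
    then have "s *\<^sub>R v = s *\<^sub>R a0 + s *\<^sub>R b0" "s *\<^sub>R a0 \<in> A" "s *\<^sub>R b0 \<in> B"
      using scale by (auto simp: scaleR_add_right)
    then have "s *\<^sub>R v \<in> ?V" by blast
    moreover have "norm (s *\<^sub>R v) < r" using False r by (simp add: s_def)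
    moreover have "0 < s * e" using s e by simp
    ultimately obtain a b where ab: "a \<in> A" "b \<in> B" "norm a \<le> 2 * real n"
      "norm (s *\<^sub>R v - (a + b)) < s * e" using near by blast
    have "v - ((1 / s) *\<^sub>R a + (1 / s) *\<^sub>R b) = (1 / s) *\<^sub>R (s *\<^sub>R v - (a + b))"
      using s by (simp add: scaleR_diff_right scaleR_add_right)
    then have "norm (v - ((1 / s) *\<^sub>R a + (1 / s) *\<^sub>R b)) = norm (s *\<^sub>R v - (a + b)) / s"
      using s by simp
    also have "\<dots> < e" using ab(4) s by (simp add: field_simps)
    finally have 1: "norm (v - ((1 / s) *\<^sub>R a + (1 / s) *\<^sub>R b)) < e" .
    have "norm ((1 / s) *\<^sub>R a) = norm a / s" using s by simp
    also have "\<dots> \<le> 2 * real n / s" using ab(3) s by (simp add: divide_right_mono)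
    also have "\<dots> = C * norm v" using False r by (simp add: s_def C_def field_simps)
    finally show ?thesis using 1 scale[OF ab(1,2)] by blast
  qed
  have bound: "norm a \<le> 2 * C * norm (a + b)" if ab: "a \<in> A" "b \<in> B" for a b
  proof (cases "a + b = 0")
    case True
    then have "a = - b" by (simp add: eq_neg_iff_add_eq_0)
    then have "a \<in> A \<inter> B" using ab B by (simp add: subspace_neg)
    then show ?thesis using AB C by simp
  next
    case False
    define v where "v = a + b"
    have v: "v \<in> ?V" "0 < norm v" using ab False by (auto simp: v_def)
    define \<pi> where "\<pi> w e = (SOME ab. fst ab \<in> A \<and> snd ab \<in> B \<and>
      norm (fst ab) \<le> C * norm w \<and> norm (w - (fst ab + snd ab)) < e)" for w and e :: real
    define \<alpha> \<beta> where "\<alpha> w e = fst (\<pi> w e)" and "\<beta> w e = snd (\<pi> w e)" for w e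
    have \<alpha>\<beta>: "\<alpha> w e \<in> A \<and> \<beta> w e \<in> B \<and>
      norm (\<alpha> w e) \<le> C * norm w \<and> norm (w - (\<alpha> w e + \<beta> w e)) < e" if w: "w \<in> ?V" "0 < e" for w e
      unfolding \<alpha>_def \<beta>_def \<pi>_def
    proof (rule someI_ex)
      obtain a b where "a \<in> A \<and> b \<in> B \<and> norm a \<le> C * norm w \<and> norm (w - (a + b)) < e"
        using scaled[OF w] by blast
      then show "\<exists>ab. fst ab \<in> A \<and> snd ab \<in> B \<and> norm (fst ab) \<le> C * norm w \<and> norm (w - (fst ab + snd ab)) < e"
        by (intro exI[of _ "(a, b)"]) simp
    qed
    \<comment> \<open>With these tolerances the residual \<open>w k\<close> has norm at most
      \<open>norm v / 2^k\<close>, so the corrections in \<open>A\<close> are bounded by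
      \<open>C * norm v / 2^k\<close> and sum up to at most \<open>2 * C * norm v\<close>.\<close>
    define \<delta> where "\<delta> k = norm v * (1 / 2) ^ Suc k" for k
    have \<delta>: "0 < \<delta> k" for k using v by (simp add: \<delta>_def)
    define w where "w = rec_nat v (\<lambda>k u. u - (\<alpha> u (\<delta> k) + \<beta> u (\<delta> k)))"
    define p q where "p k = \<alpha> (w k) (\<delta> k)" and "q k = \<beta> (w k) (\<delta> k)" for k
    have w0: "w 0 = v" and wS: "w (Suc k) = w k - (p k + q k)" for k
      by (simp_all add: w_def p_def q_def)
    have inv: "w k \<in> ?V \<and> norm (w k) \<le> norm v * (1 / 2) ^ k" for k
    proof (induction k)
      case 0
      then show ?case using v by (simp add: w0)
    next
      case (Suc k)
      have pq: "p k \<in> A" "q k \<in> B" "norm (w k - (p k + q k)) < \<delta> k"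
        using \<alpha>\<beta>[of "w k" "\<delta> k"] Suc \<delta> by (auto simp: p_def q_def)
      have "- p k + - q k \<in> ?V" using pq A B subspace_neg by blast
      then have "w k + (- p k + - q k) \<in> ?V" using Suc add by blast
      moreover have "w k + (- p k + - q k) = w (Suc k)" by (simp add: wS)
      ultimately have "w (Suc k) \<in> ?V" by (simp only:)
      moreover have "norm (w (Suc k)) \<le> norm v * (1 / 2) ^ Suc k" using pq by (simp add: wS \<delta>_def)
      ultimately show ?case by blast
    qed
    have pq: "p k \<in> A" "q k \<in> B" "norm (p k) \<le> C * norm v * (1 / 2) ^ k" for k
    proof -
      show "p k \<in> A" "q k \<in> B" using \<alpha>\<beta>[of "w k" "\<delta> k"] inv \<delta> by (auto simp: p_def q_def)
      have "norm (p k) \<le> C * norm (w k)"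
        using \<alpha>\<beta>[of "w k" "\<delta> k"] inv \<delta> by (auto simp: p_def)
      also have "\<dots> \<le> C * (norm v * (1 / 2) ^ k)" using inv C by (intro mult_left_mono) auto
      finally show "norm (p k) \<le> C * norm v * (1 / 2) ^ k" by simp
    qed
    have geo: "summable (\<lambda>k. C * norm v * (1 / 2) ^ k)" "(\<Sum>k. C * norm v * (1 / 2 :: real) ^ k) = 2 * C * norm v"
      using suminf_mult[OF summable_geometric[of "1/2::real"], of "C * norm v"] suminf_geometric[of "1/2::real"]
      by (auto intro!: summable_mult summable_geometric)
    have sp: "summable p" by (rule summable_comparison_test'[OF geo(1)]) (use pq in auto)
    define a' where "a' = suminf p"
    have lim_p: "(\<lambda>n. \<Sum>k<n. p k) \<longlonglongrightarrow> a'" using sp unfolding a'_def by (rule summable_LIMSEQ)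
    have "w n = v - (\<Sum>k<n. p k) - (\<Sum>k<n. q k)" for n
      by (induction n) (simp_all add: w0 wS)
    \<comment> \<open>Convergence of the corrections in \<open>B\<close> is read off from this
      identity, the other two terms being convergent.\<close>
    then have q_eq: "(\<Sum>k<n. q k) = v - (\<Sum>k<n. p k) - w n" for n by simp
    have "(\<lambda>n. norm v * (1 / 2) ^ n) \<longlonglongrightarrow> norm v * 0"
      by (intro tendsto_intros LIMSEQ_realpow_zero) auto
    then have lim0: "(\<lambda>n. norm v * (1 / 2) ^ n) \<longlonglongrightarrow> 0" by simp
    have "w \<longlonglongrightarrow> 0"
      by (rule Lim_null_comparison[OF always_eventually lim0]) (use inv in blast)
    then have "(\<lambda>n. \<Sum>k<n. q k) \<longlonglongrightarrow> v - a' - 0"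
      unfolding q_eq by (intro tendsto_intros lim_p)
    then have lim_q: "(\<lambda>n. \<Sum>k<n. q k) \<longlonglongrightarrow> v - a'" by simp
    have b': "v - a' \<in> B"
      using closed_sequentially[OF B(2) _ lim_q] pq B by (auto intro!: subspace_sum)
    have a': "a' \<in> A"
      using closed_sequentially[OF A(2) _ lim_p] pq A by (auto intro!: subspace_sum)
    have "a - a' = (v - a') - b" by (simp add: v_def)
    then have "a - a' \<in> A \<inter> B" using a' b' ab A B by (metis IntI subspace_diff)
    then have "a = a'" using AB by auto
    moreover have "norm a' \<le> 2 * C * norm v"
      unfolding a'_def geo(2)[symmetric] by (intro norm_suminf_le pq geo)
    ultimately show ?thesis by (simp add: v_def)
  qed
  show ?thesis using bound C by (intro exI[of _ "2 * C"]) auto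
qed

text \<open>Norm and completeness are available separately; their combination opens the type to
  results on series in Banach spaces.\<close>

instance bcontfun :: (metric_space, banach) banach ..

section \<open>Complex scaling of bounded complex functions\<close>

definition cscale :: "complex \<Rightarrow> ('i::topological_space \<Rightarrow>\<^sub>C complex) \<Rightarrow> 'i \<Rightarrow>\<^sub>C complex" where
  "cscale a g = Bcontfun (\<lambda>x. a * apply_bcontfun g x)"

lemma apply_cscale [simp]: "apply_bcontfun (cscale a g) x = a * apply_bcontfun g x"
proof -
  have "(\<lambda>x. a * apply_bcontfun g x) \<in> bcontfun"
    by (rule bcontfun_normI[where b = "cmod a * norm g"])
       (auto intro!: continuous_intros mult_left_mono norm_bounded simp: norm_mult)
  then show ?thesis by (simp add: cscale_def Bcontfun_inverse)
qed

lemma cscale_simps [simp]: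
  "cscale a (cscale b g) = cscale (a * b) g" "cscale 1 g = g" "cscale 0 g = 0" "cscale a 0 = 0"
  "cscale (- 1) g = - g"
  by (auto intro!: bcontfun_eqI simp: mult.assoc)

lemma cscale_add: "cscale a (g + h) = cscale a g + cscale a h"
  and cscale_diff: "cscale a (g - h) = cscale a g - cscale a h"
  and cscale_diff_left: "cscale (a - b) g = cscale a g - cscale b g"
  and scaleR_eq_cscale: "r *\<^sub>R g = cscale (of_real r) g"
  by (auto intro!: bcontfun_eqI simp: algebra_simps scaleR_conv_of_real)

lemma norm_cscale_le: "norm (cscale a g) \<le> cmod a * norm g"
  by (rule norm_bound) (auto simp: norm_mult intro!: mult_left_mono norm_bounded)

lemma norm_cscale [simp]: "norm (cscale a g) = cmod a * norm g"
proof (cases "a = 0")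
  case False
  have "norm g \<le> cmod (inverse a) * norm (cscale a g)"
    using norm_cscale_le[of "inverse a" "cscale a g"] False by simp
  then have "cmod a * norm g \<le> cmod a * (cmod (inverse a) * norm (cscale a g))"
    by (intro mult_left_mono) auto
  also have "\<dots> = norm (cscale a g)" using False by (simp add: norm_inverse)
  finally have "cmod a * norm g \<le> norm (cscale a g)" .
  then show ?thesis using norm_cscale_le[of a g] by simp
qed simp

definition csubspace :: "('i::topological_space \<Rightarrow>\<^sub>C complex) set \<Rightarrow> bool" where
  "csubspace V \<longleftrightarrow> 0 \<in> V \<and> (\<forall>x\<in>V. \<forall>y\<in>V. x + y \<in> V) \<and> (\<forall>a. \<forall>x\<in>V. cscale a x \<in> V)"

lemma csubspace_imp_subspace: "csubspace V \<Longrightarrow> subspace V"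
  by (auto simp: csubspace_def subspace_def scaleR_eq_cscale)

section \<open>Spectrum in the unit disk and summable powers\<close>

locale complex_operator =
  fixes V :: "('i::metric_space \<Rightarrow>\<^sub>C complex) set" and S c
  assumes csubspace: "csubspace V" and closed: "closed V"
    and S_mem: "\<And>x. x \<in> V \<Longrightarrow> S x \<in> V"
    and S_add: "\<And>x y. x \<in> V \<Longrightarrow> y \<in> V \<Longrightarrow> S (x + y) = S x + S y"
    and S_scale: "\<And>a x. x \<in> V \<Longrightarrow> S (cscale a x) = cscale a (S x)"
    and S_bound: "\<And>x. x \<in> V \<Longrightarrow> norm (S x) \<le> c * norm x"
    and c_nonneg: "0 \<le> c"
begin

lemma V_closure: "0 \<in> V" "x \<in> V \<Longrightarrow> y \<in> V \<Longrightarrow> x + y \<in> V" "x \<in> V \<Longrightarrow> y \<in> V \<Longrightarrow> x - y \<in> V"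
  "x \<in> V \<Longrightarrow> cscale a x \<in> V"
  using csubspace csubspace_imp_subspace[OF csubspace] by (auto simp: csubspace_def subspace_diff)

lemma S_diff: "x \<in> V \<Longrightarrow> y \<in> V \<Longrightarrow> S (x - y) = S x - S y"
  using S_add[of "x - y" y] by (simp add: V_closure)

lemma iterate_mem: "x \<in> V \<Longrightarrow> (S ^^ n) x \<in> V"
  using S_mem by (auto intro: funpow_mem)

text \<open>This is \<open>1 - \<zeta> S\<close>, where \<open>\<zeta>\<close> is the inverse of a
  spectral parameter. Spectrum in the open disk then means invertibility on the whole closed disk, a
  compact set around the centre 0 of the Taylor expansion.\<close>

definition D :: "complex \<Rightarrow> ('i \<Rightarrow>\<^sub>C complex) \<Rightarrow> 'i \<Rightarrow>\<^sub>C complex" where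
  "D \<zeta> x = x - cscale \<zeta> (S x)"

lemma D_mem: "x \<in> V \<Longrightarrow> D \<zeta> x \<in> V"
  by (simp add: D_def V_closure S_mem)

lemma D_add: "x \<in> V \<Longrightarrow> y \<in> V \<Longrightarrow> D \<zeta> (x + y) = D \<zeta> x + D \<zeta> y"
  by (simp add: D_def S_add cscale_add)

lemma D_diff: "x \<in> V \<Longrightarrow> y \<in> V \<Longrightarrow> D \<zeta> (x - y) = D \<zeta> x - D \<zeta> y"
  by (simp add: D_def S_diff cscale_diff)

lemma D_scale: "x \<in> V \<Longrightarrow> D \<zeta> (cscale a x) = cscale a (D \<zeta> x)"
  by (simp add: D_def S_scale cscale_diff mult.commute)

lemma D_change: "D \<zeta> x = D \<zeta>' x - cscale (\<zeta> - \<zeta>') (S x)"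
  by (simp add: D_def cscale_diff_left)

text \<open>Summability of the powers makes the Neumann series converge up to and including the
  circle \<open>cmod \<zeta> = 1\<close>. Applied to \<open>D \<zeta> x\<close> the series
  telescopes to \<open>x\<close>, which bounds \<open>D \<zeta>\<close> from below; its sum at
  \<open>y\<close> is a preimage of \<open>y\<close>.\<close>

lemma neumann:
  assumes a: "summable a" "\<And>n. 0 \<le> a n" "\<And>n x. x \<in> V \<Longrightarrow> norm ((S ^^ n) x) \<le> a n * norm x"
    and \<zeta>: "cmod \<zeta> \<le> 1"
  shows "bij_betw (D \<zeta>) V V" "\<exists>m>0. \<forall>x\<in>V. m * norm x \<le> norm (D \<zeta> x)"
proof -
  have pow: "cmod \<zeta> ^ n \<le> 1" for n using \<zeta> by (simp add: power_le_one)
  have term_le: "norm (cscale (\<zeta> ^ n) ((S ^^ n) x)) \<le> a n * norm x" if "x \<in> V" for n x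
  proof -
    have "cmod \<zeta> ^ n * norm ((S ^^ n) x) \<le> 1 * (a n * norm x)"
      by (intro mult_mono pow a that) auto
    then show ?thesis by (simp add: norm_power)
  qed
  have S_pow_D: "(S ^^ n) (D \<zeta> x) = (S ^^ n) x - cscale \<zeta> ((S ^^ Suc n) x)" if "x \<in> V" for n x
    by (induction n) (simp_all add: D_def S_diff S_scale V_closure S_mem iterate_mem that)
  have tele: "(\<Sum>k<n. cscale (\<zeta> ^ k) ((S ^^ k) (D \<zeta> x))) = x - cscale (\<zeta> ^ n) ((S ^^ n) x)"
    if "x \<in> V" for n x
    by (induction n) (simp_all add: S_pow_D[OF that] cscale_diff mult.commute)
  have a0: "a \<longlonglongrightarrow> 0" using a(1) by (rule summable_LIMSEQ_zero)
  have lower: "norm x \<le> suminf a * norm (D \<zeta> x)" if x: "x \<in> V" for x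
  proof (rule LIMSEQ_le_const)
    have "(\<lambda>n. suminf a * norm (D \<zeta> x) + a n * norm x) \<longlonglongrightarrow> suminf a * norm (D \<zeta> x) + 0 * norm x"
      by (intro tendsto_intros a0)
    then show "(\<lambda>n. suminf a * norm (D \<zeta> x) + a n * norm x) \<longlonglongrightarrow> suminf a * norm (D \<zeta> x)" by simp
    have "norm x \<le> suminf a * norm (D \<zeta> x) + a n * norm x" for n
    proof -
      have eq: "x = (\<Sum>k<n. cscale (\<zeta> ^ k) ((S ^^ k) (D \<zeta> x))) + cscale (\<zeta> ^ n) ((S ^^ n) x)"
        by (simp only: tele[OF x] diff_add_cancel)
      have "norm (\<Sum>k<n. cscale (\<zeta> ^ k) ((S ^^ k) (D \<zeta> x))) \<le> (\<Sum>k<n. a k * norm (D \<zeta> x))"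
        by (intro sum_norm_le term_le D_mem x)
      from norm_triangle_mono[OF this term_le[OF x, of n]]
      have "norm x \<le> (\<Sum>k<n. a k * norm (D \<zeta> x)) + a n * norm x" by (simp only: eq[symmetric])
      also have "(\<Sum>k<n. a k * norm (D \<zeta> x)) \<le> suminf a * norm (D \<zeta> x)"
        unfolding sum_distrib_right[symmetric] by (intro mult_right_mono sum_le_suminf a) auto
      finally show ?thesis by simp
    qed
    then show "\<exists>N. \<forall>n\<ge>N. norm x \<le> suminf a * norm (D \<zeta> x) + a n * norm x" by blast
  qed
  have sa: "0 \<le> suminf a" using a by (intro suminf_nonneg)
  show "\<exists>m>0. \<forall>x\<in>V. m * norm x \<le> norm (D \<zeta> x)"
  \<comment> \<open>The added 1 covers the case that all \<open>a n\<close> vanish.\<close>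
  proof (intro exI[of _ "1 / (suminf a + 1)"] conjI ballI)
    fix x assume "x \<in> V"
    then have "norm x \<le> (suminf a + 1) * norm (D \<zeta> x)"
      using lower[of x] norm_ge_zero[of "D \<zeta> x"] unfolding ring_distribs by linarith
    then show "1 / (suminf a + 1) * norm x \<le> norm (D \<zeta> x)" using sa by (simp add: field_simps)
  qed (use sa in simp)
  have "inj_on (D \<zeta>) V"
  proof (rule inj_onI)
    fix x y assume "x \<in> V" "y \<in> V" "D \<zeta> x = D \<zeta> y"
    then show "x = y" using lower[of "x - y"] by (simp add: D_diff V_closure)
  qed
  moreover have "y \<in> D \<zeta> ` V" if y: "y \<in> V" for y
  proof -
    let ?x = "\<lambda>k. cscale (\<zeta> ^ k) ((S ^^ k) y)"
    have s: "summable ?x"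
      by (rule summable_comparison_test'[where g = "\<lambda>n. a n * norm y"]) (use a y term_le in \<open>auto intro: summable_mult2\<close>)
    have lim: "(\<lambda>n. \<Sum>k<n. ?x k) \<longlonglongrightarrow> suminf ?x" using s by (rule summable_LIMSEQ)
    have pV: "(\<Sum>k<n. ?x k) \<in> V" for n
      by (intro subspace_sum csubspace_imp_subspace csubspace V_closure iterate_mem y)
    have xV: "suminf ?x \<in> V" using closed_sequentially[OF closed _ lim] pV by blast
    have S_part: "S (\<Sum>k<n. ?x k) = (\<Sum>k<n. S (?x k))" for n
    proof (induction n)
      case 0
      then show ?case using S_scale[of 0 0] V_closure(1) by simp
    qed (use pV in \<open>simp add: S_add V_closure iterate_mem y\<close>)
    have "D \<zeta> (\<Sum>k<n. ?x k) = y - cscale (\<zeta> ^ n) ((S ^^ n) y)" for n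
    proof -
      have "D \<zeta> (\<Sum>k<n. ?x k) = (\<Sum>k<n. ?x k) - cscale \<zeta> (\<Sum>k<n. S (?x k))"
        by (simp add: D_def S_part)
      also have "\<dots> = y - ?x n"
      proof (induction n)
        case (Suc n)
        have "cscale \<zeta> (S (?x n)) = ?x (Suc n)" by (simp add: S_scale iterate_mem y)
        then show ?case using Suc by (simp add: cscale_add algebra_simps del: cscale_simps(1) funpow.simps power_Suc)
      qed simp
      finally show ?thesis .
    qed note DD = this
    have "(\<lambda>n. cscale (\<zeta> ^ n) ((S ^^ n) y)) \<longlonglongrightarrow> 0"
      using s by (rule summable_LIMSEQ_zero)
    then have "(\<lambda>n. y - cscale (\<zeta> ^ n) ((S ^^ n) y)) \<longlonglongrightarrow> y - 0" by (intro tendsto_intros)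
    then have 1: "(\<lambda>n. D \<zeta> (\<Sum>k<n. ?x k)) \<longlonglongrightarrow> y" unfolding DD by simp
    have D_bd: "norm (D \<zeta> x) \<le> (1 + c) * norm x" if "x \<in> V" for x
    proof -
      have "norm (D \<zeta> x) \<le> norm x + cmod \<zeta> * norm (S x)" unfolding D_def using norm_triangle_ineq4[of x "cscale \<zeta> (S x)"] by simp
      also have "\<dots> \<le> norm x + 1 * (c * norm x)" by (intro add_left_mono mult_mono \<zeta> S_bound that) auto
      finally show ?thesis by (simp add: algebra_simps)
    qed
    have "(\<lambda>n. (1 + c) * norm ((\<Sum>k<n. ?x k) - suminf ?x)) \<longlonglongrightarrow> (1 + c) * 0"
      using lim by (intro tendsto_intros) (simp add: LIM_zero tendsto_norm_zero)
    then have "(\<lambda>n. D \<zeta> (\<Sum>k<n. ?x k) - D \<zeta> (suminf ?x)) \<longlonglongrightarrow> 0"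
      using Lim_null_comparison[OF always_eventually[OF allI[OF D_bd[OF V_closure(3)[OF pV xV]]]]]
      by (simp add: D_diff[OF pV xV])
    then have "(\<lambda>n. D \<zeta> (\<Sum>k<n. ?x k)) \<longlonglongrightarrow> D \<zeta> (suminf ?x)" by (rule LIM_zero_cancel)
    with 1 have "y = D \<zeta> (suminf ?x)" by (rule LIMSEQ_unique)
    then show ?thesis using xV by blast
  qed
  ultimately show "bij_betw (D \<zeta>) V V" using D_mem by (auto simp: bij_betw_def)
qed

end

section \<open>Decay of powers from the resolvent\<close>

locale resolvent = complex_operator +
  assumes D_bij: "\<And>\<zeta>. cmod \<zeta> \<le> 1 \<Longrightarrow> bij_betw (D \<zeta>) V V"
    and D_lower: "\<And>\<zeta>. cmod \<zeta> \<le> 1 \<Longrightarrow> \<exists>m>0. \<forall>x\<in>V. m * norm x \<le> norm (D \<zeta> x)"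
begin

text \<open>A lower bound \<open>\<mu> \<zeta>'\<close> at one point survives with half its size on
  a disk of radius proportional to \<open>\<mu> \<zeta>'\<close>, as \<open>D\<close> depends on the
  parameter with Lipschitz constant at most \<open>c\<close>. Finitely many such disks cover the
  closed unit disk; hence also the half in the definition of \<open>m\<close>.\<close>

lemma uniform_lower: "\<exists>m>0. \<forall>\<zeta>\<in>cball 0 1. \<forall>x\<in>V. m * norm x \<le> norm (D \<zeta> x)"
proof -
  obtain \<mu> where \<mu>: "\<And>\<zeta>. cmod \<zeta> \<le> 1 \<Longrightarrow> 0 < \<mu> \<zeta> \<and> (\<forall>x\<in>V. \<mu> \<zeta> * norm x \<le> norm (D \<zeta> x))"
    using D_lower by metis
  let ?r = "\<lambda>\<zeta>. \<mu> \<zeta> / (2 * (c + 1))"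
  have r: "0 < ?r \<zeta>" if "cmod \<zeta> \<le> 1" for \<zeta> using \<mu>[OF that] c_nonneg by (auto intro!: divide_pos_pos)
  have cov: "cball 0 1 \<subseteq> (\<Union>\<zeta>\<in>cball 0 1. ball \<zeta> (?r \<zeta>))"
  proof
    fix \<zeta> :: complex assume z: "\<zeta> \<in> cball 0 1"
    then have "\<zeta> \<in> ball \<zeta> (?r \<zeta>)" using r[of \<zeta>] by simp
    with z show "\<zeta> \<in> (\<Union>\<zeta>\<in>cball 0 1. ball \<zeta> (?r \<zeta>))" by blast
  qed
  obtain F where F: "F \<subseteq> cball 0 1" "finite F" "cball 0 1 \<subseteq> (\<Union>\<zeta>\<in>F. ball \<zeta> (?r \<zeta>))"
    by (rule compactE_image[of "cball (0::complex) 1" "cball 0 1" "\<lambda>\<zeta>. ball \<zeta> (?r \<zeta>)"])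
       (use cov in auto)
  have ne: "F \<noteq> {}" using F(3) by fastforce
  define m where "m = Min (\<mu> ` F) / 2"
  have m0: "0 < m" unfolding m_def using F ne \<mu> by auto
  have "m * norm x \<le> norm (D \<zeta> x)" if "\<zeta> \<in> cball 0 1" "x \<in> V" for \<zeta> x
  proof -
    have "\<zeta> \<in> (\<Union>\<zeta>\<in>F. ball \<zeta> (?r \<zeta>))" using F(3) that(1) by blast
    then obtain \<zeta>' where "\<zeta>' \<in> F" "\<zeta> \<in> ball \<zeta>' (?r \<zeta>')" by blast
    then have \<zeta>': "\<zeta>' \<in> F" "dist \<zeta>' \<zeta> < ?r \<zeta>'" by (simp_all only: mem_ball)
    have le: "cmod \<zeta>' \<le> 1" using F(1) \<zeta>'(1) by auto
    have "cmod (\<zeta> - \<zeta>') * norm (S x) \<le> ?r \<zeta>' * (c * norm x)"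
      using \<zeta>'(2) r[OF le] by (intro mult_mono S_bound that) (auto simp: dist_norm norm_minus_commute)
    also have "\<dots> = (?r \<zeta>' * c) * norm x" by simp
    also have "\<dots> \<le> (\<mu> \<zeta>' / 2) * norm x"
      using \<mu>[OF le] c_nonneg by (intro mult_right_mono) (auto simp: field_simps)
    finally have 1: "norm (cscale (\<zeta> - \<zeta>') (S x)) \<le> \<mu> \<zeta>' / 2 * norm x" by simp
    have "\<mu> \<zeta>' * norm x \<le> norm (D \<zeta>' x)" using \<mu>[OF le] that by blast
    moreover have "norm (D \<zeta>' x) - norm (cscale (\<zeta> - \<zeta>') (S x)) \<le> norm (D \<zeta> x)"
      unfolding D_change[of \<zeta> x \<zeta>'] by (rule norm_triangle_ineq2)
    ultimately have "\<mu> \<zeta>' / 2 * norm x \<le> norm (D \<zeta> x)" using 1 by (simp add: algebra_simps)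
    moreover have "m \<le> \<mu> \<zeta>' / 2" unfolding m_def using F \<zeta>' by (intro divide_right_mono Min_le) auto
    ultimately show ?thesis by (meson mult_right_mono norm_ge_zero order_trans)
  qed
  then show ?thesis using m0 by blast
qed

definition R where "R \<zeta> = inv_into V (D \<zeta>)"

lemma R_mem: "cmod \<zeta> \<le> 1 \<Longrightarrow> y \<in> V \<Longrightarrow> R \<zeta> y \<in> V"
  unfolding R_def using self_bij_inv_mem[OF D_bij] by blast

lemma D_R: "cmod \<zeta> \<le> 1 \<Longrightarrow> y \<in> V \<Longrightarrow> D \<zeta> (R \<zeta> y) = y"
  unfolding R_def using self_bij_right_inv[OF D_bij] by blast

lemma R_unique: "cmod \<zeta> \<le> 1 \<Longrightarrow> x \<in> V \<Longrightarrow> D \<zeta> x = y \<Longrightarrow> R \<zeta> y = x"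
  unfolding R_def using self_bij_left_inv[OF D_bij] by blast

text \<open>It serves twice: as a Lipschitz estimate up to the boundary of the disk, and as an exact
  formula for the difference quotients of \<open>R \<zeta> y\<close>.\<close>

lemma resolvent_identity:
  assumes "cmod \<zeta> \<le> 1" "cmod \<zeta>' \<le> 1" "y \<in> V"
  shows "R \<zeta> y - R \<zeta>' y = cscale (\<zeta> - \<zeta>') (R \<zeta> (S (R \<zeta>' y)))"
proof -
  have "R \<zeta> y = R \<zeta>' y + cscale (\<zeta> - \<zeta>') (R \<zeta> (S (R \<zeta>' y)))"
  proof (rule R_unique)
    have "D \<zeta> (R \<zeta>' y) = y - cscale (\<zeta> - \<zeta>') (S (R \<zeta>' y))"
      using D_change[of \<zeta> "R \<zeta>' y" \<zeta>'] assms by (simp add: D_R)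
    then show "D \<zeta> (R \<zeta>' y + cscale (\<zeta> - \<zeta>') (R \<zeta> (S (R \<zeta>' y)))) = y"
      using assms by (simp add: D_add D_scale R_mem S_mem V_closure D_R)
  qed (use assms in \<open>auto intro!: V_closure R_mem S_mem\<close>)
  then show ?thesis by simp
qed

text \<open>The values of \<open>S^n y\<close> at an index \<open>\<psi>\<close> are the Taylor
  coefficients at 0 of the value of the resolvent there. A bound for the resolvent on the unit disk
  would merely show that powers are bounded; the bound \<open>L\<close> for its derivative shows
  that they decay like \<open>1 / n\<close>, so that some power halves the norm and its iterates
  decay geometrically.\<close>

lemma summable_powers:
  "\<exists>a. summable a \<and> (\<forall>n. 0 \<le> a n) \<and> (\<forall>n. \<forall>x\<in>V. norm ((S ^^ n) x) \<le> a n * norm x)"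
proof -
  obtain m where m: "0 < m" "\<And>\<zeta> x. cmod \<zeta> \<le> 1 \<Longrightarrow> x \<in> V \<Longrightarrow> m * norm x \<le> norm (D \<zeta> x)"
    using uniform_lower by auto
  define M where "M = 1 / m"
  have M: "0 \<le> M" using m by (simp add: M_def)
  have R_bound: "norm (R \<zeta> y) \<le> M * norm y" if "cmod \<zeta> \<le> 1" "y \<in> V" for \<zeta> y
    using m(2)[OF that(1) R_mem[OF that]] m(1) that by (simp add: M_def D_R field_simps)
  define G where "G y \<psi> \<zeta> = apply_bcontfun (R \<zeta> y) \<psi>" for y \<psi> \<zeta>
  have G_bound: "cmod (G y \<psi> \<zeta>) \<le> M * norm y" if "cmod \<zeta> \<le> 1" "y \<in> V" for y \<psi> \<zeta>
    unfolding G_def using norm_bounded[of "R \<zeta> y" \<psi>] R_bound[OF that] by simp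
  have G_diff: "G y \<psi> \<zeta> - G y \<psi> \<zeta>' = (\<zeta> - \<zeta>') * G (S (R \<zeta>' y)) \<psi> \<zeta>"
    if "cmod \<zeta> \<le> 1" "cmod \<zeta>' \<le> 1" "y \<in> V" for y \<psi> \<zeta> \<zeta>'
    using arg_cong[OF resolvent_identity[OF that], of "\<lambda>g. apply_bcontfun g \<psi>"] by (simp add: G_def)
  have SR_bound: "norm (S (R \<zeta> y)) \<le> c * (M * norm y)" if "cmod \<zeta> \<le> 1" "y \<in> V" for y \<zeta>
    using S_bound[OF R_mem[OF that]] mult_left_mono[OF R_bound[OF that] c_nonneg] by linarith
  have G_cont: "continuous_on (cball 0 1) (G y \<psi>)" if "y \<in> V" for y \<psi>
  proof (rule lipschitz_on_continuous_on[where L = "M * (c * (M * norm y))"], rule lipschitz_onI)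
    fix \<zeta> \<zeta>' :: complex assume z: "\<zeta> \<in> cball 0 1" "\<zeta>' \<in> cball 0 1"
    then have "cmod (G (S (R \<zeta>' y)) \<psi> \<zeta>) \<le> M * norm (S (R \<zeta>' y))"
      by (intro G_bound S_mem R_mem that) auto
    also have "\<dots> \<le> M * (c * (M * norm y))" using z that by (intro mult_left_mono SR_bound M) auto
    finally have "cmod (\<zeta> - \<zeta>') * cmod (G (S (R \<zeta>' y)) \<psi> \<zeta>) \<le> cmod (\<zeta> - \<zeta>') * (M * (c * (M * norm y)))"
      by (intro mult_left_mono) auto
    then show "dist (G y \<psi> \<zeta>) (G y \<psi> \<zeta>') \<le> M * (c * (M * norm y)) * dist \<zeta> \<zeta>'"
      using z that by (simp add: dist_norm G_diff norm_mult mult.commute)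
  qed (use M c_nonneg in simp)
  have G_deriv: "(G y \<psi> has_field_derivative G (S (R \<zeta>' y)) \<psi> \<zeta>') (at \<zeta>')"
    if z: "\<zeta>' \<in> ball 0 1" and y: "y \<in> V" for y \<psi> \<zeta>'
  proof -
    let ?w = "S (R \<zeta>' y)"
    have w: "?w \<in> V" using z y by (intro S_mem R_mem) auto
    have "continuous_on (ball 0 1) (G ?w \<psi>)"
      using G_cont[OF w] by (rule continuous_on_subset) auto
    then have "isCont (G ?w \<psi>) \<zeta>'" using z by (simp add: continuous_on_eq_continuous_at)
    then have lim: "(G ?w \<psi> \<longlongrightarrow> G ?w \<psi> \<zeta>') (at \<zeta>')" by (simp add: isCont_def)
    have "\<forall>\<^sub>F \<zeta> in at \<zeta>'. \<zeta> \<in> ball 0 1"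
      using z by (intro eventually_at_in_open') auto
    moreover have "\<forall>\<^sub>F \<zeta> in at \<zeta>'. \<zeta> \<noteq> \<zeta>'" by (simp add: eventually_at_filter)
    \<comment> \<open>The difference quotient at \<open>\<zeta>'\<close> is itself the function
      \<open>G ?w \<psi>\<close>, so its limit comes from the continuity already shown.\<close>
    ultimately have "\<forall>\<^sub>F \<zeta> in at \<zeta>'. G ?w \<psi> \<zeta> = (G y \<psi> \<zeta> - G y \<psi> \<zeta>') / (\<zeta> - \<zeta>')"
      by eventually_elim (use z y in \<open>simp add: G_diff\<close>)
    then show ?thesis unfolding has_field_derivative_iff by (rule Lim_transform_eventually[OF lim])
  qed
  have G_hol: "G y \<psi> holomorphic_on ball 0 1" if "y \<in> V" for y \<psi>
    unfolding holomorphic_on_open[OF open_ball] using G_deriv[OF _ that] by blast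
  have R_expand: "R \<zeta> y = y + cscale \<zeta> (R \<zeta> (S y))" if "cmod \<zeta> \<le> 1" "y \<in> V" for \<zeta> y
    using that
    by (intro R_unique) (auto intro!: V_closure R_mem S_mem simp: D_add D_scale R_mem S_mem V_closure D_R, simp add: D_def)
  have coeff: "(deriv ^^ n) (G y \<psi>) 0 = fact n * apply_bcontfun ((S ^^ n) y) \<psi>" if "y \<in> V" for n y \<psi>
    using that
  proof (induction n arbitrary: y)
    case 0
    have "R 0 y = y" using 0 by (intro R_unique) (auto simp: D_def)
    then show ?case by (simp add: G_def)
  next
    case (Suc n)
    let ?F = "G (S y) \<psi>"
    have F: "?F holomorphic_on ball 0 1" using Suc by (intro G_hol S_mem)
    have "(deriv ^^ Suc n) (G y \<psi>) 0 = (deriv ^^ Suc n) (\<lambda>\<zeta>. apply_bcontfun y \<psi> + \<zeta> * ?F \<zeta>) 0"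
    proof (rule higher_deriv_transform_within_open[where S = "ball 0 1"])
      fix \<zeta> :: complex assume "\<zeta> \<in> ball 0 1"
      then show "G y \<psi> \<zeta> = apply_bcontfun y \<psi> + \<zeta> * ?F \<zeta>"
        using R_expand[of \<zeta> y] Suc.prems by (simp add: G_def)
    qed (use Suc F in \<open>auto intro!: holomorphic_intros G_hol\<close>)
    also have "\<dots> = (deriv ^^ Suc n) (\<lambda>\<zeta>. apply_bcontfun y \<psi>) 0 + (deriv ^^ Suc n) (\<lambda>\<zeta>. \<zeta> * ?F \<zeta>) 0"
      by (rule higher_deriv_add[where S = "ball 0 1"]) (use F in \<open>auto intro!: holomorphic_intros\<close>)
    also have "(deriv ^^ Suc n) (\<lambda>\<zeta>. apply_bcontfun y \<psi>) 0 = 0"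
      by (simp only: higher_deriv_const) simp
    also have "(deriv ^^ Suc n) (\<lambda>\<zeta>. \<zeta> * ?F \<zeta>) 0 =
        (\<Sum>i = 0..Suc n. of_nat (Suc n choose i) * (deriv ^^ i) (\<lambda>\<zeta>. \<zeta>) 0 * (deriv ^^ (Suc n - i)) ?F 0)"
      by (rule higher_deriv_mult[where S = "ball 0 1"]) (use F in \<open>auto intro!: holomorphic_intros\<close>)
    \<comment> \<open>In the Leibniz sum for \<open>\<zeta> * ?F \<zeta>\<close> at 0 only the first
      derivative of the identity is nonzero. Thus \<open>R_expand\<close> lowers the order by one
      and replaces \<open>y\<close> by \<open>S y\<close>.\<close>
    also have "\<dots> = (\<Sum>i\<in>{1}. of_nat (Suc n choose i) * (deriv ^^ i) (\<lambda>\<zeta>. \<zeta>) 0 * (deriv ^^ (Suc n - i)) ?F 0)"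
      by (rule sum.mono_neutral_right) (auto simp only: higher_deriv_ident, auto split: if_splits)
    also have "\<dots> = of_nat (Suc n) * (deriv ^^ n) ?F 0" by simp
    also have "(deriv ^^ n) ?F 0 = fact n * apply_bcontfun ((S ^^ n) (S y)) \<psi>"
      using Suc by (intro Suc.IH S_mem)
    also have "(S ^^ n) (S y) = (S ^^ Suc n) y" by (simp only: funpow_Suc_right o_apply)
    finally show ?case by (simp only: fact_Suc of_nat_mult mult.assoc add_0_left of_nat_fact)
  qed
  \<comment> \<open>The derivative of \<open>G y\<close> contains two resolvents and one factor
    \<open>S\<close>, whence the product of \<open>M\<close>, \<open>c\<close> and
    \<open>M\<close>.\<close>
  define L where "L = M * (c * M)"
  have L: "0 \<le> L" using M c_nonneg by (simp add: L_def)
  have decay: "real (Suc n) * norm ((S ^^ Suc n) y) \<le> L * norm y" if y: "y \<in> V" for n y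
  proof -
    have dG: "deriv (G y \<psi>) \<zeta> = G (S (R \<zeta> y)) \<psi> \<zeta>" if "\<zeta> \<in> ball 0 1" for \<zeta> \<psi>
      using G_deriv[OF that y] by (rule DERIV_imp_deriv)
    have dG_bound: "cmod (deriv (G y \<psi>) \<zeta>) \<le> L * norm y" if "\<zeta> \<in> ball 0 1" for \<zeta> \<psi>
    proof -
      have z: "cmod \<zeta> \<le> 1" using that by simp
      have "cmod (deriv (G y \<psi>) \<zeta>) \<le> M * norm (S (R \<zeta> y))"
        unfolding dG[OF that] by (intro G_bound S_mem R_mem z y)
      also have "\<dots> \<le> M * (c * (M * norm y))" by (intro mult_left_mono SR_bound M z y)
      finally show ?thesis by (simp add: L_def mult.assoc)
    qed
    have "cmod (of_nat (Suc n) * apply_bcontfun ((S ^^ Suc n) y) \<psi>) \<le> L * norm y" for \<psi>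
    proof (rule tendsto_lowerbound)
      \<comment> \<open>Cauchy's inequality holds on disks of radius \<open>r < 1\<close>; letting
        \<open>r\<close> tend to 1 removes the factor \<open>1 / r ^ n\<close>.\<close>
      have "((\<lambda>r::real. L * norm y / r ^ n) \<longlongrightarrow> L * norm y / 1 ^ n) (at_left 1)"
        by (intro tendsto_intros) auto
      then show "((\<lambda>r::real. L * norm y / r ^ n) \<longlongrightarrow> L * norm y) (at_left 1)" by simp
      have le: "cmod (of_nat (Suc n) * apply_bcontfun ((S ^^ Suc n) y) \<psi>) \<le> L * norm y / r ^ n"
        if r: "0 < r" "r < 1" for r
      proof -
        have hol: "deriv (G y \<psi>) holomorphic_on ball 0 1" by (intro holomorphic_deriv G_hol y) auto
        have "cmod ((deriv ^^ n) (deriv (G y \<psi>)) 0) \<le> fact n * (L * norm y) / r ^ n"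
        proof (rule Cauchy_inequality)
          show "deriv (G y \<psi>) holomorphic_on ball 0 r" using r by (intro holomorphic_on_subset[OF hol]) auto
          show "continuous_on (cball 0 r) (deriv (G y \<psi>))"
            using r by (intro continuous_on_subset[OF holomorphic_on_imp_continuous_on[OF hol]]) auto
        qed (use r in \<open>auto intro!: dG_bound\<close>)
        also have "(deriv ^^ n) (deriv (G y \<psi>)) 0 = fact (Suc n) * apply_bcontfun ((S ^^ Suc n) y) \<psi>"
          using coeff[OF y, of "Suc n" \<psi>] by (simp only: funpow_Suc_right o_apply)
        also have "\<dots> = fact n * (of_nat (Suc n) * apply_bcontfun ((S ^^ Suc n) y) \<psi>)"
          by (simp only: fact_Suc of_nat_mult of_nat_fact ac_simps)
        finally have "fact n * cmod (of_nat (Suc n) * apply_bcontfun ((S ^^ Suc n) y) \<psi>) \<le> fact n * (L * norm y / r ^ n)"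
          by (simp only: norm_mult norm_fact times_divide_eq_right)
        then show ?thesis by (simp only: mult_le_cancel_left_pos fact_gt_zero)
      qed
      show "\<forall>\<^sub>F r in at_left 1. cmod (of_nat (Suc n) * apply_bcontfun ((S ^^ Suc n) y) \<psi>) \<le> L * norm y / r ^ n"
        by (rule eventually_mono[OF eventually_at_left_real[OF zero_less_one]], rule le)
          (simp_all only: greaterThanLessThan_iff)
    qed auto
    then have "norm (cscale (of_nat (Suc n)) ((S ^^ Suc n) y)) \<le> L * norm y"
      by (intro norm_bound) (simp only: apply_cscale)
    then show ?thesis by (simp only: norm_cscale norm_of_nat)
  qed
  \<comment> \<open>The 1 is for the zeroth power, to which \<open>decay\<close> does not
    apply.\<close>
  define B where "B = max 1 L"
  have B: "1 \<le> B" by (simp add: B_def)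
  have power_bounded: "norm ((S ^^ n) y) \<le> B * norm y" if y: "y \<in> V" for n y
  proof (cases n)
    case 0
    then show ?thesis using mult_right_mono[OF B norm_ge_zero[of y]] by simp
  next
    case (Suc k)
    have "1 * norm ((S ^^ Suc k) y) \<le> real (Suc k) * norm ((S ^^ Suc k) y)" by (intro mult_right_mono) auto
    also have "\<dots> \<le> L * norm y" by (rule decay[OF y])
    also have "\<dots> \<le> B * norm y" by (intro mult_right_mono) (auto simp: B_def)
    finally show ?thesis using Suc by simp
  qed
  \<comment> \<open>The exponent \<open>N\<close> is chosen so that \<open>2 * L \<le> N\<close>,
    which turns \<open>decay\<close> into a contraction by 1/2. The case \<open>L = 0\<close> is
    separate because \<open>L\<close> is cancelled.\<close>
  obtain k where k: "2 * L \<le> real k" using real_arch_simple by blast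
  define N where "N = Suc k"
  have half: "norm ((S ^^ N) y) \<le> 1 / 2 * norm y" if y: "y \<in> V" for y
  proof -
    have "2 * L * norm ((S ^^ N) y) \<le> real N * norm ((S ^^ N) y)"
      using k by (intro mult_right_mono) (auto simp: N_def)
    also have "\<dots> \<le> L * norm y" using decay[OF y, of k] by (simp only: N_def)
    finally have *: "L * norm ((S ^^ N) y) \<le> L * (1 / 2 * norm y)" by simp
    show ?thesis
    proof (cases "L = 0")
      case True
      then have "real N * norm ((S ^^ N) y) \<le> 0" using decay[OF y, of k] by (simp only: N_def mult_zero_left)
      then have "norm ((S ^^ N) y) \<le> 0" by (simp add: N_def mult_le_0_iff)
      then show ?thesis using norm_ge_zero[of y] by linarith
    next
      case False
      then show ?thesis using * L by (metis less_eq_real_def mult_le_cancel_left_pos)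
    qed
  qed
  have halves: "norm ((S ^^ (N * q)) y) \<le> (1 / 2) ^ q * norm y" if y: "y \<in> V" for q y
  proof (induction q)
    case (Suc q)
    have "(S ^^ (N * Suc q)) y = (S ^^ N) ((S ^^ (N * q)) y)" by (simp add: funpow_add)
    also have "norm \<dots> \<le> 1 / 2 * norm ((S ^^ (N * q)) y)" by (intro half iterate_mem y)
    also have "\<dots> \<le> 1 / 2 * ((1 / 2) ^ q * norm y)" by (intro mult_left_mono Suc) auto
    finally show ?case by simp
  qed simp
  define \<theta> where "\<theta> = (1 / 2 :: real) powr (1 / real N)"
  have \<theta>: "0 < \<theta>" "\<theta> < 1"
    using powr_less_mono'[of "1/2::real" 0 "1 / real N"] by (auto simp: \<theta>_def N_def)
  \<comment> \<open>Rounding \<open>n / N\<close> down loses less than one factor 1/2, which the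
    constant 2 restores.\<close>
  have le: "(1 / 2) ^ (n div N) \<le> 2 * \<theta> ^ n" for n
  proof -
    have "real n / real N \<le> real (n div N) + 1"
    proof -
      have "n mod N < N" by (simp add: N_def)
      moreover have "real n = real N * real (n div N) + real (n mod N)"
        by (metis mult_div_mod_eq of_nat_add of_nat_mult)
      ultimately show ?thesis by (simp add: N_def field_simps del: of_nat_Suc)
    qed
    then have "(1 / 2 :: real) powr real (n div N) \<le> (1 / 2) powr (real n / real N - 1)"
      by (intro powr_mono') auto
    also have "\<dots> = 2 * (1 / 2) powr (real n / real N)" by (simp add: powr_diff)
    also have "(1 / 2 :: real) powr (real n / real N) = \<theta> ^ n"
      by (simp add: \<theta>_def powr_powr flip: powr_realpow)
    finally show ?thesis by (simp add: powr_realpow)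
  qed
  show ?thesis
  proof (intro exI[of _ "\<lambda>n. B * 2 * \<theta> ^ n"] conjI allI ballI)
    show "summable (\<lambda>n. B * 2 * \<theta> ^ n)" using \<theta> by (intro summable_mult summable_geometric) auto
    show "0 \<le> B * 2 * \<theta> ^ n" for n using B \<theta> by simp
    fix n x assume x: "x \<in> V"
    have "(S ^^ n) x = (S ^^ (n mod N)) ((S ^^ (N * (n div N))) x)"
      by (metis comp_apply funpow_add mod_mult_div_eq)
    also have "norm \<dots> \<le> B * norm ((S ^^ (N * (n div N))) x)" by (intro power_bounded iterate_mem x)
    also have "\<dots> \<le> B * ((1 / 2) ^ (n div N) * norm x)" using B by (intro mult_left_mono halves x) auto
    also have "\<dots> \<le> B * ((2 * \<theta> ^ n) * norm x)" using B by (intro mult_left_mono mult_right_mono le) auto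
    finally show "norm ((S ^^ n) x) \<le> B * 2 * \<theta> ^ n * norm x" by simp
  qed
qed

end

section \<open>Spaces embedded into bounded functions\<close>

text \<open>The laws of a normed space hold on the carrier because \<open>J\<close> is injective and
  transports the operations and the norm; closedness of the range stands for completeness.\<close>

locale embedded_space =
  fixes E :: "'e cnormed" and J :: "'e \<Rightarrow> ('i::metric_space \<Rightarrow>\<^sub>C complex)"
  assumes inj: "inj_on J (carr E)" and closed_range: "closed (J ` carr E)"
    and zero_mem: "vzero E \<in> carr E"
    and add_mem: "\<And>x y. x \<in> carr E \<Longrightarrow> y \<in> carr E \<Longrightarrow> vadd E x y \<in> carr E"
    and scale_mem: "\<And>a x. x \<in> carr E \<Longrightarrow> vscale E a x \<in> carr E"
    and J_zero: "J (vzero E) = 0"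
    and J_add: "\<And>x y. x \<in> carr E \<Longrightarrow> y \<in> carr E \<Longrightarrow> J (vadd E x y) = J x + J y"
    and J_scale: "\<And>a x. x \<in> carr E \<Longrightarrow> J (vscale E a x) = cscale a (J x)"
    and vnorm_eq: "\<And>x. x \<in> carr E \<Longrightarrow> vnorm E x = norm (J x)"
begin

abbreviation "V \<equiv> J ` carr E"
abbreviation "I \<equiv> inv_into (carr E) J"

lemma I_mem: "v \<in> V \<Longrightarrow> I v \<in> carr E" by (rule inv_into_into)
lemma J_I [simp]: "v \<in> V \<Longrightarrow> J (I v) = v" by (rule f_inv_into_f)
lemma I_J [simp]: "x \<in> carr E \<Longrightarrow> I (J x) = x" using inj by simp
lemma J_eq_iff: "x \<in> carr E \<Longrightarrow> y \<in> carr E \<Longrightarrow> J x = J y \<longleftrightarrow> x = y" using inj by (simp add: inj_on_eq_iff)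

lemma vdiff_mem: "x \<in> carr E \<Longrightarrow> y \<in> carr E \<Longrightarrow> vdiff E x y \<in> carr E"
  by (simp add: vdiff_def add_mem scale_mem)

lemma J_diff: "x \<in> carr E \<Longrightarrow> y \<in> carr E \<Longrightarrow> J (vdiff E x y) = J x - J y"
  by (simp add: vdiff_def J_add J_scale scale_mem)

lemma vdist_eq: "x \<in> carr E \<Longrightarrow> y \<in> carr E \<Longrightarrow> vdist E x y = dist (J x) (J y)"
  by (simp add: vdist_def vnorm_eq vdiff_mem J_diff dist_norm)

lemma csubspace_V: "csubspace V"
  unfolding csubspace_def
proof (intro conjI ballI allI)
  show "0 \<in> V" using J_zero zero_mem by (metis imageI)
  show "v + w \<in> V" if vw: "v \<in> V" "w \<in> V" for v w
  proof -
    obtain x y where "v = J x" "w = J y" "x \<in> carr E" "y \<in> carr E" using vw by blast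
    then show ?thesis by (metis J_add add_mem imageI)
  qed
  show "cscale a v \<in> V" if v: "v \<in> V" for a v
  proof -
    obtain x where "v = J x" "x \<in> carr E" using v by blast
    then show ?thesis by (metis J_scale scale_mem imageI)
  qed
qed

lemma Metric_space_E: "Metric_space (carr E) (vdist E)"
proof
  fix x y z
  show "0 \<le> vdist E x y" "vdist E x y = vdist E y x"
    by (cases "x \<in> carr E \<and> y \<in> carr E"; auto simp: vdist_eq dist_commute; simp add: vdist_def)+
  assume m: "x \<in> carr E" "y \<in> carr E"
  then show "vdist E x y = 0 \<longleftrightarrow> x = y" by (simp add: vdist_eq J_eq_iff)
  assume "z \<in> carr E"
  with m show "vdist E x z \<le> vdist E x y + vdist E y z" by (simp add: vdist_eq dist_triangle)
qed

lemma homeomorphic_J: "homeomorphic_map (norm_topology E) (top_of_set V) J"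
proof -
  interpret M1: Metric_space "carr E" "vdist E" by (rule Metric_space_E)
  interpret M2: Submetric UNIV dist V
    by unfold_locales auto
  interpret Metric_space12 "carr E" "vdist E" V dist ..
  have "homeomorphic_map M1.mtopology M2.sub.mtopology J"
    by (rule isometry_imp_homeomorphic_map) (auto simp: vdist_eq)
  then show ?thesis by (simp add: norm_topology_def M2.mtopology_submetric)
qed

lemma topspace_norm_topology: "topspace (norm_topology E) = carr E"
  unfolding norm_topology_def using Metric_space.topspace_mtopology[OF Metric_space_E] .

lemma closedin_iff:
  assumes "A \<subseteq> carr E"
  shows "closedin (norm_topology E) A \<longleftrightarrow> closed (J ` A)"
proof -
  have "closedin (top_of_set V) (J ` A) \<longleftrightarrow> closed (J ` A)"
    using closed_range assms by (metis closedin_closed_eq image_mono)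
  then show ?thesis
    using homeomorphic_map_closedness_eq[OF homeomorphic_J] assms
    by (metis homeomorphic_J homeomorphic_map_closedness topspace_norm_topology)
qed

text \<open>The same \<open>J\<close> embeds every closed subspace, so that whatever is proved about
  operators on the whole space applies verbatim to restrictions, in particular the description of
  the spectrum.\<close>

lemma subspace_embedded:
  assumes "closed_subspace E A"
  shows "embedded_space (E\<lparr>carr := A\<rparr>) J"
proof -
  have A: "A \<subseteq> carr E" using assms by (simp add: closed_subspace_def)
  show ?thesis
    using assms A closedin_iff[OF A]
    by unfold_locales
      (auto simp: closed_subspace_def J_zero J_add J_scale vnorm_eq subset_iff intro: inj_on_subset[OF inj])
qed

section \<open>Operators transported along the embedding\<close>

definition lift :: "('e \<Rightarrow> 'e) \<Rightarrow> ('i \<Rightarrow>\<^sub>C complex) \<Rightarrow> ('i \<Rightarrow>\<^sub>C complex)" where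
  "lift T = J \<circ> T \<circ> I"

lemma lift_J [simp]: "x \<in> carr E \<Longrightarrow> lift T (J x) = J (T x)"
  by (simp add: lift_def)

lemma lift_funpow: "T \<in> carr E \<rightarrow> carr E \<Longrightarrow> x \<in> carr E \<Longrightarrow> (lift T ^^ n) (J x) = J ((T ^^ n) x)"
  by (induction n) (auto simp: funpow_mem)

lemma lift_bij_iff:
  assumes T: "T \<in> carr E \<rightarrow> carr E"
  shows "bij_betw (lift T) V V \<longleftrightarrow> bij_betw T (carr E) (carr E)"
proof -
  have J: "bij_betw J (carr E) V" using inj by (simp add: bij_betw_def)
  have "bij_betw (lift T \<circ> J) (carr E) V \<longleftrightarrow> bij_betw (lift T) V V"
    using bij_betw_comp_iff[OF J] by metis
  moreover have "bij_betw (lift T \<circ> J) (carr E) V \<longleftrightarrow> bij_betw (J \<circ> T) (carr E) V"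
    by (rule bij_betw_cong) simp
  moreover have "bij_betw (J \<circ> T) (carr E) V \<longleftrightarrow> bij_betw T (carr E) (carr E)"
    using bij_betw_comp_iff2[OF J, of T "carr E"] T by auto
  ultimately show ?thesis by simp
qed

lemma lift_inv:
  assumes T: "bij_betw T (carr E) (carr E)" and x: "x \<in> carr E"
  shows "inv_into V (lift T) (J x) = J (inv_into (carr E) T x)"
proof -
  have TE: "T \<in> carr E \<rightarrow> carr E" using T by (auto simp: bij_betw_def)
  have "bij_betw (lift T) V V" using lift_bij_iff[OF TE] T by simp
  moreover have "lift T (J (inv_into (carr E) T x)) = J x"
    using x by (simp add: self_bij_inv_mem[OF T] self_bij_right_inv[OF T])
  ultimately show ?thesis using x self_bij_inv_mem[OF T x] by (metis self_bij_left_inv imageI)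
qed

lemma bounded_operator_bound:
  assumes "bounded_operator E T"
  obtains c where "0 \<le> c" "\<And>x. x \<in> carr E \<Longrightarrow> norm (J (T x)) \<le> c * norm (J x)"
proof -
  obtain C where C: "\<And>x. x \<in> carr E \<Longrightarrow> vnorm E (T x) \<le> C * vnorm E x" "T \<in> carr E \<rightarrow> carr E"
    using assms unfolding bounded_operator_def by blast
  have "norm (J (T x)) \<le> max C 0 * norm (J x)" if "x \<in> carr E" for x
  proof -
    have "T x \<in> carr E" using C that by blast
    then have "norm (J (T x)) \<le> C * norm (J x)" using C(1)[OF that] that by (simp add: vnorm_eq)
    also have "\<dots> \<le> max C 0 * norm (J x)" by (intro mult_right_mono) auto
    finally show ?thesis .
  qed
  then show ?thesis using that[of "max C 0"] by simp
qed

lemma lift_complex_operator: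
  assumes "bounded_operator E T"
  obtains c where "complex_operator V (lift T) c"
proof -
  obtain c where c: "0 \<le> c" "\<And>x. x \<in> carr E \<Longrightarrow> norm (J (T x)) \<le> c * norm (J x)"
    using bounded_operator_bound[OF assms] by blast
  have T: "\<And>x. x \<in> carr E \<Longrightarrow> T x \<in> carr E"
    "\<And>x y. x \<in> carr E \<Longrightarrow> y \<in> carr E \<Longrightarrow> T (vadd E x y) = vadd E (T x) (T y)"
    "\<And>a x. x \<in> carr E \<Longrightarrow> T (vscale E a x) = vscale E a (T x)"
    using assms by (auto simp: bounded_operator_def)
  have "complex_operator V (lift T) c"
  proof
    show "lift T (v + w) = lift T v + lift T w" if vw: "v \<in> V" "w \<in> V" for v w
    proof -
      obtain x y where "v = J x" "w = J y" "x \<in> carr E" "y \<in> carr E" using vw by blast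
      then show ?thesis using lift_J[of "vadd E x y" T] by (simp add: T J_add add_mem)
    qed
    show "lift T (cscale a v) = cscale a (lift T v)" if v: "v \<in> V" for a v
    proof -
      obtain x where "v = J x" "x \<in> carr E" using v by blast
      then show ?thesis using lift_J[of "vscale E a x" T] by (simp add: T J_scale scale_mem)
    qed
  qed (use csubspace_V closed_range c T in auto)
  then show ?thesis by (rule that)
qed

text \<open>The inverse of a linear bijection is linear by itself, and its boundedness is a lower
  bound for \<open>T\<close>. This is the shape in which \<open>neumann\<close> and
  \<open>resolvent\<close> speak of invertibility.\<close>

lemma invertible_operator_iff:
  assumes T: "bounded_operator E T"
  shows "invertible_operator E T \<longleftrightarrow>
    bij_betw (lift T) V V \<and> (\<exists>m>0. \<forall>v\<in>V. m * norm v \<le> norm (lift T v))"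
proof -
  have TE: "T \<in> carr E \<rightarrow> carr E" using T by (auto simp: bounded_operator_def)
  let ?T' = "inv_into (carr E) T"
  have bounded: "bounded_operator E ?T' \<longleftrightarrow> (\<exists>m>0. \<forall>v\<in>V. m * norm v \<le> norm (lift T v))"
    if bij: "bij_betw T (carr E) (carr E)"
  proof
    assume "bounded_operator E ?T'"
    then obtain c where c: "0 \<le> c" "\<And>x. x \<in> carr E \<Longrightarrow> norm (J (?T' x)) \<le> c * norm (J x)"
      using bounded_operator_bound by blast
    have "1 / (c + 1) * norm (J x) \<le> norm (J (T x))" if x: "x \<in> carr E" for x
    proof -
      have "norm (J x) \<le> c * norm (J (T x))"
        using c(2)[of "T x"] x TE by (simp add: self_bij_left_inv[OF bij] self_bij_mem[OF bij])
      also have "\<dots> \<le> (c + 1) * norm (J (T x))" by (intro mult_right_mono) auto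
      finally show ?thesis using c(1) by (simp add: field_simps)
    qed
    then show "\<exists>m>0. \<forall>v\<in>V. m * norm v \<le> norm (lift T v)"
      using c(1) by (intro exI[of _ "1 / (c + 1)"]) auto
  next
    assume "\<exists>m>0. \<forall>v\<in>V. m * norm v \<le> norm (lift T v)"
    then obtain m where m: "0 < m" "\<And>x. x \<in> carr E \<Longrightarrow> m * norm (J x) \<le> norm (J (T x))" by auto
    have Tlin: "T (vadd E x y) = vadd E (T x) (T y)" "T (vscale E a x) = vscale E a (T x)"
      if "x \<in> carr E" "y \<in> carr E" for x y a
      using T that by (auto simp: bounded_operator_def)
    note mem = self_bij_inv_mem[OF bij]
    have add: "?T' (vadd E x y) = vadd E (?T' x) (?T' y)" if "x \<in> carr E" "y \<in> carr E" for x y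
      using self_bij_left_inv[OF bij, of "vadd E (?T' x) (?T' y)"] that by (simp add: Tlin mem add_mem self_bij_right_inv[OF bij])
    have scale: "?T' (vscale E a x) = vscale E a (?T' x)" if "x \<in> carr E" for x a
      using self_bij_left_inv[OF bij, of "vscale E a (?T' x)"] that by (simp add: Tlin(2)[OF mem mem] scale_mem mem self_bij_right_inv[OF bij])
    have bd: "vnorm E (?T' x) \<le> 1 / m * vnorm E x" if "x \<in> carr E" for x
      using m(2)[of "?T' x"] m(1) that by (simp add: vnorm_eq mem self_bij_right_inv[OF bij] field_simps)
    show "bounded_operator E ?T'"
      unfolding bounded_operator_def using mem add scale bd by blast
  qed
  show ?thesis
    unfolding invertible_operator_def using T bounded lift_bij_iff[OF TE] by blast
qed

text \<open>For nonzero \<open>z\<close> one has \<open>z - T = z (1 - T / z)\<close>, so the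
  parameters with \<open>cmod z \<ge> 1\<close> correspond to \<open>\<zeta> = 1 / z\<close> in the
  closed disk without 0. From left to right this feeds \<open>summable_powers\<close>, from right to
  left \<open>neumann\<close>.\<close>

lemma spectrum_subset_ball_iff:
  assumes T: "bounded_operator E T"
  shows "spectrum E T \<subseteq> ball 0 1 \<longleftrightarrow>
    (\<exists>a. summable a \<and> (\<forall>n. 0 \<le> a n) \<and> (\<forall>n. \<forall>x\<in>carr E. vnorm E ((T ^^ n) x) \<le> a n * vnorm E x))"
    (is "?l \<longleftrightarrow> ?r")
proof -
  obtain c where "complex_operator V (lift T) c" using lift_complex_operator[OF T] by blast
  then interpret complex_operator V "lift T" c .
  have TE: "T \<in> carr E \<rightarrow> carr E"
    and Tlin: "\<And>x y. x \<in> carr E \<Longrightarrow> y \<in> carr E \<Longrightarrow> T (vadd E x y) = vadd E (T x) (T y)"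
    "\<And>a x. x \<in> carr E \<Longrightarrow> T (vscale E a x) = vscale E a (T x)"
    using T by (auto simp: bounded_operator_def)
  have Tmem: "x \<in> carr E \<Longrightarrow> T x \<in> carr E" for x using TE by blast
  let ?R = "\<lambda>z x. vdiff E (vscale E z x) (T x)"
  have JR: "J (?R z x) = cscale z (D (1 / z) (J x))" if "z \<noteq> 0" "x \<in> carr E" for z x
    using that by (simp add: J_diff J_scale scale_mem Tmem D_def cscale_diff)
  have R_mem: "?R z x \<in> carr E" if "x \<in> carr E" for z x
    using that by (simp add: vdiff_mem scale_mem Tmem)
  have R_bounded: "bounded_operator E (?R z)" for z
    unfolding bounded_operator_def
  proof (intro conjI ballI allI)
    show "?R z \<in> carr E \<rightarrow> carr E" using R_mem by blast
    fix x assume x: "x \<in> carr E"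
    show "?R z (vscale E a x) = vscale E a (?R z x)" for a
      using x by (subst J_eq_iff[symmetric])
        (auto simp: Tlin R_mem scale_mem vdiff_mem Tmem J_diff J_scale cscale_diff mult.commute)
    show "?R z (vadd E x y) = vadd E (?R z x) (?R z y)" if y: "y \<in> carr E" for y
      using x y by (subst J_eq_iff[symmetric])
        (auto simp: Tlin R_mem scale_mem vdiff_mem add_mem Tmem J_diff J_scale J_add cscale_add)
  next
    have "vnorm E (?R z x) \<le> (cmod z + c) * vnorm E x" if x: "x \<in> carr E" for x
    proof -
      have "vnorm E (?R z x) \<le> norm (cscale z (J x)) + norm (lift T (J x))"
        using x norm_triangle_ineq4[of "cscale z (J x)" "J (T x)"]
        by (simp add: vnorm_eq R_mem J_diff J_scale scale_mem Tmem)
      also have "\<dots> \<le> cmod z * norm (J x) + c * norm (J x)"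
        using S_bound[of "J x"] x by simp
      finally show ?thesis using x by (simp add: vnorm_eq algebra_simps)
    qed
    then show "\<exists>C. \<forall>x\<in>carr E. vnorm E (?R z x) \<le> C * vnorm E x" by blast
  qed
  have lift_R: "lift (?R z) v = cscale z (D (1 / z) v)" if "z \<noteq> 0" "v \<in> V" for z v
    using that by (auto simp: JR R_mem)
  have bij_scale: "bij_betw (cscale z) V V" if "z \<noteq> 0" for z
    by (rule bij_betwI[where g = "cscale (1 / z)"]) (use that V_closure in auto)
  have inv_iff: "invertible_operator E (?R z) \<longleftrightarrow>
      bij_betw (D (1 / z)) V V \<and> (\<exists>m>0. \<forall>v\<in>V. m * norm v \<le> norm (D (1 / z) v))" if z: "z \<noteq> 0" for z
  proof -
    have DV: "D (1 / z) ` V \<subseteq> V" using D_mem by blast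
    have "bij_betw (lift (?R z)) V V \<longleftrightarrow> bij_betw (cscale z \<circ> D (1 / z)) V V"
      by (rule bij_betw_cong) (simp add: lift_R z)
    also have "\<dots> \<longleftrightarrow> bij_betw (D (1 / z)) V V"
      using bij_betw_comp_iff2[OF bij_scale[OF z] DV] by simp
    finally have 1: "bij_betw (lift (?R z)) V V \<longleftrightarrow> bij_betw (D (1 / z)) V V" .
    have 2: "(\<exists>m>0. \<forall>v\<in>V. m * norm v \<le> norm (lift (?R z) v)) \<longleftrightarrow> (\<exists>m>0. \<forall>v\<in>V. m * norm v \<le> norm (D (1 / z) v))"
    proof
      assume "\<exists>m>0. \<forall>v\<in>V. m * norm v \<le> norm (lift (?R z) v)"
      then obtain m where m: "0 < m" "\<And>v. v \<in> V \<Longrightarrow> m * norm v \<le> norm (lift (?R z) v)" by blast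
      have "m / cmod z * norm v \<le> norm (D (1 / z) v)" if "v \<in> V" for v
        using m(2)[OF that] z by (simp add: lift_R[OF z that] field_simps)
      then show "\<exists>m>0. \<forall>v\<in>V. m * norm v \<le> norm (D (1 / z) v)"
        using m(1) z by (intro exI[of _ "m / cmod z"]) auto
    next
      assume "\<exists>m>0. \<forall>v\<in>V. m * norm v \<le> norm (D (1 / z) v)"
      then obtain m where m: "0 < m" "\<And>v. v \<in> V \<Longrightarrow> m * norm v \<le> norm (D (1 / z) v)" by blast
      have "cmod z * m * norm v \<le> norm (lift (?R z) v)" if "v \<in> V" for v
        using mult_left_mono[OF m(2)[OF that] norm_ge_zero[of z]] by (simp add: lift_R[OF z that] mult.assoc)
      then show "\<exists>m>0. \<forall>v\<in>V. m * norm v \<le> norm (lift (?R z) v)"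
        using m(1) z by (intro exI[of _ "cmod z * m"]) auto
    qed
    show ?thesis unfolding invertible_operator_iff[OF R_bounded] 1 2 ..
  qed
  have norms: "norm ((lift T ^^ n) (J x)) = vnorm E ((T ^^ n) x)" "norm (J x) = vnorm E x" if "x \<in> carr E" for n x
    using that TE by (simp_all add: lift_funpow vnorm_eq funpow_mem)
  have V_iff: "?r \<longleftrightarrow> (\<exists>a. summable a \<and> (\<forall>n. 0 \<le> a n) \<and> (\<forall>n. \<forall>v\<in>V. norm ((lift T ^^ n) v) \<le> a n * norm v))"
    by (simp add: norms)
  show ?thesis
  proof
    assume ?l
    \<comment> \<open>The centre 0 is not of the form \<open>1 / z\<close>, but there
      \<open>D\<close> is the identity.\<close>
    have ok: "bij_betw (D \<zeta>) V V \<and> (\<exists>m>0. \<forall>v\<in>V. m * norm v \<le> norm (D \<zeta> v))" if "cmod \<zeta> \<le> 1" for \<zeta>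
    proof (cases "\<zeta> = 0")
      case True
      have "D 0 = (\<lambda>v. v)" by (auto simp: D_def fun_eq_iff)
      then show ?thesis unfolding True by (auto simp: bij_betw_def intro!: exI[of _ 1])
    next
      case False
      then have "1 \<le> cmod (1 / \<zeta>)" using that by (simp add: norm_divide)
      then have "1 / \<zeta> \<notin> spectrum E T" using \<open>?l\<close> by auto
      then show ?thesis using inv_iff[of "1 / \<zeta>"] False by (simp add: spectrum_def)
    qed
    interpret resolvent V "lift T" c
      by unfold_locales (use ok in auto)
    show ?r unfolding V_iff by (rule summable_powers)
  next
    assume ?r
    then obtain a where a: "summable a" "\<And>n. 0 \<le> a n" "\<And>n v. v \<in> V \<Longrightarrow> norm ((lift T ^^ n) v) \<le> a n * norm v"
      unfolding V_iff by blast
    show ?l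
    proof
      fix z assume z: "z \<in> spectrum E T"
      show "z \<in> ball 0 1"
      proof (rule ccontr)
        assume "z \<notin> ball 0 1"
        then have z1: "1 \<le> cmod z" by simp
        then have "cmod (1 / z) \<le> 1" "z \<noteq> 0" by (auto simp: norm_divide divide_simps)
        then have "invertible_operator E (?R z)" unfolding inv_iff[OF \<open>z \<noteq> 0\<close>]
          using neumann[OF a] by blast
        then show False using z by (simp add: spectrum_def)
      qed
    qed
  qed
qed

end

section \<open>Generalized hyperbolicity implies shadowing and strong structural stability\<close>

definition summable_powers_on :: "'e cnormed \<Rightarrow> 'e set \<Rightarrow> ('e \<Rightarrow> 'e) \<Rightarrow> bool" where
  "summable_powers_on E A T \<longleftrightarrow>
     (\<exists>a. summable a \<and> (\<forall>n. 0 \<le> a n) \<and> (\<forall>n. \<forall>x\<in>A. vnorm E ((T ^^ n) x) \<le> a n * vnorm E x))"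

definition summable_splitting :: "'e cnormed \<Rightarrow> ('e \<Rightarrow> 'e) \<Rightarrow> bool" where
  "summable_splitting E T \<longleftrightarrow>
     (\<exists>A B. closed_subspace E A \<and> closed_subspace E B \<and> direct_sum E A B \<and>
        T ` A \<subseteq> A \<and> inv_into (carr E) T ` B \<subseteq> B \<and>
        summable_powers_on E A T \<and> summable_powers_on E B (inv_into (carr E) T))"

lemma bounded_operator_restrict:
  assumes "bounded_operator E T" "A \<subseteq> carr E" "T ` A \<subseteq> A"
  shows "bounded_operator (E\<lparr>carr := A\<rparr>) T"
proof -
  obtain C where "\<forall>x\<in>carr E. vnorm E (T x) \<le> C * vnorm E x"
    using assms(1) unfolding bounded_operator_def by blast
  then have "\<exists>C. \<forall>x\<in>A. vnorm E (T x) \<le> C * vnorm E x" using assms(2) by blast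
  then show ?thesis using assms by (auto simp: bounded_operator_def subset_iff)
qed

context embedded_space
begin

lemma spectrum_restrict_iff:
  assumes "closed_subspace E A" "bounded_operator E T" "T ` A \<subseteq> A"
  shows "spectrum (E\<lparr>carr := A\<rparr>) T \<subseteq> ball 0 1 \<longleftrightarrow> summable_powers_on E A T"
proof -
  interpret A: embedded_space "E\<lparr>carr := A\<rparr>" J by (rule subspace_embedded[OF assms(1)])
  have "bounded_operator (E\<lparr>carr := A\<rparr>) T"
    using assms by (intro bounded_operator_restrict) (auto simp: closed_subspace_def)
  from A.spectrum_subset_ball_iff[OF this] show ?thesis by (simp add: summable_powers_on_def)
qed

lemma generalized_hyperbolic_iff:
  assumes "invertible_operator E T"
  shows "generalized_hyperbolic E T \<longleftrightarrow> summable_splitting E T"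
proof -
  have T: "bounded_operator E T" "bounded_operator E (inv_into (carr E) T)"
    using assms by (auto simp: invertible_operator_def)
  show ?thesis
    unfolding generalized_hyperbolic_def summable_splitting_def
    using spectrum_restrict_iff[OF _ T(1)] spectrum_restrict_iff[OF _ T(2)] by metis
qed

text \<open>The algebraic decomposition determines an additive projection \<open>P\<close> by
  uniqueness of components; its continuity is where closedness of both summands enters, through
  \<open>direct_sum_projection_bounded\<close>.\<close>

lemma splitting_lift:
  assumes inv: "invertible_operator E T" and "summable_splitting E T"
  obtains P a c where "splitting V (lift T) P a c"
proof -
  have T: "bounded_operator E T" "bounded_operator E (inv_into (carr E) T)"
    and bij: "bij_betw T (carr E) (carr E)"
    using inv by (auto simp: invertible_operator_def)
  let ?T' = "inv_into (carr E) T"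
  have TE: "T \<in> carr E \<rightarrow> carr E" "?T' \<in> carr E \<rightarrow> carr E"
    using T by (auto simp: bounded_operator_def)
  obtain A B where AB: "closed_subspace E A" "closed_subspace E B" "direct_sum E A B"
    "T ` A \<subseteq> A" "?T' ` B \<subseteq> B" "summable_powers_on E A T" "summable_powers_on E B ?T'"
    using assms(2) unfolding summable_splitting_def by blast
  have sub: "A \<subseteq> carr E" "B \<subseteq> carr E" using AB by (auto simp: closed_subspace_def)
  obtain a1 a2 where a1: "summable a1" "\<And>n. 0 \<le> a1 n" "\<And>n x. x \<in> A \<Longrightarrow> vnorm E ((T ^^ n) x) \<le> a1 n * vnorm E x"
    and a2: "summable a2" "\<And>n. 0 \<le> a2 n" "\<And>n x. x \<in> B \<Longrightarrow> vnorm E ((?T' ^^ n) x) \<le> a2 n * vnorm E x"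
    using AB(6,7) unfolding summable_powers_on_def by blast
  have closed: "closed (J ` A)" "closed (J ` B)"
    using AB closedin_iff[OF sub(1)] closedin_iff[OF sub(2)] by (auto simp: closed_subspace_def)
  interpret A: embedded_space "E\<lparr>carr := A\<rparr>" J by (rule subspace_embedded[OF AB(1)])
  interpret B: embedded_space "E\<lparr>carr := B\<rparr>" J by (rule subspace_embedded[OF AB(2)])
  have subspaces: "subspace (J ` A)" "subspace (J ` B)" "subspace V"
    using csubspace_imp_subspace[OF A.csubspace_V] csubspace_imp_subspace[OF B.csubspace_V]
      csubspace_imp_subspace[OF csubspace_V] by simp_all
  have inter: "J ` A \<inter> J ` B = {0}"
  proof -
    have "J ` (A \<inter> B) = J ` A \<inter> J ` B" using inj_on_image_Int[OF inj] sub by blast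
    moreover have "A \<inter> B = {vzero E}" using AB(3) by (simp add: direct_sum_def)
    ultimately show ?thesis using J_zero by simp
  qed
  have V_eq: "V = {u + w | u w. u \<in> J ` A \<and> w \<in> J ` B}"
  proof -
    have E: "carr E = {vadd E x y | x y. x \<in> A \<and> y \<in> B}" using AB(3) by (simp add: direct_sum_def)
    have J: "J (vadd E x y) = J x + J y" if "x \<in> A" "y \<in> B" for x y
      using that sub by (intro J_add) auto
    show ?thesis
    proof (intro equalityI subsetI)
      fix v assume "v \<in> V"
      then obtain z where "z \<in> carr E" "v = J z" by blast
      then obtain x y where "x \<in> A" "y \<in> B" "v = J (vadd E x y)" unfolding E by blast
      then show "v \<in> {u + w | u w. u \<in> J ` A \<and> w \<in> J ` B}" using J by auto
    next
      fix v assume "v \<in> {u + w | u w. u \<in> J ` A \<and> w \<in> J ` B}"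
      then obtain x y where xy: "x \<in> A" "y \<in> B" "v = J x + J y" by blast
      then have "v = J (vadd E x y)" "vadd E x y \<in> carr E" using J sub by (auto intro!: add_mem)
      then show "v \<in> V" by blast
    qed
  qed
  obtain C where C: "0 \<le> C" "\<And>u w. u \<in> J ` A \<Longrightarrow> w \<in> J ` B \<Longrightarrow> norm u \<le> C * norm (u + w)"
    using direct_sum_projection_bounded[OF subspaces(1) closed(1) subspaces(2) closed(2) inter]
      closed_range unfolding V_eq by blast
  have unique: "u = u'" if uw: "u \<in> J ` A" "u' \<in> J ` A" "w \<in> J ` B" "w' \<in> J ` B" "u + w = u' + w'" for u u' w w'
  proof -
    have "u - u' = w' - w" using uw(5) by (simp add: algebra_simps)
    then have "u - u' \<in> J ` A \<inter> J ` B" using uw subspaces subspace_diff by (metis IntI)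
    then show ?thesis using inter by simp
  qed
  define P where "P v = (SOME u. u \<in> J ` A \<and> v - u \<in> J ` B)" for v
  have P: "P v \<in> J ` A" "v - P v \<in> J ` B" if "v \<in> V" for v
  proof -
    obtain u w where uw: "u \<in> J ` A" "w \<in> J ` B" "v = u + w" using \<open>v \<in> V\<close> unfolding V_eq by blast
    then have "u \<in> J ` A \<and> v - u \<in> J ` B" by simp
    then have "P v \<in> J ` A \<and> v - P v \<in> J ` B" unfolding P_def by (rule someI)
    then show "P v \<in> J ` A" "v - P v \<in> J ` B" by auto
  qed
  have subV: "J ` A \<subseteq> V" "J ` B \<subseteq> V" using sub by auto
  have P_norm: "norm (P v) \<le> C * norm v" if "v \<in> V" for v
    using C(2)[OF P[OF that]] by simp
  have Q_norm: "norm (v - P v) \<le> (1 + C) * norm v" if "v \<in> V" for v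
    using norm_triangle_ineq4[of v "P v"] P_norm[OF that] by (simp add: algebra_simps)
  obtain c1 where "complex_operator V (lift T) c1" using lift_complex_operator[OF T(1)] by blast
  then interpret S: complex_operator V "lift T" c1 .
  obtain c2 where "complex_operator V (lift ?T') c2" using lift_complex_operator[OF T(2)] by blast
  then interpret S': complex_operator V "lift ?T'" c2 .
  have lift_bij: "bij_betw (lift T) V V" using lift_bij_iff[OF TE(1)] bij by simp
  have inv_lift: "inv_into V (lift T) v = lift ?T' v" if "v \<in> V" for v
    using that lift_inv[OF bij] by auto
  have inv_pow: "(inv_into V (lift T) ^^ n) (J x) = J ((?T' ^^ n) x)" if x: "x \<in> carr E" for n x
  proof (induction n)
    case (Suc n)
    have "(?T' ^^ n) x \<in> carr E" using TE(2) x by (rule funpow_mem)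
    then show ?case using Suc by (simp add: lift_inv[OF bij])
  qed simp
  \<comment> \<open>The norms of \<open>P\<close> and \<open>1 - P\<close> are at most
    \<open>C\<close> and \<open>1 + C\<close>; the sum of the two resulting decay rates serves both
    sides.\<close>
  have "splitting V (lift T) P (\<lambda>n. a1 n * C + a2 n * (1 + C)) (max c1 c2)"
  proof
    show "subspace V" by (rule subspaces)
    show "closed V" by (rule closed_range)
    show "bij_betw (lift T) V V" by (rule lift_bij)
    show "lift T (v + w) = lift T v + lift T w" if "v \<in> V" "w \<in> V" for v w
      using S.S_add[OF that] .
    show "norm (lift T v) \<le> max c1 c2 * norm v" if "v \<in> V" for v
      using S.S_bound[OF that] mult_right_mono[of c1 "max c1 c2" "norm v"] by simp
    show "norm (inv_into V (lift T) v) \<le> max c1 c2 * norm v" if "v \<in> V" for v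
      using S'.S_bound[OF that] mult_right_mono[of c2 "max c1 c2" "norm v"] inv_lift[OF that] by simp
    show "P v \<in> V" if "v \<in> V" for v using P(1)[OF that] subV by blast
    show "P (v + w) = P v + P w" if vw: "v \<in> V" "w \<in> V" for v w
    proof (rule unique)
      have "v + w \<in> V" using vw subspaces(3) by (rule subspace_add[rotated])
      then show "P (v + w) \<in> J ` A" "v + w - P (v + w) \<in> J ` B" using P by blast+
      show "P v + P w \<in> J ` A" using P vw subspaces by (intro subspace_add) auto
      show "(v - P v) + (w - P w) \<in> J ` B" using P vw subspaces by (intro subspace_add) auto
    qed simp
    show "0 \<le> max c1 c2" using S.c_nonneg by simp
    show "0 \<le> a1 n * C + a2 n * (1 + C)" for n using a1(2) a2(2) C(1) by simp
    show "summable (\<lambda>n. a1 n * C + a2 n * (1 + C))"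
      using a1(1) a2(1) by (intro summable_add summable_mult2)
    show "norm ((lift T ^^ n) (P v)) \<le> (a1 n * C + a2 n * (1 + C)) * norm v" if v: "v \<in> V" for v n
    proof -
      obtain x where x: "x \<in> A" "P v = J x" using P(1)[OF v] by blast
      have xE: "x \<in> carr E" using x sub by blast
      have "norm ((lift T ^^ n) (P v)) = vnorm E ((T ^^ n) x)"
        using xE TE(1) by (simp add: x(2) lift_funpow vnorm_eq funpow_mem)
      also have "\<dots> \<le> a1 n * norm (P v)" using a1(3)[OF x(1)] xE by (simp add: x(2) vnorm_eq)
      also have "\<dots> \<le> a1 n * (C * norm v)" by (intro mult_left_mono P_norm v a1)
      also have "\<dots> \<le> (a1 n * C + a2 n * (1 + C)) * norm v"
        using a2(2)[of n] C(1) by (simp add: distrib_right)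
      finally show ?thesis .
    qed
    show "norm ((inv_into V (lift T) ^^ n) (v - P v)) \<le> (a1 n * C + a2 n * (1 + C)) * norm v" if v: "v \<in> V" for v n
    proof -
      obtain x where x: "x \<in> B" "v - P v = J x" using P(2)[OF v] by blast
      have xE: "x \<in> carr E" using x sub by blast
      have "norm ((inv_into V (lift T) ^^ n) (v - P v)) = vnorm E ((?T' ^^ n) x)"
        using xE TE(2) by (simp add: x(2) inv_pow vnorm_eq funpow_mem)
      also have "\<dots> \<le> a2 n * norm (v - P v)" using a2(3)[OF x(1)] xE by (simp add: x(2) vnorm_eq)
      also have "\<dots> \<le> a2 n * ((1 + C) * norm v)" by (intro mult_left_mono Q_norm v a2)
      also have "\<dots> \<le> (a1 n * C + a2 n * (1 + C)) * norm v"
        using mult_nonneg_nonneg[OF a1(2)[of n] mult_nonneg_nonneg[OF C(1) norm_ge_zero[of v]]]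
        by (simp add: algebra_simps)
      finally show ?thesis .
    qed
  qed
  then show ?thesis by (rule that)
qed

text \<open>The errors of a pseudo-orbit force a bounded solution \<open>d\<close> of the same
  inhomogeneous equation. Subtracting it leaves a genuine orbit, and the distance to that orbit is
  \<open>norm (d n)\<close>.\<close>

lemma summable_splitting_imp_shadowing:
  assumes inv: "invertible_operator E T" and "summable_splitting E T"
  shows "shadowing_property E T"
proof -
  obtain P a c where "splitting V (lift T) P a c" using splitting_lift[OF assms] .
  then interpret splitting V "lift T" P a c .
  have bijE: "bij_betw T (carr E) (carr E)" using inv by (simp add: invertible_operator_def)
  have TE: "x \<in> carr E \<Longrightarrow> T x \<in> carr E" for x using self_bij_mem[OF bijE] .
  show ?thesis
    unfolding shadowing_property_def
  proof (intro allI impI)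
    fix \<epsilon> :: real assume \<epsilon>: "0 < \<epsilon>"
    \<comment> \<open>The factor 2 makes the final inequality strict.\<close>
    define \<delta> where "\<delta> = \<epsilon> / (2 * K)"
    have \<delta>: "0 < \<delta>" "K * \<delta> < \<epsilon>" using \<epsilon> K_pos by (auto simp: \<delta>_def)
    show "\<exists>\<delta>>0. \<forall>x::int \<Rightarrow> 'e. (\<forall>n. x n \<in> carr E) \<and> (\<forall>n. vnorm E (vdiff E (T (x n)) (x (n + 1))) \<le> \<delta>) \<longrightarrow>
        (\<exists>y\<in>carr E. \<forall>n. vnorm E (vdiff E (int_iter (carr E) T n y) (x n)) < \<epsilon>)"
    proof (intro exI[of _ \<delta>] conjI allI impI \<delta>)
      fix x :: "int \<Rightarrow> 'e"
      assume "(\<forall>n. x n \<in> carr E) \<and> (\<forall>n. vnorm E (vdiff E (T (x n)) (x (n + 1))) \<le> \<delta>)"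
      then have x: "x n \<in> carr E" and xe: "vnorm E (vdiff E (T (x n)) (x (n + 1))) \<le> \<delta>" for n by auto
      define e where "e n = J (x (n + 1)) - lift T (J (x n))" for n
      have e: "e n \<in> V" "norm (e n) \<le> \<delta>" for n
        using xe[of n] x by (auto simp: e_def V_closure TE vnorm_eq vdiff_mem J_diff norm_minus_commute)
      \<comment> \<open>The offset is such that the entry at 1, which \<open>\<Lambda>_shift\<close>
        releases, is \<open>e n\<close>.\<close>
      define d where "d n = \<Lambda> (\<lambda>k. e (n + k - 1))" for n
      have d_mem: "d n \<in> V" and d_norm: "norm (d n) \<le> K * \<delta>" for n
        unfolding d_def by (intro \<Lambda>_mem[where \<beta>=\<delta>] \<Lambda>_bound; use e in auto)+
      have d_step: "d (n + 1) = lift T (d n) + e n" for n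
        using \<Lambda>_shift[of "\<lambda>k. e (n + k - 1)" \<delta>] e by (auto simp: d_def algebra_simps)
      define w where "w n = J (x n) - d n" for n
      have w_mem: "w n \<in> V" for n using x d_mem by (auto simp: w_def V_closure)
      have w_step: "w (n + 1) = lift T (w n)" for n
        using T_diff[of "J (x n)" "d n"] x d_mem by (simp add: w_def d_step e_def)
      have w_iter: "w n = int_iter V (lift T) n (w 0)" for n
      proof (induction n rule: int_induct[where k = 0])
        case base
        then show ?case by simp
      next
        case (step1 i)
        then show ?case using w_step[of i] int_iter_add_1[OF bij w_mem] by simp
      next
        case (step2 i)
        have "w (i - 1) = inv_into V (lift T) (w i)"
          using w_step[of "i - 1"] self_bij_left_inv[OF bij w_mem, of "i - 1"] by simp
        then show ?case using int_iter_diff_1[OF bij w_mem, of i 0] step2 by simp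
      qed
      define y where "y = I (w 0)"
      have y: "y \<in> carr E" "J y = w 0" using w_mem by (auto simp: y_def I_mem)
      have Jy: "J (int_iter (carr E) T n y) = w n" for n
        using conj_int_iter[OF bijE bij, of J y n] y w_iter[of n] by simp
      have "vnorm E (vdiff E (int_iter (carr E) T n y) (x n)) < \<epsilon>" for n
      proof -
        have m: "int_iter (carr E) T n y \<in> carr E" using int_iter_mem[OF bijE y(1)] .
        have "vnorm E (vdiff E (int_iter (carr E) T n y) (x n)) = norm (d n)"
          using m x by (simp add: vnorm_eq vdiff_mem J_diff Jy w_def)
        then show ?thesis using d_norm[of n] \<delta> by simp
      qed
      then show "\<exists>y\<in>carr E. \<forall>n. vnorm E (vdiff E (int_iter (carr E) T n y) (x n)) < \<epsilon>"
        using y(1) by blast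
    qed
  qed
qed

lemma summable_splitting_imp_stable:
  assumes inv: "invertible_operator E T" and "summable_splitting E T"
  shows "strongly_structurally_stable E T"
proof -
  obtain P a c where "splitting V (lift T) P a c" using splitting_lift[OF assms] .
  then interpret splitting V "lift T" P a c .
  have bijE: "bij_betw T (carr E) (carr E)" using inv by (simp add: invertible_operator_def)
  have TE: "x \<in> carr E \<Longrightarrow> T x \<in> carr E" for x using self_bij_mem[OF bijE] .
  show ?thesis
    unfolding strongly_structurally_stable_def
  proof (intro allI impI)
    fix \<gamma> :: real assume \<gamma>: "0 < \<gamma>"
    \<comment> \<open>The first term yields \<open>K * \<epsilon> \<le> \<gamma>\<close> for
      closeness to the identity and \<open>K * \<epsilon> \<le> 1/2\<close> for the contraction; the
      second yields \<open>c * \<epsilon> \<le> 1/2\<close>, with \<open>c + 1\<close> since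
      \<open>c\<close> may be 0.\<close>
    define \<epsilon> where "\<epsilon> = min (min \<gamma> (1 / 2) / K) (1 / (2 * (c + 1)))"
    have \<epsilon>: "0 < \<epsilon>" using \<gamma> K_pos c_nonneg by (simp add: \<epsilon>_def)
    have "K * \<epsilon> \<le> K * (min \<gamma> (1 / 2) / K)" using K_pos by (intro mult_left_mono) (auto simp: \<epsilon>_def)
    then have K\<epsilon>: "K * \<epsilon> \<le> \<gamma>" "K * \<epsilon> \<le> 1 / 2" using K_pos by auto
    have "c * \<epsilon> \<le> c * (1 / (2 * (c + 1)))" using c_nonneg by (intro mult_left_mono) (auto simp: \<epsilon>_def)
    also have "\<dots> \<le> 1 / 2" using c_nonneg by (simp add: field_simps)
    finally have c\<epsilon>: "c * \<epsilon> \<le> 1 / 2" .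
    show "\<exists>\<epsilon>>0. \<forall>\<phi>\<in>carr E \<rightarrow> carr E. (\<forall>x\<in>carr E. vnorm E (\<phi> x) \<le> \<epsilon>) \<and>
      (\<forall>x\<in>carr E. \<forall>y\<in>carr E. vdist E (\<phi> x) (\<phi> y) \<le> \<epsilon> * vdist E x y) \<longrightarrow>
      (\<exists>h. homeomorphic_map (norm_topology E) (norm_topology E) h \<and>
         (\<forall>x\<in>carr E. h (T x) = vadd E (T (h x)) (\<phi> (h x))) \<and>
         (\<forall>x\<in>carr E. vnorm E (vdiff E (h x) x) \<le> \<gamma>))"
    proof (intro exI[of _ \<epsilon>] conjI ballI impI \<epsilon>)
      fix \<phi> assume \<phi>: "\<phi> \<in> carr E \<rightarrow> carr E"
        and "(\<forall>x\<in>carr E. vnorm E (\<phi> x) \<le> \<epsilon>) \<and>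
          (\<forall>x\<in>carr E. \<forall>y\<in>carr E. vdist E (\<phi> x) (\<phi> y) \<le> \<epsilon> * vdist E x y)"
      then have \<phi>_small: "\<And>x. x \<in> carr E \<Longrightarrow> vnorm E (\<phi> x) \<le> \<epsilon>"
        and \<phi>_lip: "\<And>x y. x \<in> carr E \<Longrightarrow> y \<in> carr E \<Longrightarrow> vdist E (\<phi> x) (\<phi> y) \<le> \<epsilon> * vdist E x y" by auto
      have \<phi>E: "x \<in> carr E \<Longrightarrow> \<phi> x \<in> carr E" for x using \<phi> by blast
      interpret perturbation V "lift T" P a c "lift \<phi>" \<epsilon>
      proof
        show "lift \<phi> v \<in> V" if "v \<in> V" for v using that \<phi>E by auto
        show "norm (lift \<phi> v) \<le> \<epsilon>" if "v \<in> V" for v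
          using that \<phi>_small \<phi>E by (auto simp: vnorm_eq)
        show "norm (lift \<phi> v - lift \<phi> w) \<le> \<epsilon> * norm (v - w)" if "v \<in> V" "w \<in> V" for v w
          using that \<phi>_lip \<phi>E by (auto simp: vdist_eq dist_norm)
      qed (use \<epsilon> c\<epsilon> K\<epsilon> in auto)
      define k where "k = I \<circ> (h \<circ> J)"
      have k: "k x \<in> carr E" "J (k x) = h (J x)" if "x \<in> carr E" for x
        using that h_mem by (auto simp: k_def I_mem)
      have "homeomorphic_map (norm_topology E) (norm_topology E) k"
        unfolding k_def
      proof (intro homeomorphic_map_compose)
        show "homeomorphic_map (norm_topology E) (top_of_set V) J" by (rule homeomorphic_J)
        show "homeomorphic_map (top_of_set V) (top_of_set V) h"
          by (rule homeomorphic_maps_imp_map[where g = g])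
            (auto simp: homeomorphic_maps_def h_continuous g_continuous h_mem g_mem h_g g_h)
        \<comment> \<open>The inverse supplied by the homeomorphism \<open>J\<close> is only known
          to agree with \<open>I\<close> on \<open>V\<close>, which is the whole space in
          question.\<close>
        obtain I' where I': "homeomorphic_maps (norm_topology E) (top_of_set V) J I'"
          using homeomorphic_J by (auto simp: homeomorphic_map_maps)
        then have "I' (J x) = I (J x)" if "x \<in> carr E" for x
          using that by (simp add: homeomorphic_maps_def topspace_norm_topology)
        then have "I' v = I v" if "v \<in> V" for v using that by blast
        then show "homeomorphic_map (top_of_set V) (norm_topology E) I"
          using I' by (intro homeomorphic_map_eq[of _ _ I' I]) (auto simp: homeomorphic_maps_map)
      qed
      moreover have "k (T x) = vadd E (T (k x)) (\<phi> (k x))" if x: "x \<in> carr E" for x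
      proof -
        have "J (k (T x)) = S (h (J x))" using h_T[of "J x"] x by (simp add: k TE)
        also have "\<dots> = lift T (J (k x)) + lift \<phi> (J (k x))" by (simp only: S_def k(2)[OF x])
        also have "\<dots> = J (vadd E (T (k x)) (\<phi> (k x)))" using k(1)[OF x] by (simp add: J_add TE \<phi>E)
        finally have "J (k (T x)) = J (vadd E (T (k x)) (\<phi> (k x)))" .
        moreover have "k (T x) \<in> carr E" "vadd E (T (k x)) (\<phi> (k x)) \<in> carr E"
          using x by (simp_all add: k(1) TE \<phi>E add_mem)
        ultimately show ?thesis using J_eq_iff by blast
      qed
      moreover have "vnorm E (vdiff E (k x) x) \<le> \<gamma>" if x: "x \<in> carr E" for x
        using h_close[of "J x"] x K\<epsilon> by (simp add: vnorm_eq vdiff_mem k J_diff)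
      ultimately show "\<exists>h. homeomorphic_map (norm_topology E) (norm_topology E) h \<and>
         (\<forall>x\<in>carr E. h (T x) = vadd E (T (h x)) (\<phi> (h x))) \<and>
         (\<forall>x\<in>carr E. vnorm E (vdiff E (h x) x) \<le> \<gamma>)" by blast
    qed
  qed
qed

end

section \<open>The space \<open>L\<^sup>p\<close>\<close>

text \<open>With the exponent \<open>p - 1\<close> in place of a conjugate exponent, the inequality
  still makes sense at \<open>p = 1\<close>, where the conjugate exponent is infinite.\<close>

lemma Young_powr:
  fixes u v p :: real
  assumes "1 \<le> p" "0 \<le> u" "0 \<le> v"
  shows "u * v powr (p - 1) \<le> u powr p / p + (1 - 1 / p) * v powr p"
proof (cases "p = 1")
  case True
  \<comment> \<open>An inequality only, because \<open>0 powr 0 = 0\<close>.\<close>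
  have "u * v powr 0 \<le> u * 1" using assms by (intro mult_left_mono) (auto simp: powr_zero_eq_one)
  then show ?thesis using True assms by (simp add: powr_one_gt_zero_iff)
next
  case False
  then have p: "1 < p" using assms by simp
  have "u * v powr (p - 1) \<le> u powr p / p + (v powr (p - 1)) powr (p / (p - 1)) / (p / (p - 1))"
    using p assms by (intro Youngs_inequality) (auto simp: field_simps)
  moreover have "(v powr (p - 1)) powr (p / (p - 1)) = v powr p" using p by (simp add: powr_powr)
  moreover have "v powr p / (p / (p - 1)) = (1 - 1 / p) * v powr p" using p by (simp add: field_simps)
  ultimately show ?thesis by simp
qed

locale Lp_space =
  fixes M :: "'a measure" and p :: real
  assumes p: "1 \<le> p"
begin

section \<open>Functions with integrable \<open>p\<close>-th power\<close>

definition \<L> :: "('a \<Rightarrow> complex) set" where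
  "\<L> = {\<phi> \<in> borel_measurable M. integrable M (\<lambda>x. cmod (\<phi> x) powr p)}"

abbreviation "cl \<equiv> ae_class M"

text \<open>The \<open>p\<close>-th power of the norm with values in the extended reals, so that
  monotonicity, Fatou's lemma and changes of measure apply before integrability is known;
  \<open>nn_leD\<close> returns to real norms.\<close>

definition nn :: "('a \<Rightarrow> complex) \<Rightarrow> ennreal" where
  "nn \<phi> = (\<integral>\<^sup>+x. ennreal (cmod (\<phi> x) powr p) \<partial>M)"

definition nrm :: "('a \<Rightarrow> complex) \<Rightarrow> real" where
  "nrm \<phi> = (LINT x|M. cmod (\<phi> x) powr p) powr (1 / p)"

lemma carr_eq: "carr (Lp M p) = cl ` \<L>"
  by (simp add: Lp_def \<L>_def)

lemma \<L>_measurable [measurable_dest]: "\<phi> \<in> \<L> \<Longrightarrow> \<phi> \<in> borel_measurable M"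
  by (simp add: \<L>_def)

lemma ae_class_eq_iff:
  assumes "\<phi> \<in> borel_measurable M" "\<psi> \<in> borel_measurable M"
  shows "cl \<phi> = cl \<psi> \<longleftrightarrow> (AE x in M. \<phi> x = \<psi> x)"
proof
  assume "cl \<phi> = cl \<psi>"
  moreover have "\<phi> \<in> cl \<phi>" using assms by (simp add: ae_class_def)
  ultimately show "AE x in M. \<phi> x = \<psi> x" by (auto simp: ae_class_def)
next
  assume eq: "AE x in M. \<phi> x = \<psi> x"
  have "AE x in M. \<xi> x = \<psi> x" if "AE x in M. \<xi> x = \<phi> x" for \<xi>
    using eq that by eventually_elim simp
  moreover have "AE x in M. \<xi> x = \<phi> x" if "AE x in M. \<xi> x = \<psi> x" for \<xi>
    using eq that by eventually_elim simp
  ultimately show "cl \<phi> = cl \<psi>" unfolding ae_class_def by blast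
qed

lemma rep_ae_class:
  assumes "\<phi> \<in> borel_measurable M"
  shows "rep (cl \<phi>) \<in> borel_measurable M" "AE x in M. rep (cl \<phi>) x = \<phi> x"
proof -
  have "\<phi> \<in> cl \<phi>" using assms by (simp add: ae_class_def)
  then have "rep (cl \<phi>) \<in> cl \<phi>" unfolding rep_def by (rule someI[where P = "\<lambda>\<psi>. \<psi> \<in> cl \<phi>"])
  then show "rep (cl \<phi>) \<in> borel_measurable M" "AE x in M. rep (cl \<phi>) x = \<phi> x"
    by (auto simp: ae_class_def)
qed

lemma nrm_cong:
  assumes "\<phi> \<in> borel_measurable M" "\<psi> \<in> borel_measurable M" "AE x in M. \<phi> x = \<psi> x"
  shows "nrm \<phi> = nrm \<psi>" "nn \<phi> = nn \<psi>" "\<phi> \<in> \<L> \<longleftrightarrow> \<psi> \<in> \<L>"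
proof -
  have ae: "AE x in M. cmod (\<phi> x) powr p = cmod (\<psi> x) powr p"
    using assms(3) by eventually_elim simp
  have m: "(\<lambda>x. cmod (\<phi> x) powr p) \<in> borel_measurable M" "(\<lambda>x. cmod (\<psi> x) powr p) \<in> borel_measurable M"
    using assms by measurable
  show "nrm \<phi> = nrm \<psi>" unfolding nrm_def using integral_cong_AE[OF m ae] by simp
  show "nn \<phi> = nn \<psi>" unfolding nn_def
    by (rule nn_integral_cong_AE) (use ae in eventually_elim; simp)
  show "\<phi> \<in> \<L> \<longleftrightarrow> \<psi> \<in> \<L>" unfolding \<L>_def using integrable_cong_AE[OF m ae] assms by simp
qed

lemma rep_cl:
  assumes "\<phi> \<in> \<L>"
  shows "rep (cl \<phi>) \<in> \<L>" "AE x in M. rep (cl \<phi>) x = \<phi> x" "nrm (rep (cl \<phi>)) = nrm \<phi>"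
  using nrm_cong[of "rep (cl \<phi>)" \<phi>] rep_ae_class[of \<phi>] \<L>_measurable[OF assms] assms by auto

lemma carrE:
  assumes "\<Phi> \<in> carr (Lp M p)"
  obtains \<phi> where "\<phi> \<in> \<L>" "\<Phi> = cl \<phi>"
  using assms unfolding carr_eq by blast

lemma cl_mem: "\<phi> \<in> \<L> \<Longrightarrow> cl \<phi> \<in> carr (Lp M p)"
  by (simp add: carr_eq)

lemma nn_eq: "\<phi> \<in> \<L> \<Longrightarrow> nn \<phi> = ennreal (nrm \<phi> powr p)"
proof -
  assume "\<phi> \<in> \<L>"
  then have "nn \<phi> = ennreal (LINT x|M. cmod (\<phi> x) powr p)"
    unfolding nn_def by (intro nn_integral_eq_integral) (auto simp: \<L>_def)
  moreover have "(LINT x|M. cmod (\<phi> x) powr p) = nrm \<phi> powr p"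
    unfolding nrm_def using p by (simp add: powr_powr)
  ultimately show ?thesis by simp
qed

lemma nn_leD:
  assumes \<phi>: "\<phi> \<in> borel_measurable M" and le: "nn \<phi> \<le> ennreal (C powr p)" and C: "0 \<le> C"
  shows "\<phi> \<in> \<L>" "nrm \<phi> \<le> C"
proof -
  have "nn \<phi> < \<infinity>" using le_less_trans[OF le ennreal_less_top] by simp
  then show L: "\<phi> \<in> \<L>" using \<phi> unfolding \<L>_def nn_def
    by (auto intro!: integrableI_bounded)
  have "nrm \<phi> powr p \<le> C powr p" using le unfolding nn_eq[OF L] by simp
  then show "nrm \<phi> \<le> C" using powr_less_mono2[of p C "nrm \<phi>"] p C by linarith
qed

lemma nrm_nonneg: "0 \<le> nrm \<phi>" by (simp add: nrm_def)

lemma nn_scale: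
  assumes [measurable]: "\<phi> \<in> borel_measurable M"
  shows "nn (\<lambda>x. a * \<phi> x) = ennreal (cmod a powr p) * nn \<phi>"
proof -
  have "nn (\<lambda>x. a * \<phi> x) = (\<integral>\<^sup>+x. ennreal (cmod a powr p) * ennreal (cmod (\<phi> x) powr p) \<partial>M)"
    unfolding nn_def by (simp add: norm_mult powr_mult ennreal_mult)
  also have "\<dots> = ennreal (cmod a powr p) * nn \<phi>"
    unfolding nn_def by (rule nn_integral_cmult) measurable
  finally show ?thesis .
qed

lemma \<L>_scale: "\<phi> \<in> \<L> \<Longrightarrow> (\<lambda>x. a * \<phi> x) \<in> \<L>"
proof (rule nn_leD(1)[where C = "cmod a * nrm \<phi>"])
  assume \<phi>: "\<phi> \<in> \<L>"
  show "nn (\<lambda>x. a * \<phi> x) \<le> ennreal ((cmod a * nrm \<phi>) powr p)"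
    by (simp add: nn_scale[OF \<L>_measurable[OF \<phi>]] nn_eq[OF \<phi>] nrm_nonneg powr_mult ennreal_mult)
qed (auto simp: nrm_nonneg)

lemma \<L>_add:
  assumes "\<phi> \<in> \<L>" "\<psi> \<in> \<L>"
  shows "(\<lambda>x. \<phi> x + \<psi> x) \<in> \<L>"
proof -
  note [measurable] = \<L>_measurable[OF assms(1)] \<L>_measurable[OF assms(2)]
  have int: "integrable M (\<lambda>x. 2 powr p * (cmod (\<phi> x) powr p + cmod (\<psi> x) powr p))"
    using assms by (simp add: \<L>_def)
  have bound: "norm (cmod (\<phi> x + \<psi> x) powr p) \<le> norm (2 powr p * (cmod (\<phi> x) powr p + cmod (\<psi> x) powr p))" for x
  proof -
    \<comment> \<open>Estimating by twice the maximum is crude but suffices for integrability. The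
      triangle inequality of the norm itself is inherited from the embedding.\<close>
    define m where "m = max (cmod (\<phi> x)) (cmod (\<psi> x))"
    have "cmod (\<phi> x + \<psi> x) \<le> 2 * m" using norm_triangle_ineq[of "\<phi> x" "\<psi> x"] by (simp add: m_def)
    then have "cmod (\<phi> x + \<psi> x) powr p \<le> (2 * m) powr p" using p by (intro powr_mono2) auto
    also have "\<dots> = 2 powr p * m powr p" by (rule powr_mult)
    also have "m powr p \<le> cmod (\<phi> x) powr p + cmod (\<psi> x) powr p" by (auto simp: m_def max_def)
    finally show ?thesis by simp
  qed
  have "integrable M (\<lambda>x. cmod (\<phi> x + \<psi> x) powr p)"
    by (rule Bochner_Integration.integrable_bound[OF int _ AE_I2[OF bound]]) measurable
  then show ?thesis by (simp add: \<L>_def)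
qed

lemma \<L>_diff: "\<phi> \<in> \<L> \<Longrightarrow> \<psi> \<in> \<L> \<Longrightarrow> (\<lambda>x. \<phi> x - \<psi> x) \<in> \<L>"
  using \<L>_add[OF _ \<L>_scale[of \<psi> "-1"], of \<phi>] by simp

lemma \<L>_zero: "(\<lambda>x. 0) \<in> \<L>"
  using p by (simp add: \<L>_def)

lemma Lp_ops:
  "vzero (Lp M p) = cl (\<lambda>x. 0)"
  "\<phi> \<in> \<L> \<Longrightarrow> \<psi> \<in> \<L> \<Longrightarrow> vadd (Lp M p) (cl \<phi>) (cl \<psi>) = cl (\<lambda>x. \<phi> x + \<psi> x)"
  "\<phi> \<in> \<L> \<Longrightarrow> vscale (Lp M p) a (cl \<phi>) = cl (\<lambda>x. a * \<phi> x)"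
  "\<phi> \<in> \<L> \<Longrightarrow> vnorm (Lp M p) (cl \<phi>) = nrm \<phi>"
proof -
  show "vzero (Lp M p) = cl (\<lambda>x. 0)" by (simp add: Lp_def)
  assume \<phi>: "\<phi> \<in> \<L>"
  note r = rep_cl[OF \<phi>]
  show "vscale (Lp M p) a (cl \<phi>) = cl (\<lambda>x. a * \<phi> x)"
  proof -
    have "cl (\<lambda>x. a * rep (cl \<phi>) x) = cl (\<lambda>x. a * \<phi> x)"
      by (subst ae_class_eq_iff) (use r \<phi> in \<open>auto intro!: \<L>_measurable \<L>_scale\<close>)
    then show ?thesis by (simp add: Lp_def)
  qed
  show "vnorm (Lp M p) (cl \<phi>) = nrm \<phi>" using r(3) by (simp add: Lp_def nrm_def)
  assume \<psi>: "\<psi> \<in> \<L>"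
  note s = rep_cl[OF \<psi>]
  have "AE x in M. rep (cl \<phi>) x + rep (cl \<psi>) x = \<phi> x + \<psi> x" using r(2) s(2) by eventually_elim simp
  then have "cl (\<lambda>x. rep (cl \<phi>) x + rep (cl \<psi>) x) = cl (\<lambda>x. \<phi> x + \<psi> x)"
    by (subst ae_class_eq_iff) (use r s \<phi> \<psi> in \<open>auto intro!: \<L>_measurable \<L>_add\<close>)
  then show "vadd (Lp M p) (cl \<phi>) (cl \<psi>) = cl (\<lambda>x. \<phi> x + \<psi> x)" by (simp add: Lp_def)
qed

text \<open>The functionals of norm at most one given by integration against a function; by Young's
  inequality they determine the norm, so that evaluation at them embeds \<open>L\<^sup>p\<close> isometrically.\<close>

definition polar :: "('a \<Rightarrow> complex) set" where
  "polar = {\<psi> \<in> borel_measurable M. \<forall>\<phi>\<in>\<L>. integrable M (\<lambda>x. \<phi> x * \<psi> x) \<and> cmod (LINT x|M. \<phi> x * \<psi> x) \<le> nrm \<phi>}"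

text \<open>Hoelder's inequality against a power of \<open>\<phi>\<close>, obtained by integrating
  Young's inequality for \<open>\<xi> / t\<close> and \<open>\<phi> / N\<close>. It provides norming
  functionals and, for \<open>\<phi>\<close> the indicator of \<open>W\<close>, bounds means over
  \<open>W\<close>.\<close>

lemma Hoelder_powr:
  assumes \<phi>: "\<phi> \<in> \<L>" and \<xi>: "\<xi> \<in> \<L>" and N: "nrm \<phi> \<le> N" "0 < N"
  shows "integrable M (\<lambda>x. cmod (\<xi> x) * (cmod (\<phi> x) / N) powr (p - 1))"
    "(LINT x|M. cmod (\<xi> x) * (cmod (\<phi> x) / N) powr (p - 1)) \<le> nrm \<xi>"
proof -
  note [measurable] = \<L>_measurable[OF \<phi>] \<L>_measurable[OF \<xi>]
  let ?g = "\<lambda>x. cmod (\<xi> x) * (cmod (\<phi> x) / N) powr (p - 1)"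
  have ip: "integrable M (\<lambda>x. (cmod (\<eta> x) / t) powr p) \<and> (LINT x|M. (cmod (\<eta> x) / t) powr p) \<le> 1"
    if "\<eta> \<in> \<L>" "nrm \<eta> \<le> t" "0 < t" for \<eta> t
  proof -
    have int: "integrable M (\<lambda>x. cmod (\<eta> x) powr p)" using that by (simp add: \<L>_def)
    have e: "(\<lambda>x. (cmod (\<eta> x) / t) powr p) = (\<lambda>x. cmod (\<eta> x) powr p / t powr p)"
      using that by (simp add: powr_divide)
    have "(LINT x|M. cmod (\<eta> x) powr p) = nrm \<eta> powr p" using p by (simp add: nrm_def powr_powr)
    also have "\<dots> \<le> t powr p" using that p by (intro powr_mono2) (auto simp: nrm_nonneg)
    finally show ?thesis unfolding e using int that by simp
  qed
  \<comment> \<open>The scale \<open>t\<close> is any positive bound of \<open>nrm \<xi>\<close>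
    rather than the norm itself, so that \<open>\<xi>\<close> may have norm 0; afterwards
    \<open>t\<close> decreases to \<open>nrm \<xi>\<close>.\<close>
  have main: "integrable M ?g \<and> (LINT x|M. ?g x) \<le> t" if t: "nrm \<xi> \<le> t" "0 < t" for t
  proof -
    let ?h = "\<lambda>x. t * ((cmod (\<xi> x) / t) powr p / p + (1 - 1 / p) * (cmod (\<phi> x) / N) powr p)"
    have le: "?g x \<le> ?h x" for x
    proof -
      have "t * ((cmod (\<xi> x) / t) * (cmod (\<phi> x) / N) powr (p - 1)) \<le> ?h x"
        using t N p by (intro mult_left_mono Young_powr) auto
      then show ?thesis using t by simp
    qed
    note i\<xi> = ip[OF \<xi> t] and i\<phi> = ip[OF \<phi> N]
    have ih: "integrable M ?h" using i\<xi> i\<phi> by auto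
    have ig: "integrable M ?g"
    proof (rule Bochner_Integration.integrable_bound[OF ih])
      show "AE x in M. norm (?g x) \<le> norm (?h x)"
        using le t N by (intro AE_I2) (smt (verit) divide_nonneg_nonneg mult_nonneg_nonneg norm_ge_zero powr_ge_zero real_norm_def)
    qed measurable
    have "(LINT x|M. ?g x) \<le> (LINT x|M. ?h x)" by (intro integral_mono ig ih le)
    also have "\<dots> = t * ((LINT x|M. (cmod (\<xi> x) / t) powr p) / p + (1 - 1 / p) * (LINT x|M. (cmod (\<phi> x) / N) powr p))"
      using i\<xi> i\<phi> by simp
    also have "\<dots> \<le> t * (1 / p + (1 - 1 / p) * 1)"
      using i\<xi> i\<phi> t p by (intro mult_left_mono add_mono divide_right_mono) (auto simp: mult_left_le)
    finally show ?thesis using ig by simp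
  qed
  show "integrable M ?g" using main[of "nrm \<xi> + 1"] nrm_nonneg[of \<xi>] by simp
  show "(LINT x|M. ?g x) \<le> nrm \<xi>"
  proof (rule field_le_epsilon)
    fix e :: real assume "0 < e"
    then show "(LINT x|M. ?g x) \<le> nrm \<xi> + e" using main[of "nrm \<xi> + e"] nrm_nonneg[of \<xi>] by simp
  qed
qed

lemma borel_measurable_cnj [measurable]: "cnj \<in> borel_measurable borel"
  by (intro borel_measurable_continuous_onI continuous_intros)

lemma polar_norming:
  assumes \<phi>: "\<phi> \<in> \<L>" and N: "0 < nrm \<phi>"
  obtains \<psi> where "\<psi> \<in> polar" "(LINT x|M. \<phi> x * \<psi> x) = of_real (nrm \<phi>)"
proof -
  note [measurable] = \<L>_measurable[OF \<phi>]
  define N where "N = nrm \<phi>"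
  have N: "0 < N" using assms by (simp add: N_def)
  \<comment> \<open>The equality case of Hoelder's inequality. The exponent \<open>p - 2\<close> may
    be negative, but where \<open>\<phi>\<close> vanishes so does the factor
    \<open>cnj (\<phi> x)\<close>.\<close>
  define \<psi> where "\<psi> x = cnj (\<phi> x) * of_real (cmod (\<phi> x) powr (p - 2) / N powr (p - 1))" for x
  have [measurable]: "\<psi> \<in> borel_measurable M" unfolding \<psi>_def by measurable
  have norm_\<psi>: "cmod (\<psi> x) = (cmod (\<phi> x) / N) powr (p - 1)" for x
  proof (cases "\<phi> x = 0")
    case False
    have "cmod (\<phi> x) * cmod (\<phi> x) powr (p - 2) = cmod (\<phi> x) powr (p - 1)"
      using False powr_mult_base[of "cmod (\<phi> x)" "p - 2"] by (simp add: algebra_simps)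
    then show ?thesis using N by (simp add: \<psi>_def norm_mult norm_divide powr_divide)
  qed (simp add: \<psi>_def)
  have "\<psi> \<in> polar"
    unfolding polar_def
  proof (intro CollectI conjI ballI)
    fix \<xi> assume \<xi>: "\<xi> \<in> \<L>"
    note [measurable] = \<L>_measurable[OF \<xi>]
    note H = Hoelder_powr[OF \<phi> \<xi> _ N, folded norm_\<psi>, unfolded N_def, simplified]
    have n: "norm (\<xi> x * \<psi> x) = cmod (\<xi> x) * cmod (\<psi> x)" for x by (simp add: norm_mult)
    show i: "integrable M (\<lambda>x. \<xi> x * \<psi> x)"
      by (rule Bochner_Integration.integrable_bound[OF H(1)]) (auto simp: n)
    show "cmod (LINT x|M. \<xi> x * \<psi> x) \<le> nrm \<xi>"
      using integral_norm_bound[of M "\<lambda>x. \<xi> x * \<psi> x"] H(2) by (simp add: n)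
  qed measurable
  moreover have "(LINT x|M. \<phi> x * \<psi> x) = of_real (nrm \<phi>)"
  proof -
    have "\<phi> x * \<psi> x = of_real (cmod (\<phi> x) powr p / N powr (p - 1))" for x
    proof (cases "\<phi> x = 0")
      case False
      have "\<phi> x * \<psi> x = of_real (cmod (\<phi> x) * (cmod (\<phi> x) * cmod (\<phi> x) powr (p - 2)) / N powr (p - 1))"
        using complex_norm_square[of "\<phi> x"] by (simp add: \<psi>_def power2_eq_square mult.assoc[symmetric])
      also have "cmod (\<phi> x) * (cmod (\<phi> x) * cmod (\<phi> x) powr (p - 2)) = cmod (\<phi> x) powr p"
        using False powr_mult_base[of "cmod (\<phi> x)" "p - 2"] powr_mult_base[of "cmod (\<phi> x)" "p - 1"]
        by (simp add: algebra_simps)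
      finally show ?thesis .
    qed simp
    then have "(LINT x|M. \<phi> x * \<psi> x) = of_real ((LINT x|M. cmod (\<phi> x) powr p) / N powr (p - 1))"
      by (simp only: integral_complex_of_real integral_divide_zero)
    also have "(LINT x|M. cmod (\<phi> x) powr p) = N powr p" using p by (simp add: nrm_def powr_powr N_def)
    also have "N powr p / N powr (p - 1) = N" using N by (simp flip: powr_diff)
    finally show ?thesis by (simp add: N_def)
  qed
  ultimately show ?thesis by (rule that)
qed

text \<open>The index type is a discrete copy of all functions, on which every function is
  continuous; the value 0 outside \<open>polar\<close> keeps the evaluation bounded.\<close>

definition J :: "('a \<Rightarrow> complex) set \<Rightarrow> ('a \<Rightarrow> complex) discrete \<Rightarrow>\<^sub>C complex" where
  "J \<Phi> = Bcontfun (\<lambda>\<psi>. if of_discrete \<psi> \<in> polar then LINT x|M. rep \<Phi> x * of_discrete \<psi> x else 0)"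

lemma polarD:
  assumes "\<psi> \<in> polar" "\<phi> \<in> \<L>"
  shows "integrable M (\<lambda>x. \<phi> x * \<psi> x)" "cmod (LINT x|M. \<phi> x * \<psi> x) \<le> nrm \<phi>" "\<psi> \<in> borel_measurable M"
  using assms by (auto simp: polar_def)

lemma J_apply:
  assumes \<phi>: "\<phi> \<in> \<L>"
  shows "apply_bcontfun (J (cl \<phi>)) \<psi> = (if of_discrete \<psi> \<in> polar then LINT x|M. \<phi> x * of_discrete \<psi> x else 0)"
proof -
  note r = rep_cl[OF \<phi>]
  let ?f = "\<lambda>\<psi>. if of_discrete \<psi> \<in> polar then LINT x|M. rep (cl \<phi>) x * of_discrete \<psi> x else 0"
  have "?f \<in> bcontfun"
  proof (rule bcontfun_normI)
    show "continuous_on UNIV ?f"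
      unfolding continuous_on_open_vimage[OF open_UNIV] using open_discrete by blast
    show "norm (?f \<psi>) \<le> nrm (rep (cl \<phi>))" for \<psi>
      using polarD(2)[OF _ r(1)] nrm_nonneg by auto
  qed
  then have "apply_bcontfun (J (cl \<phi>)) \<psi> = ?f \<psi>" by (simp add: J_def Bcontfun_inverse)
  moreover have "(LINT x|M. rep (cl \<phi>) x * of_discrete \<psi> x) = (LINT x|M. \<phi> x * of_discrete \<psi> x)" if "of_discrete \<psi> \<in> polar"
  proof (rule integral_cong_AE)
    show "AE x in M. rep (cl \<phi>) x * of_discrete \<psi> x = \<phi> x * of_discrete \<psi> x"
      using r(2) by eventually_elim simp
  qed (use polarD(1)[OF that] r \<phi> in \<open>auto dest: borel_measurable_integrable\<close>)
  ultimately show ?thesis by simp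
qed

lemma J_add_cl: "\<phi> \<in> \<L> \<Longrightarrow> \<psi> \<in> \<L> \<Longrightarrow> J (cl (\<lambda>x. \<phi> x + \<psi> x)) = J (cl \<phi>) + J (cl \<psi>)"
  by (auto intro!: bcontfun_eqI simp: J_apply \<L>_add distrib_right polarD)

lemma J_scale_cl: "\<phi> \<in> \<L> \<Longrightarrow> J (cl (\<lambda>x. a * \<phi> x)) = cscale a (J (cl \<phi>))"
  by (auto intro!: bcontfun_eqI simp: J_apply \<L>_scale mult.assoc polarD)

lemma J_diff_cl: "\<phi> \<in> \<L> \<Longrightarrow> \<psi> \<in> \<L> \<Longrightarrow> J (cl (\<lambda>x. \<phi> x - \<psi> x)) = J (cl \<phi>) - J (cl \<psi>)"
  by (auto intro!: bcontfun_eqI simp: J_apply \<L>_diff left_diff_distrib polarD)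

lemma J_norm:
  assumes \<phi>: "\<phi> \<in> \<L>"
  shows "norm (J (cl \<phi>)) = nrm \<phi>"
proof (rule antisym)
  show "norm (J (cl \<phi>)) \<le> nrm \<phi>"
    by (rule norm_bound) (use \<phi> polarD nrm_nonneg in \<open>auto simp: J_apply\<close>)
  show "nrm \<phi> \<le> norm (J (cl \<phi>))"
  proof (cases "nrm \<phi> = 0")
    case False
    then have "0 < nrm \<phi>" using nrm_nonneg[of \<phi>] by simp
    then obtain \<psi> where \<psi>: "\<psi> \<in> polar" "(LINT x|M. \<phi> x * \<psi> x) = of_real (nrm \<phi>)"
      by (rule polar_norming[OF \<phi>])
    then have "nrm \<phi> = norm (apply_bcontfun (J (cl \<phi>)) (discrete \<psi>))"
      by (simp add: J_apply \<phi> discrete_inverse nrm_nonneg)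
    also have "\<dots> \<le> norm (J (cl \<phi>))" by (rule norm_bounded)
    finally show ?thesis .
  qed simp
qed

section \<open>Injectivity and closed range of the embedding\<close>

lemma nrm_eq_0D:
  assumes \<phi>: "\<phi> \<in> \<L>" and 0: "nrm \<phi> = 0"
  shows "AE x in M. \<phi> x = 0"
proof -
  note [measurable] = \<L>_measurable[OF \<phi>]
  have "nn \<phi> = 0" using nn_eq[OF \<phi>] 0 by simp
  then have "AE x in M. ennreal (cmod (\<phi> x) powr p) = 0"
    unfolding nn_def by (subst nn_integral_0_iff_AE[symmetric]) auto
  then show ?thesis by eventually_elim (simp add: ennreal_eq_0_iff)
qed

lemma J_inj: "inj_on J (carr (Lp M p))"
proof (rule inj_onI)
  fix \<Phi> \<Psi> assume *: "\<Phi> \<in> carr (Lp M p)" "\<Psi> \<in> carr (Lp M p)" "J \<Phi> = J \<Psi>"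
  obtain \<phi> where \<phi>: "\<phi> \<in> \<L>" "\<Phi> = cl \<phi>" using *(1) by (rule carrE)
  obtain \<psi> where \<psi>: "\<psi> \<in> \<L>" "\<Psi> = cl \<psi>" using *(2) by (rule carrE)
  have "nrm (\<lambda>x. \<phi> x - \<psi> x) = 0"
    using * by (simp add: \<phi> \<psi> \<L>_diff J_diff_cl flip: J_norm)
  from nrm_eq_0D[OF \<L>_diff[OF \<phi>(1) \<psi>(1)] this] have "AE x in M. \<phi> x = \<psi> x" by simp
  then show "\<Phi> = \<Psi>" using \<phi> \<psi> by (simp add: ae_class_eq_iff \<L>_measurable)
qed

text \<open>Riesz-Fischer. A sequence approaching its limit at rate \<open>4^-n\<close> has
  increments whose multiples by \<open>2^n\<close> still have summable \<open>p\<close>-th powers;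
  hence these increments are almost everywhere dominated by a geometric sequence. Fatou's lemma
  identifies the pointwise limit as the limit in norm.\<close>

lemma J_closed: "closed (J ` carr (Lp M p))"
proof -
  have "v \<in> J ` carr (Lp M p)" if v: "v \<in> closure (J ` carr (Lp M p))" for v
  proof -
    have "\<exists>\<phi>. \<phi> \<in> \<L> \<and> dist (J (cl \<phi>)) v < (1 / 4) ^ n" for n :: nat
    proof -
      have "\<exists>y\<in>J ` carr (Lp M p). dist y v < (1 / 4) ^ n"
        using v unfolding closure_approachable by simp
      then show ?thesis unfolding carr_eq by auto
    qed
    then obtain \<phi> where \<phi>: "\<And>n. \<phi> n \<in> \<L>" "\<And>n. dist (J (cl (\<phi> n))) v < (1 / 4) ^ n" by metis
    note [measurable] = \<L>_measurable[OF \<phi>(1)]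
    have close: "nrm (\<lambda>x. \<phi> m x - \<phi> n x) \<le> 2 * (1 / 4) ^ n" if "n \<le> m" for m n
    proof -
      have "nrm (\<lambda>x. \<phi> m x - \<phi> n x) = dist (J (cl (\<phi> m))) (J (cl (\<phi> n)))"
        using \<phi>(1) by (simp add: dist_norm J_diff_cl \<L>_diff flip: J_norm)
      also have "\<dots> \<le> (1 / 4) ^ m + (1 / 4) ^ n"
        using dist_triangle2[of "J (cl (\<phi> m))" "J (cl (\<phi> n))" v] \<phi>(2)[of m] \<phi>(2)[of n] by linarith
      also have "(1 / 4 :: real) ^ m \<le> (1 / 4) ^ n" using that by (intro power_decreasing) auto
      finally show ?thesis by simp
    qed
    let ?\<Delta> = "\<lambda>n x. \<phi> (Suc n) x - \<phi> n x"
    \<comment> \<open>The multiplied increments have norm at most \<open>2 * (1/2)^n\<close>, and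
      raising \<open>(1/2)^n\<close> to a power \<open>p \<ge> 1\<close> only decreases it.\<close>
    have \<Delta>: "nn (\<lambda>x. 2 ^ n * ?\<Delta> n x) \<le> ennreal (2 powr p * (1 / 2) ^ n)" for n
    proof -
      have "nn (\<lambda>x. 2 ^ n * ?\<Delta> n x) = ennreal ((2 ^ n) powr p) * ennreal (nrm (?\<Delta> n) powr p)"
        by (simp add: nn_scale nn_eq \<L>_diff \<phi>(1) norm_power)
      also have "\<dots> = ennreal ((2 ^ n * nrm (?\<Delta> n)) powr p)"
        by (simp add: powr_mult nrm_nonneg ennreal_mult)
      also have "\<dots> \<le> ennreal (2 powr p * (1 / 2) ^ n)"
      proof (rule ennreal_leI)
        have "2 ^ n * nrm (?\<Delta> n) \<le> 2 ^ n * (2 * (1 / 4) ^ n)" by (intro mult_left_mono close) auto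
        also have "\<dots> = 2 * (1 / 2) ^ n" by (simp add: power_mult_distrib[symmetric])
        finally have "(2 ^ n * nrm (?\<Delta> n)) powr p \<le> (2 * (1 / 2) ^ n) powr p"
          using p by (intro powr_mono2) (auto simp: nrm_nonneg)
        also have "\<dots> = 2 powr p * ((1 / 2) ^ n) powr p" by (rule powr_mult)
        also have "((1 / 2 :: real) ^ n) powr p \<le> ((1 / 2) ^ n) powr 1"
          using p by (intro powr_mono') (auto simp: power_le_one)
        finally show "(2 ^ n * nrm (?\<Delta> n)) powr p \<le> 2 powr p * (1 / 2) ^ n" by simp
      qed
      finally show ?thesis .
    qed
    have "(\<integral>\<^sup>+x. (\<Sum>n. ennreal (cmod (2 ^ n * ?\<Delta> n x) powr p)) \<partial>M) = (\<Sum>n. nn (\<lambda>x. 2 ^ n * ?\<Delta> n x))"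
      unfolding nn_def by (rule nn_integral_suminf) measurable
    also have "\<dots> \<le> (\<Sum>n. ennreal (2 powr p * (1 / 2) ^ n))" by (intro suminf_le \<Delta>) auto
    also have "\<dots> = ennreal (\<Sum>n. 2 powr p * (1 / 2) ^ n)"
      by (intro suminf_ennreal2 summable_mult summable_geometric) auto
    also have "\<dots> < \<infinity>" by simp
    finally have fin: "(\<integral>\<^sup>+x. (\<Sum>n. ennreal (cmod (2 ^ n * ?\<Delta> n x) powr p)) \<partial>M) < \<infinity>" .
    have m: "(\<lambda>x. \<Sum>n. ennreal (cmod (2 ^ n * ?\<Delta> n x) powr p)) \<in> borel_measurable M"
      by measurable
    have "AE x in M. (\<Sum>n. ennreal (cmod (2 ^ n * ?\<Delta> n x) powr p)) \<noteq> \<infinity>"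
      by (rule nn_integral_PInf_AE[OF m]) (use fin in simp)
    then have conv: "AE x in M. (\<lambda>n. \<phi> n x) \<longlonglongrightarrow> lim (\<lambda>n. \<phi> n x)"
    proof eventually_elim
      case (elim x)
      define C where "C = enn2real (\<Sum>n. ennreal (cmod (2 ^ n * ?\<Delta> n x) powr p))"
      have C: "(\<Sum>n. ennreal (cmod (2 ^ n * ?\<Delta> n x) powr p)) = ennreal C" "0 \<le> C"
        using elim by (auto simp: C_def less_top)
      have dec: "cmod (?\<Delta> n x) \<le> C powr (1 / p) * (1 / 2) ^ n" for n
      proof -
        have "(\<Sum>k\<in>{n}. ennreal (cmod (2 ^ k * ?\<Delta> k x) powr p)) \<le> (\<Sum>n. ennreal (cmod (2 ^ n * ?\<Delta> n x) powr p))"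
          by (intro sum_le_suminf) auto
        then have "cmod (2 ^ n * ?\<Delta> n x) powr p \<le> C" unfolding C(1) using C(2) by simp
        then have "(cmod (2 ^ n * ?\<Delta> n x) powr p) powr (1 / p) \<le> C powr (1 / p)"
          using p by (intro powr_mono2) auto
        then have "2 ^ n * cmod (?\<Delta> n x) \<le> C powr (1 / p)"
          using p by (simp add: powr_powr norm_mult norm_power)
        then have "(1 / 2) ^ n * (2 ^ n * cmod (?\<Delta> n x)) \<le> (1 / 2) ^ n * C powr (1 / p)"
          by (intro mult_left_mono) auto
        moreover have "(1 / 2 :: real) ^ n * 2 ^ n = 1" by (simp flip: power_mult_distrib)
        ultimately show ?thesis by (simp only: mult.assoc[symmetric] mult_1_left mult.commute[of "C powr (1 / p)"])
      qed
      have "summable (\<lambda>n. C powr (1 / p) * (1 / 2 :: real) ^ n)"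
        by (intro summable_mult summable_geometric) auto
      then have "summable (\<lambda>n. ?\<Delta> n x)"
        by (rule summable_comparison_test'[where N = 0]) (rule dec)
      then have "convergent (\<lambda>n. \<Sum>i<n. ?\<Delta> i x)" by (simp add: summable_iff_convergent)
      moreover have "(\<Sum>i<n. ?\<Delta> i x) = \<phi> n x - \<phi> 0 x" for n
        by (rule sum_lessThan_telescope)
      ultimately have "convergent (\<lambda>n. \<phi> n x - \<phi> 0 x)" by simp
      then have "convergent (\<lambda>n. (\<phi> n x - \<phi> 0 x) + \<phi> 0 x)" by (intro convergent_add convergent_const)
      then show ?case by (simp add: convergent_LIMSEQ_iff)
    qed
    \<comment> \<open>On the null set without convergence \<open>lim\<close> has an arbitrary
      value.\<close>
    define \<psi> where "\<psi> x = lim (\<lambda>n. \<phi> n x)" for x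
    have [measurable]: "\<psi> \<in> borel_measurable M" unfolding \<psi>_def by measurable
    have limit: "(\<lambda>x. \<psi> x - \<phi> n x) \<in> \<L> \<and> nrm (\<lambda>x. \<psi> x - \<phi> n x) \<le> 2 * (1 / 4) ^ n" for n
    proof -
      \<comment> \<open>The limit in \<open>m\<close> is written as a lower limit to prepare for
        Fatou's lemma.\<close>
      have "nn (\<lambda>x. \<psi> x - \<phi> n x) = (\<integral>\<^sup>+x. liminf (\<lambda>m. ennreal (cmod (\<phi> m x - \<phi> n x) powr p)) \<partial>M)"
        unfolding nn_def
      proof (rule nn_integral_cong_AE, use conv in eventually_elim)
        case (elim x)
        have "(\<lambda>m. ennreal (cmod (\<phi> m x - \<phi> n x) powr p)) \<longlonglongrightarrow> ennreal (cmod (\<psi> x - \<phi> n x) powr p)"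
          using p elim unfolding \<psi>_def by (intro tendsto_ennrealI tendsto_powr' tendsto_intros) auto
        from lim_imp_Liminf[OF sequentially_bot this] show ?case by simp
      qed
      also have "\<dots> \<le> liminf (\<lambda>m. nn (\<lambda>x. \<phi> m x - \<phi> n x))"
        unfolding nn_def by (rule nn_integral_liminf) measurable
      also have "\<dots> \<le> ennreal ((2 * (1 / 4) ^ n) powr p)"
      proof (rule Liminf_le)
        show "\<forall>\<^sub>F m in sequentially. nn (\<lambda>x. \<phi> m x - \<phi> n x) \<le> ennreal ((2 * (1 / 4) ^ n) powr p)"
          using eventually_ge_at_top[of n]
        proof eventually_elim
          case (elim m)
          then show ?case unfolding nn_eq[OF \<L>_diff[OF \<phi>(1) \<phi>(1)]]
            using p by (intro ennreal_leI powr_mono2 close) (auto simp: nrm_nonneg)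
        qed
      qed simp
      finally show ?thesis using nn_leD[of "\<lambda>x. \<psi> x - \<phi> n x"] by auto
    qed
    have \<psi>: "\<psi> \<in> \<L>" using \<L>_add[OF conjunct1[OF limit[of 0]] \<phi>(1)[of 0]] by simp
    have four: "(\<lambda>n. (1 / 4 :: real) ^ n) \<longlonglongrightarrow> 0" by (rule LIMSEQ_realpow_zero) auto
    have four': "(\<lambda>n. 2 * (1 / 4 :: real) ^ n) \<longlonglongrightarrow> 0" using tendsto_mult_left[OF four, of 2] by simp
    have "(\<lambda>n. J (cl (\<phi> n))) \<longlonglongrightarrow> J (cl \<psi>)"
    proof (rule metric_LIMSEQ_I, goal_cases)
      case (1 e)
      then obtain N where N: "\<And>n. N \<le> n \<Longrightarrow> 2 * (1 / 4 :: real) ^ n < e"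
        using order_tendstoD(2)[OF four' 1] unfolding eventually_sequentially by blast
      have "dist (J (cl (\<phi> n))) (J (cl \<psi>)) < e" if "N \<le> n" for n
      proof -
        have "dist (J (cl (\<phi> n))) (J (cl \<psi>)) = nrm (\<lambda>x. \<psi> x - \<phi> n x)"
          using \<phi>(1) \<psi> by (simp add: dist_norm norm_minus_commute J_diff_cl \<L>_diff flip: J_norm)
        also have "\<dots> < e" using limit[of n] N[OF that] by linarith
        finally show ?thesis .
      qed
      then show ?case by blast
    qed
    moreover have "(\<lambda>n. J (cl (\<phi> n))) \<longlonglongrightarrow> v"
    proof (rule metric_LIMSEQ_I, goal_cases)
      case (1 e)
      then obtain N where N: "\<And>n. N \<le> n \<Longrightarrow> (1 / 4 :: real) ^ n < e"
        using order_tendstoD(2)[OF four 1] unfolding eventually_sequentially by blast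
      then show ?case using \<phi>(2) less_trans by blast
    qed
    ultimately have "v = J (cl \<psi>)" by (rule LIMSEQ_unique[rotated])
    then show ?thesis using \<psi> cl_mem by blast
  qed
  then show ?thesis by (metis closure_subset closure_eq subsetI subset_antisym)
qed

sublocale embedded_space "Lp M p" J
proof
  show "inj_on J (carr (Lp M p))" by (rule J_inj)
  show "closed (J ` carr (Lp M p))" by (rule J_closed)
  show "vzero (Lp M p) \<in> carr (Lp M p)" by (simp add: Lp_ops cl_mem \<L>_zero)
  show "J (vzero (Lp M p)) = 0" by (rule bcontfun_eqI) (simp add: Lp_ops J_apply \<L>_zero)
  fix \<Phi> assume "\<Phi> \<in> carr (Lp M p)"
  then obtain \<phi> where \<phi>: "\<phi> \<in> \<L>" "\<Phi> = cl \<phi>" by (rule carrE)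
  show "vscale (Lp M p) a \<Phi> \<in> carr (Lp M p)" for a
    using \<phi> by (simp add: Lp_ops cl_mem \<L>_scale)
  show "J (vscale (Lp M p) a \<Phi>) = cscale a (J \<Phi>)" for a
    using \<phi> by (simp add: Lp_ops J_scale_cl)
  show "vnorm (Lp M p) \<Phi> = norm (J \<Phi>)" using \<phi> by (simp add: Lp_ops J_norm)
  fix \<Psi> assume "\<Psi> \<in> carr (Lp M p)"
  then obtain \<psi> where \<psi>: "\<psi> \<in> \<L>" "\<Psi> = cl \<psi>" by (rule carrE)
  show "vadd (Lp M p) \<Phi> \<Psi> \<in> carr (Lp M p)" using \<phi> \<psi> by (simp add: Lp_ops cl_mem \<L>_add)
  show "J (vadd (Lp M p) \<Phi> \<Psi>) = J \<Phi> + J \<Psi>" using \<phi> \<psi> by (simp add: Lp_ops J_add_cl)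
qed

lemma vdiff_cl: "\<phi> \<in> \<L> \<Longrightarrow> \<psi> \<in> \<L> \<Longrightarrow> vdiff (Lp M p) (cl \<phi>) (cl \<psi>) = cl (\<lambda>x. \<phi> x - \<psi> x)"
  using \<L>_scale[of \<psi> "-1"] by (simp add: vdiff_def Lp_ops)

end

section \<open>Composition operators\<close>

context Lp_space
begin

text \<open>The bound on preimages says that the image measure, cut off to \<open>Y\<close>, is at
  most \<open>C\<close> times \<open>M\<close>. The restriction to \<open>Y\<close> is essential
  later: the decay of iterates holds only on one side of the sign change.\<close>

lemma nn_integral_comp_le:
  assumes [measurable]: "g \<in> measurable M M" "Y \<in> sets M" "h \<in> borel_measurable M"
    and le: "\<And>B. B \<in> sets M \<Longrightarrow> B \<subseteq> Y \<Longrightarrow> emeasure M (g -` B \<inter> space M) \<le> C * emeasure M B"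
    and h: "\<And>x. x \<in> space M - Y \<Longrightarrow> h x = (0 :: ennreal)"
  shows "(\<integral>\<^sup>+x. h (g x) \<partial>M) \<le> C * (\<integral>\<^sup>+x. h x \<partial>M)"
proof -
  let ?N = "density (distr M M g) (indicator Y)"
  have sets: "sets ?N = sets (scale_measure C M)" by simp
  have "?N \<le> scale_measure C M"
  proof (subst le_measure[OF sets], rule ballI)
    fix B assume "B \<in> sets ?N"
    then have B: "B \<in> sets M" by simp
    have "emeasure ?N B = (\<integral>\<^sup>+x. indicator (Y \<inter> B) x \<partial>distr M M g)"
      using B by (simp add: emeasure_density indicator_inter_arith)
    also have "\<dots> = emeasure M (g -` (Y \<inter> B) \<inter> space M)"
      using B by (simp add: emeasure_distr)
    also have "\<dots> \<le> C * emeasure M (Y \<inter> B)" using B by (intro le) auto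
    also have "\<dots> \<le> C * emeasure M B" using B by (intro mult_left_mono emeasure_mono) auto
    also have "\<dots> = emeasure (scale_measure C M) B" by simp
    finally show "emeasure ?N B \<le> emeasure (scale_measure C M) B" .
  qed
  then have "nn_integral ?N h \<le> nn_integral (scale_measure C M) h"
    by (rule nn_integral_mono_measure[OF sets])
  moreover have "nn_integral (scale_measure C M) h = C * nn_integral M h"
    by (rule nn_integral_scale_measure) measurable
  moreover have "nn_integral ?N h = (\<integral>\<^sup>+x. indicator Y x * h x \<partial>distr M M g)"
    by (subst nn_integral_density) auto
  moreover have "\<dots> = (\<integral>\<^sup>+x. h x \<partial>distr M M g)"
    by (rule nn_integral_cong) (use h in \<open>auto simp: indicator_def\<close>)
  moreover have "\<dots> = (\<integral>\<^sup>+x. h (g x) \<partial>M)" by (subst nn_integral_distr) auto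
  ultimately show ?thesis by simp
qed

lemma nn_comp_le:
  assumes g: "g \<in> measurable M M" and Y: "Y \<in> sets M" and \<phi>: "\<phi> \<in> \<L>" and C: "0 \<le> C"
    and le: "\<And>B. B \<in> sets M \<Longrightarrow> B \<subseteq> Y \<Longrightarrow> emeasure M (g -` B \<inter> space M) \<le> ennreal (C powr p) * emeasure M B"
    and 0: "\<And>x. x \<in> space M - Y \<Longrightarrow> \<phi> x = 0"
  shows "\<phi> \<circ> g \<in> \<L>" "nrm (\<phi> \<circ> g) \<le> C * nrm \<phi>"
proof -
  note [measurable] = g \<L>_measurable[OF \<phi>]
  have "nn (\<phi> \<circ> g) \<le> ennreal (C powr p) * nn \<phi>"
    using nn_integral_comp_le[OF g Y _ le, of "\<lambda>x. ennreal (cmod (\<phi> x) powr p)"] 0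
    by (simp add: nn_def)
  also have "\<dots> = ennreal ((C * nrm \<phi>) powr p)"
    using C by (simp add: nn_eq[OF \<phi>] powr_mult nrm_nonneg ennreal_mult)
  finally have "nn (\<phi> \<circ> g) \<le> ennreal ((C * nrm \<phi>) powr p)" .
  then show "\<phi> \<circ> g \<in> \<L>" "nrm (\<phi> \<circ> g) \<le> C * nrm \<phi>"
    using C by (auto intro!: nn_leD mult_nonneg_nonneg nrm_nonneg)
qed

text \<open>The common property of \<open>f\<close> and of its inverse: composition is bounded and,
  as null sets have null preimages, well defined on classes.\<close>

definition compressing :: "('a \<Rightarrow> 'a) \<Rightarrow> bool" where
  "compressing g \<longleftrightarrow> g \<in> measurable M M \<and>
     (\<exists>c\<ge>0. \<forall>B\<in>sets M. emeasure M (g -` B \<inter> space M) \<le> ennreal c * emeasure M B)"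

lemma compressing_comp:
  assumes "compressing g"
  obtains C where "0 \<le> C" "\<And>\<phi>. \<phi> \<in> \<L> \<Longrightarrow> \<phi> \<circ> g \<in> \<L> \<and> nrm (\<phi> \<circ> g) \<le> C * nrm \<phi>"
proof -
  obtain c where c: "0 \<le> c" "\<And>B. B \<in> sets M \<Longrightarrow> emeasure M (g -` B \<inter> space M) \<le> ennreal c * emeasure M B"
    and g: "g \<in> measurable M M" using assms by (auto simp: compressing_def)
  have e: "(c powr (1 / p)) powr p = c" using c p by (simp add: powr_powr)
  show ?thesis
  proof (rule that[of "c powr (1 / p)"])
    fix \<phi> assume \<phi>: "\<phi> \<in> \<L>"
    show "\<phi> \<circ> g \<in> \<L> \<and> nrm (\<phi> \<circ> g) \<le> c powr (1 / p) * nrm \<phi>"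
      using nn_comp_le[OF g sets.top \<phi>, of "c powr (1 / p)"] c by (auto simp: e)
  qed simp
qed

lemma compressing_AE:
  assumes g: "compressing g" and P: "AE x in M. P x"
  shows "AE x in M. P (g x)"
proof -
  obtain c where c: "\<And>B. B \<in> sets M \<Longrightarrow> emeasure M (g -` B \<inter> space M) \<le> ennreal c * emeasure M B"
    and m[measurable]: "g \<in> measurable M M" using g by (auto simp: compressing_def)
  obtain N where N: "{x \<in> space M. \<not> P x} \<subseteq> N" "emeasure M N = 0" "N \<in> sets M"
    using P by (rule AE_E)
  have "emeasure M (g -` N \<inter> space M) = 0" using c[OF N(3)] N(2) by simp
  moreover have "{x \<in> space M. \<not> P (g x)} \<subseteq> g -` N \<inter> space M"
    using N(1) measurable_space[OF m] by auto
  moreover have "g -` N \<inter> space M \<in> sets M" using N(3) by measurable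
  ultimately show ?thesis by (intro AE_I) auto
qed

lemma cl_cong:
  assumes "\<phi> \<in> borel_measurable M" "\<And>x. x \<in> space M \<Longrightarrow> \<phi> x = \<psi> x"
  shows "cl \<phi> = cl \<psi>"
proof -
  have "\<psi> \<in> borel_measurable M" using assms measurable_cong[of M \<phi> \<psi>] by blast
  then show ?thesis using assms by (simp add: ae_class_eq_iff)
qed

lemma composition_cl:
  assumes g: "compressing g" and \<phi>: "\<phi> \<in> \<L>"
  shows "composition_operator M g (cl \<phi>) = cl (\<phi> \<circ> g)"
proof -
  have m[measurable]: "g \<in> measurable M M" using g by (simp add: compressing_def)
  note r = rep_cl[OF \<phi>]
  note [measurable] = \<L>_measurable[OF \<phi>] \<L>_measurable[OF r(1)]
  have "AE x in M. (rep (cl \<phi>) \<circ> g) x = (\<phi> \<circ> g) x" using compressing_AE[OF g r(2)] by simp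
  then show ?thesis unfolding composition_operator_def by (subst ae_class_eq_iff) auto
qed

lemma composition_bounded:
  assumes g: "compressing g"
  shows "bounded_operator (Lp M p) (composition_operator M g)"
proof -
  obtain C where C: "0 \<le> C" "\<And>\<phi>. \<phi> \<in> \<L> \<Longrightarrow> \<phi> \<circ> g \<in> \<L>" "\<And>\<phi>. \<phi> \<in> \<L> \<Longrightarrow> nrm (\<phi> \<circ> g) \<le> C * nrm \<phi>"
    using compressing_comp[OF g] by metis
  have o: "(\<lambda>x. \<phi> x + \<psi> x) \<circ> g = (\<lambda>x. (\<phi> \<circ> g) x + (\<psi> \<circ> g) x)"
    "(\<lambda>x. a * \<phi> x) \<circ> g = (\<lambda>x. a * (\<phi> \<circ> g) x)" for \<phi> \<psi> :: "'a \<Rightarrow> complex" and a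
    by auto
  have add: "composition_operator M g (vadd (Lp M p) (cl \<phi>) (cl \<psi>)) =
      vadd (Lp M p) (composition_operator M g (cl \<phi>)) (composition_operator M g (cl \<psi>))"
    if "\<phi> \<in> \<L>" "\<psi> \<in> \<L>" for \<phi> \<psi>
    using that by (simp only: Lp_ops composition_cl[OF g] \<L>_add C(2) o(1))
  have scale: "composition_operator M g (vscale (Lp M p) a (cl \<phi>)) = vscale (Lp M p) a (composition_operator M g (cl \<phi>))"
    if "\<phi> \<in> \<L>" for \<phi> a
    using that by (simp only: Lp_ops composition_cl[OF g] \<L>_scale C(2) o(2))
  have bd: "vnorm (Lp M p) (composition_operator M g (cl \<phi>)) \<le> C * vnorm (Lp M p) (cl \<phi>)"
    if "\<phi> \<in> \<L>" for \<phi>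
    using that by (simp only: Lp_ops composition_cl[OF g] C(2) C(3))
  have mem: "composition_operator M g (cl \<phi>) \<in> cl ` \<L>" if "\<phi> \<in> \<L>" for \<phi>
    using that by (simp only: composition_cl[OF g] C(2) imageI)
  show ?thesis
    unfolding bounded_operator_def carr_eq using add scale bd mem by blast
qed

section \<open>Subspaces of functions supported on a measurable set\<close>

definition supported_on :: "'a set \<Rightarrow> ('a \<Rightarrow> complex) set set" where
  "supported_on Y = cl ` {\<phi> \<in> \<L>. \<forall>x\<in>space M - Y. \<phi> x = 0}"

lemma \<L>_indicator:
  assumes \<phi>: "\<phi> \<in> \<L>" and [measurable]: "Y \<in> sets M"
  shows "(\<lambda>x. indicator Y x * \<phi> x) \<in> \<L>"
proof -
  note [measurable] = \<L>_measurable[OF \<phi>]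
  have "nn (\<lambda>x. indicator Y x * \<phi> x) \<le> nn \<phi>"
    unfolding nn_def using p by (intro nn_integral_mono ennreal_leI) (auto simp: indicator_def)
  then show ?thesis unfolding nn_eq[OF \<phi>] by (intro nn_leD(1)[OF _ _ nrm_nonneg]) auto
qed

text \<open>Cutting the limit \<open>\<psi>\<close> off to \<open>Y\<close> changes it, in norm, by
  no more than its distance from any \<open>\<phi> n\<close>: off \<open>Y\<close>, where the change
  is \<open>\<psi>\<close> itself, \<open>\<phi> n\<close> vanishes. So the limit equals its
  truncation.\<close>

lemma closed_subspace_supported_on:
  assumes Y[measurable]: "Y \<in> sets M"
  shows "closed_subspace (Lp M p) (supported_on Y)"
proof -
  have sub: "supported_on Y \<subseteq> carr (Lp M p)" by (auto simp: supported_on_def carr_eq)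
  have "closed (J ` supported_on Y)"
    unfolding closed_sequential_limits
  proof (intro allI impI)
    fix v l assume "(\<forall>n. v n \<in> J ` supported_on Y) \<and> v \<longlonglongrightarrow> l"
    then have v: "\<And>n. v n \<in> J ` supported_on Y" and lim: "v \<longlonglongrightarrow> l" by auto
    have "\<exists>\<phi>. \<phi> \<in> \<L> \<and> (\<forall>x\<in>space M - Y. \<phi> x = 0) \<and> v n = J (cl \<phi>)" for n
      using v[of n] by (auto simp: supported_on_def)
    then obtain \<phi> where \<phi>: "\<And>n. \<phi> n \<in> \<L>" "\<And>n x. x \<in> space M - Y \<Longrightarrow> \<phi> n x = 0" "\<And>n. v n = J (cl (\<phi> n))"
      by metis
    have "l \<in> V" using closed_sequentially[OF closed_range _ lim] \<phi> cl_mem by blast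
    then obtain \<psi> where \<psi>: "\<psi> \<in> \<L>" "l = J (cl \<psi>)" unfolding carr_eq by blast
    let ?\<psi> = "\<lambda>x. indicator Y x * \<psi> x"
    have \<psi>': "?\<psi> \<in> \<L>" by (rule \<L>_indicator[OF \<psi>(1) Y])
    have le: "norm (l - J (cl ?\<psi>)) \<le> norm (l - v n)" for n
    proof -
      note [measurable] = \<L>_measurable[OF \<psi>(1)] \<L>_measurable[OF \<phi>(1)]
      have "nn (\<lambda>x. \<psi> x - ?\<psi> x) \<le> nn (\<lambda>x. \<psi> x - \<phi> n x)"
        unfolding nn_def using p \<phi>(2)[of _ n]
        by (intro nn_integral_mono ennreal_leI powr_mono2) (auto simp: indicator_def)
      then have "nrm (\<lambda>x. \<psi> x - ?\<psi> x) \<le> nrm (\<lambda>x. \<psi> x - \<phi> n x)"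
        unfolding nn_eq[OF \<L>_diff[OF \<psi>(1) \<phi>(1)]] by (intro nn_leD(2)[OF _ _ nrm_nonneg]) auto
      then show ?thesis by (simp add: J_diff_cl \<psi> \<psi>' \<phi> \<L>_diff flip: J_norm)
    qed
    have "(\<lambda>n. norm (l - v n)) \<longlonglongrightarrow> norm (l - l)" using lim by (intro tendsto_intros)
    then have "norm (l - J (cl ?\<psi>)) \<le> 0" using le by (intro LIMSEQ_le_const) auto
    then have "l = J (cl ?\<psi>)" by simp
    moreover have "cl ?\<psi> \<in> supported_on Y" unfolding supported_on_def
      using \<psi>' by (intro imageI) (auto simp: indicator_def)
    ultimately show "l \<in> J ` supported_on Y" by blast
  qed
  then have "closedin (norm_topology (Lp M p)) (supported_on Y)" using closedin_iff[OF sub] by simp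
  moreover have "vzero (Lp M p) \<in> supported_on Y"
    unfolding Lp_ops supported_on_def using \<L>_zero by auto
  moreover have "vadd (Lp M p) \<Phi> \<Psi> \<in> supported_on Y" if "\<Phi> \<in> supported_on Y" "\<Psi> \<in> supported_on Y" for \<Phi> \<Psi>
  proof -
    obtain \<phi> \<psi> where "\<phi> \<in> \<L>" "\<psi> \<in> \<L>" "\<Phi> = cl \<phi>" "\<Psi> = cl \<psi>"
      "\<forall>x\<in>space M - Y. \<phi> x = 0" "\<forall>x\<in>space M - Y. \<psi> x = 0"
      using \<open>\<Phi> \<in> _\<close> \<open>\<Psi> \<in> _\<close> by (auto simp: supported_on_def)
    then show ?thesis unfolding supported_on_def
      by (auto simp: Lp_ops intro!: imageI \<L>_add)
  qed
  moreover have "vscale (Lp M p) a \<Phi> \<in> supported_on Y" if "\<Phi> \<in> supported_on Y" for a \<Phi>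
  proof -
    obtain \<phi> where "\<phi> \<in> \<L>" "\<Phi> = cl \<phi>" "\<forall>x\<in>space M - Y. \<phi> x = 0"
      using \<open>\<Phi> \<in> _\<close> by (auto simp: supported_on_def)
    then show ?thesis unfolding supported_on_def
      by (auto simp: Lp_ops intro!: imageI \<L>_scale)
  qed
  ultimately show ?thesis using sub by (auto simp: closed_subspace_def)
qed

lemma direct_sum_supported_on:
  assumes Y[measurable]: "Y \<in> sets M"
  shows "direct_sum (Lp M p) (supported_on Y) (supported_on (space M - Y))"
  unfolding direct_sum_def
proof
  have 0: "vzero (Lp M p) \<in> supported_on Z" for Z
    unfolding Lp_ops supported_on_def using \<L>_zero by auto
  have "\<Phi> = vzero (Lp M p)" if \<Phi>: "\<Phi> \<in> supported_on Y" "\<Phi> \<in> supported_on (space M - Y)" for \<Phi>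
  proof -
    obtain \<phi> \<psi> where *: "\<phi> \<in> \<L>" "\<psi> \<in> \<L>" "\<Phi> = cl \<phi>" "cl \<phi> = cl \<psi>"
      "\<forall>x\<in>space M - Y. \<phi> x = 0" "\<forall>x\<in>space M - (space M - Y). \<psi> x = 0"
      using \<Phi> unfolding supported_on_def by fastforce
    have "AE x in M. \<phi> x = \<psi> x" using *(1,2,4) by (simp add: ae_class_eq_iff \<L>_measurable)
    then have "AE x in M. \<phi> x = 0"
      using AE_space by eventually_elim (use *(5,6) in auto)
    then show ?thesis using *(1,3) by (simp add: Lp_ops ae_class_eq_iff \<L>_measurable)
  qed
  then show "supported_on Y \<inter> supported_on (space M - Y) = {vzero (Lp M p)}" using 0 by blast
  show "carr (Lp M p) = {vadd (Lp M p) a b |a b. a \<in> supported_on Y \<and> b \<in> supported_on (space M - Y)}"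
  proof (intro equalityI subsetI)
    fix \<Phi> assume "\<Phi> \<in> carr (Lp M p)"
    then obtain \<phi> where \<phi>: "\<phi> \<in> \<L>" "\<Phi> = cl \<phi>" by (rule carrE)
    let ?a = "\<lambda>x. indicator Y x * \<phi> x" and ?b = "\<lambda>x. indicator (space M - Y) x * \<phi> x"
    have ab: "?a \<in> \<L>" "?b \<in> \<L>" using \<phi> by (auto intro!: \<L>_indicator)
    then have "cl ?a \<in> supported_on Y" "cl ?b \<in> supported_on (space M - Y)"
      unfolding supported_on_def by (auto intro!: imageI simp: indicator_def)
    moreover have "vadd (Lp M p) (cl ?a) (cl ?b) = \<Phi>"
      unfolding Lp_ops(2)[OF ab] \<phi>(2)
      by (rule cl_cong) (use ab in \<open>auto simp: indicator_def intro!: \<L>_measurable \<L>_add\<close>)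
    ultimately show "\<Phi> \<in> {vadd (Lp M p) a b |a b. a \<in> supported_on Y \<and> b \<in> supported_on (space M - Y)}"
      by blast
  next
    fix \<Phi> assume "\<Phi> \<in> {vadd (Lp M p) a b |a b. a \<in> supported_on Y \<and> b \<in> supported_on (space M - Y)}"
    then show "\<Phi> \<in> carr (Lp M p)" by (auto simp: supported_on_def Lp_ops intro!: cl_mem \<L>_add)
  qed
qed

end

section \<open>A scalar dichotomy\<close>

lemma int_partial_sums: "\<exists>s :: int \<Rightarrow> real. \<forall>n. s (n + 1) = s n + v n"
proof -
  define s where "s n = (\<Sum>k<nat n. v (int k)) - (\<Sum>k<nat (- n). v (- int k - 1))" for n
  have "s (n + 1) = s n + v n" for n
  proof (cases "0 \<le> n")
    case True
    then have "nat (n + 1) = Suc (nat n)" "nat (- n) = 0" "nat (- (n + 1)) = 0" by auto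
    then show ?thesis using True by (simp add: s_def)
  next
    case False
    then have *: "nat (n + 1) = 0" "nat n = 0" "nat (- n) = Suc (nat (- (n + 1)))" by auto
    have "- int (nat (- (n + 1))) - 1 = n" using False by simp
    then show ?thesis unfolding s_def * by simp
  qed
  then show ?thesis by blast
qed

text \<open>A solution dominated by its own increments grows geometrically away from its sign change.\<close>

lemma scalar_dichotomy:
  fixes e u :: "int \<Rightarrow> real"
  assumes e: "\<And>n. e (n + 1) = e n + \<delta> * u (n + 1)" and \<delta>: "0 < \<delta>"
    and u: "\<And>n. 0 < u n" "\<And>n. u n \<le> C * u (n + 1)" and K: "0 < K" "\<And>n. \<bar>e n\<bar> \<le> K * u n"
  obtains B \<theta> where "0 < B" "0 < \<theta>" "\<theta> < 1"
    "\<And>n k. 0 < e n \<Longrightarrow> u n \<le> B * \<theta> ^ k * u (n + int k)"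
    "\<And>n k. e n \<le> 0 \<Longrightarrow> u n \<le> B * \<theta> ^ k * u (n - int k)"
proof -
  \<comment> \<open>Backwards, \<open>K * u n\<close> bounds \<open>- e n\<close>, which gives this
    factor directly. Forwards the estimate gives \<open>(K - \<delta>) / K\<close>, which is smaller
    because \<open>(K + \<delta>) * (K - \<delta>) \<le> K * K\<close>.\<close>
  define \<theta> where "\<theta> = K / (K + \<delta>)"
  have \<theta>: "0 < \<theta>" "\<theta> < 1" using K \<delta> by (auto simp: \<theta>_def)
  have C: "0 < C" using u(1)[of 0] u(1)[of 1] u(2)[of 0]
    by (metis add_0 less_le_trans not_less zero_less_mult_pos2)
  have pos_mono: "0 < e (n + int k)" if "0 < e n" for n k
  proof (induction k)
    case (Suc k)
    have "e (n + int (Suc k)) = e (n + int k) + \<delta> * u (n + int k + 1)"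
      using e[of "n + int k"] by (simp add: algebra_simps)
    then show ?case using Suc \<delta> u(1)[of "n + int k + 1"] mult_pos_pos[of \<delta> "u (n + int k + 1)"] by linarith
  qed (use that in simp)
  have up: "e n \<le> \<theta> * e (n + 1)" if "0 < e n" for n
  proof -
    have "0 < e (n + 1)" using pos_mono[OF that, of 1] by simp
    then have "e (n + 1) \<le> K * u (n + 1)" using K(2)[of "n + 1"] by simp
    then have "\<delta> * e (n + 1) \<le> K * (\<delta> * u (n + 1))" using \<delta> by (simp add: mult.left_commute)
    also have "\<dots> = K * (e (n + 1) - e n)" by (simp add: e)
    finally have "K * e n \<le> (K - \<delta>) * e (n + 1)" by (simp add: algebra_simps)
    then have "(K + \<delta>) * (K * e n) \<le> (K + \<delta>) * ((K - \<delta>) * e (n + 1))"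
      using K \<delta> by (intro mult_left_mono) auto
    also have "\<dots> \<le> K * (K * e (n + 1))"
      using mult_pos_pos[OF \<delta> mult_pos_pos[OF \<delta> \<open>0 < e (n + 1)\<close>]] by (simp add: algebra_simps)
    finally have "K * ((K + \<delta>) * e n) \<le> K * (K * e (n + 1))" by (simp add: mult.left_commute)
    then have "(K + \<delta>) * e n \<le> K * e (n + 1)" using K by simp
    then show ?thesis using K \<delta> by (simp add: \<theta>_def field_simps)
  qed
  have ups: "e n \<le> \<theta> ^ k * e (n + int k)" if "0 < e n" for n k
  proof (induction k)
    case (Suc k)
    have "\<theta> ^ k * e (n + int k) \<le> \<theta> ^ k * (\<theta> * e (n + int k + 1))"
      using \<theta> by (intro mult_left_mono up pos_mono that) auto
    then show ?case using Suc by (simp add: algebra_simps)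
  qed simp
  have neg_mono: "e (n - int k) \<le> 0" if "e n \<le> 0" for n k
  proof (induction k)
    case (Suc k)
    have "e (n - int k) = e (n - int (Suc k)) + \<delta> * u (n - int k)"
      using e[of "n - int (Suc k)"] by simp
    then show ?case using Suc \<delta> u(1)[of "n - int k"] mult_pos_pos[of \<delta> "u (n - int k)"] by linarith
  qed (use that in simp)
  have down: "- e n \<le> \<theta> * (- e (n - 1))" if "e n \<le> 0" for n
  proof -
    have "- e n \<le> K * u n" using K(2)[of n] by simp
    then have "\<delta> * (- e n) \<le> K * (\<delta> * u n)" using mult_left_mono[of "- e n" "K * u n" \<delta>] \<delta> by (simp add: mult.left_commute)
    also have "\<dots> = K * (e n - e (n - 1))" using e[of "n - 1"] by simp
    finally have "(K + \<delta>) * (- e n) \<le> K * (- e (n - 1))" by (simp add: algebra_simps)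
    then show ?thesis using K \<delta> by (simp add: \<theta>_def field_simps)
  qed
  have downs: "- e n \<le> \<theta> ^ k * (- e (n - int k))" if "e n \<le> 0" for n k
  proof (induction k)
    case (Suc k)
    have "\<theta> ^ k * (- e (n - int k)) \<le> \<theta> ^ k * (\<theta> * (- e (n - int k - 1)))"
      using \<theta> by (intro mult_left_mono down neg_mono that) auto
    then show ?case using Suc by (simp add: algebra_simps)
  qed simp
  \<comment> \<open>The 1 covers \<open>k = 0\<close>. Otherwise one of the \<open>k\<close> steps
    is spent on comparing \<open>u n\<close> with an increment of \<open>e\<close>, which costs
    \<open>1 / \<theta>\<close>; forwards that increment belongs to \<open>u (n + 1)\<close>, which
    costs \<open>C\<close> as well.\<close>
  define B where "B = 1 + C * K / (\<delta> * \<theta>) + K / (\<delta> * \<theta>)"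
  have B: "1 \<le> B" "C * K / (\<delta> * \<theta>) \<le> B" "K / (\<delta> * \<theta>) \<le> B" "0 < B"
    using C K \<delta> \<theta> by (auto simp: B_def add_pos_nonneg intro!: add_nonneg_nonneg)
  have grow: "u n \<le> B * \<theta> ^ k * u (n + int k)" if n: "0 < e n" for n k
  proof (cases k)
    case 0
    then show ?thesis using B(1) u(1)[of n] by simp
  next
    case (Suc j)
    have "\<delta> * u n \<le> \<delta> * (C * u (n + 1))" using \<delta> u by (intro mult_left_mono) auto
    also have "\<dots> = C * (e (n + 1) - e n)" by (simp add: e mult.left_commute)
    also have "\<dots> \<le> C * e (n + 1)" using C n by (intro mult_left_mono) auto
    also have "\<dots> \<le> C * (\<theta> ^ j * e (n + 1 + int j))"
      using C ups[of "n + 1" j] pos_mono[OF n, of 1] by (intro mult_left_mono) auto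
    also have "\<dots> \<le> C * (\<theta> ^ j * (K * u (n + 1 + int j)))"
      using C \<theta> K(2)[of "n + 1 + int j"] by (intro mult_left_mono) auto
    finally have "u n \<le> C * K / (\<delta> * \<theta>) * \<theta> ^ k * u (n + int k)"
      using \<delta> \<theta> Suc by (simp add: field_simps)
    also have "\<dots> \<le> B * \<theta> ^ k * u (n + int k)"
      using B \<theta> u(1)[of "n + int k"] by (intro mult_right_mono) auto
    finally show ?thesis .
  qed
  have shrink: "u n \<le> B * \<theta> ^ k * u (n - int k)" if n: "e n \<le> 0" for n k
  proof (cases k)
    case 0
    then show ?thesis using B(1) u(1)[of n] by simp
  next
    case (Suc j)
    have "\<delta> * u n = e n - e (n - 1)" using e[of "n - 1"] by simp
    also have "\<dots> \<le> - e (n - 1)" using n by simp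
    also have "\<dots> \<le> \<theta> ^ j * (- e (n - 1 - int j))"
      using neg_mono[OF n, of 1] by (intro downs) simp
    also have "\<dots> \<le> \<theta> ^ j * (K * u (n - 1 - int j))"
      using \<theta> K(2)[of "n - 1 - int j"] by (intro mult_left_mono) auto
    finally have "u n \<le> K / (\<delta> * \<theta>) * \<theta> ^ k * u (n - int k)"
      using \<delta> \<theta> Suc by (simp add: field_simps)
    also have "\<dots> \<le> B * \<theta> ^ k * u (n - int k)"
      using B \<theta> u(1)[of "n - int k"] by (intro mult_right_mono) auto
    finally show ?thesis .
  qed
  show ?thesis by (rule that[OF B(4) \<theta> grow shrink])
qed

section \<open>Dissipative systems of bounded distortion\<close>

locale dissipative_Lp = dyn: dissipative_bounded_distortion M f W + Lp_space M p
  for M :: "'a measure" and f W p +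
  assumes invertible: "invertible_composition M f"
begin

abbreviation "F \<equiv> int_iter (space M) f"
abbreviation "T \<equiv> composition_operator M f"
abbreviation "f' \<equiv> inv_into (space M) f"

lemmas F_mem = int_iter_mem[OF dyn.bij] and F_add = int_iter_add[OF dyn.bij]
  and F_cancel = int_iter_cancel[OF dyn.bij]

lemma f'_vimage: "B \<in> sets M \<Longrightarrow> f' -` B \<inter> space M = f ` B"
proof -
  assume B: "B \<in> sets M"
  have "x = f (f' x)" "f' x \<in> space M" if "x \<in> space M" for x
    using self_bij_right_inv[OF dyn.bij that] self_bij_inv_mem[OF dyn.bij that] by auto
  then show ?thesis
    using sets.sets_into_space[OF B] self_bij_left_inv[OF dyn.bij] self_bij_mem[OF dyn.bij] by (auto simp: subset_iff)
qed

lemma f'_measurable: "f' \<in> measurable M M"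
  unfolding measurable_def
  using self_bij_inv_mem[OF dyn.bij] f'_vimage dyn.meas_image by auto

lemma compressing_f: "compressing f" "compressing f'"
proof -
  show "compressing f" unfolding compressing_def
    using dyn.vimage_bound dyn.meas less_imp_le by blast
  obtain c :: real where "c > 0" "\<And>B. B \<in> sets M \<Longrightarrow> emeasure M (f ` B) \<le> ennreal c * emeasure M B"
    using invertible by (auto simp: invertible_composition_def)
  then show "compressing f'" unfolding compressing_def
    using f'_measurable by (auto simp: f'_vimage intro!: exI[of _ c])
qed

lemma F_measurable: "F k \<in> measurable M M"
  unfolding int_iter_def
  using measurable_compose_n[OF dyn.meas] measurable_compose_n[OF f'_measurable] by auto

lemma F_vimage: "B \<subseteq> space M \<Longrightarrow> F k -` B \<inter> space M = F (- k) ` B"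
proof (intro equalityI subsetI)
  fix x assume "B \<subseteq> space M" "x \<in> F (- k) ` B"
  then show "x \<in> F k -` B \<inter> space M" using F_cancel(2) F_mem by auto
next
  fix x assume "x \<in> F k -` B \<inter> space M"
  then show "x \<in> F (- k) ` B" using F_cancel(1)[of x k] by (metis IntD1 IntD2 imageI vimageD)
qed

lemma F_image_sets: "B \<in> sets M \<Longrightarrow> F k ` B \<in> sets M"
  using F_vimage[of B "- k"] measurable_sets[OF F_measurable, of B "- k"] sets.sets_into_space by fastforce

lemma F_image_image: "B \<subseteq> space M \<Longrightarrow> F j ` (F k ` B) = F (j + k) ` B"
  unfolding image_image by (rule image_cong) (auto simp: F_add subset_iff)

lemma W_space: "W \<subseteq> space M" using sets.sets_into_space[OF dyn.W_sets] .

section \<open>Measures of the levels\<close>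

abbreviation "level k \<equiv> F k ` W"

lemma level_sets: "level k \<in> sets M" by (rule F_image_sets[OF dyn.W_sets])

lemma level_bound:
  obtains c :: real where "0 < c" "\<And>k. emeasure M (level (k + 1)) \<le> ennreal c * emeasure M (level k)"
    "\<And>k. emeasure M (level (k - 1)) \<le> ennreal c * emeasure M (level k)"
proof -
  obtain a where a: "0 \<le> a" "\<And>B. B \<in> sets M \<Longrightarrow> emeasure M (f -` B \<inter> space M) \<le> ennreal a * emeasure M B"
    using compressing_f(1) by (auto simp: compressing_def)
  obtain b where b: "0 \<le> b" "\<And>B. B \<in> sets M \<Longrightarrow> emeasure M (f' -` B \<inter> space M) \<le> ennreal b * emeasure M B"
    using compressing_f(2) by (auto simp: compressing_def)
  have F1: "F 1 = f" "F (- 1) = f'" by (auto simp: fun_eq_iff int_iter_1[OF dyn.bij] int_iter_minus_1[OF dyn.bij])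
  have le: "ennreal a * x \<le> ennreal (a + b + 1) * x" "ennreal b * x \<le> ennreal (a + b + 1) * x" for x
    using a b by (auto intro!: mult_right_mono ennreal_leI)
  show ?thesis
  \<comment> \<open>One positive constant that dominates the bounds for both directions.\<close>
  proof (rule that[of "a + b + 1"])
    show "0 < a + b + 1" using a b by simp
    fix k
    have space: "level k \<subseteq> space M" using sets.sets_into_space[OF level_sets] .
    have "level (k + 1) = F 1 ` level k" using F_image_image[OF W_space, of 1 k] by (simp add: add.commute)
    also have "\<dots> = f' -` level k \<inter> space M" using F_vimage[OF space, of "- 1"] F1 by simp
    finally show "emeasure M (level (k + 1)) \<le> ennreal (a + b + 1) * emeasure M (level k)"
      using b(2)[OF level_sets, of k] le order_trans by metis
    have "level (k - 1) = F (- 1) ` level k" using F_image_image[OF W_space, of "- 1" k] by simp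
    also have "\<dots> = f -` level k \<inter> space M" using F_vimage[OF space, of 1] F1 by simp
    finally show "emeasure M (level (k - 1)) \<le> ennreal (a + b + 1) * emeasure M (level k)"
      using a(2)[OF level_sets, of k] le order_trans by metis
  qed
qed

definition m :: "int \<Rightarrow> real" where "m k = measure M (level k)"

text \<open>Both properties spread from \<open>W\<close> by comparing neighbouring levels: a bound
  from the level nearer to \<open>W\<close> preserves finiteness, and a null level would force that
  neighbour to be null.\<close>

lemma level_emeasure: "emeasure M (level k) = ennreal (m k)" "0 < m k"
proof -
  obtain c :: real where c: "0 < c" "\<And>k. emeasure M (level (k + 1)) \<le> ennreal c * emeasure M (level k)"
    "\<And>k. emeasure M (level (k - 1)) \<le> ennreal c * emeasure M (level k)"
    using level_bound by blast
  have finite: "emeasure M (level k) < \<infinity>" for k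
  proof (induction k rule: int_induct[where k = 0])
    case base
    then show ?case using dyn.W_finite by simp
  next
    case (step1 i)
    then show ?case using c(2)[of i] by (simp add: ennreal_mult_less_top le_less_trans)
  next
    case (step2 i)
    then show ?case using c(3)[of i] by (simp add: ennreal_mult_less_top le_less_trans)
  qed
  have pos: "emeasure M (level k) \<noteq> 0" for k
  proof (induction k rule: int_induct[where k = 0])
    case base
    then show ?case using dyn.W_pos by simp
  next
    case (step1 i)
    then show ?case using c(3)[of "i + 1"] by auto
  next
    case (step2 i)
    then show ?case using c(2)[of "i - 1"] by auto
  qed
  show eq: "emeasure M (level k) = ennreal (m k)"
    unfolding m_def using finite[of k] by (intro emeasure_eq_ennreal_measure) auto
  show "0 < m k" using pos[of k] unfolding eq by (simp add: m_def zero_less_measure_iff)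
qed

lemma m_bound:
  obtains c where "0 < c" "\<And>k. m (k - 1) \<le> c * m k"
proof -
  obtain c :: real where c: "0 < c" "\<And>k. emeasure M (level (k + 1)) \<le> ennreal c * emeasure M (level k)"
    "\<And>k. emeasure M (level (k - 1)) \<le> ennreal c * emeasure M (level k)"
    using level_bound by blast
  show ?thesis
    using that[of c] c level_emeasure(2) by (simp add: level_emeasure(1) less_imp_le flip: ennreal_mult)
qed

lemma emeasure_level_subset:
  assumes "B \<in> sets M" "B \<subseteq> level k"
  shows "emeasure M B = ennreal (measure M B)"
proof -
  have "emeasure M B \<le> ennreal (m k)" using emeasure_mono[OF assms(2) level_sets] level_emeasure by simp
  then show ?thesis by (intro emeasure_eq_ennreal_measure) (auto simp: top_unique)
qed

text \<open>Distortion compares a level with \<open>W\<close> only. Pulling \<open>B\<close> back to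
  \<open>W\<close> and pushing it forward to level \<open>i + j\<close> uses it twice, and
  \<open>D\<close> is the product \<open>K * K\<close>.\<close>

lemma shift_bound:
  obtains D where "0 < D" "\<And>i j B. B \<in> sets M \<Longrightarrow> B \<subseteq> level j \<Longrightarrow>
    emeasure M (F i ` B) \<le> ennreal (D * m (i + j) / m j) * emeasure M B"
proof -
  obtain K :: real where K: "0 < K" "\<And>k B. B \<in> sets M \<Longrightarrow> B \<subseteq> W \<Longrightarrow>
      ennreal (1 / K) * emeasure M (level k) * emeasure M B \<le> emeasure M (F k ` B) * emeasure M W \<and>
      emeasure M (F k ` B) * emeasure M W \<le> ennreal K * emeasure M (level k) * emeasure M B"
    using dyn.distortion by blast
  have W0: "level 0 = W" by simp
  have real: "1 / K * m k * measure M B \<le> measure M (F k ` B) * m 0"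
    "measure M (F k ` B) * m 0 \<le> K * m k * measure M B"
    if B: "B \<in> sets M" "B \<subseteq> W" for k B
  proof -
    have e: "emeasure M B = ennreal (measure M B)" using emeasure_level_subset[of B 0] B W0 by simp
    have e': "emeasure M (F k ` B) = ennreal (measure M (F k ` B))"
      by (rule emeasure_level_subset[of _ k]) (use B F_image_sets in auto)
    have eW: "emeasure M W = ennreal (m 0)" using level_emeasure(1)[of 0] W0 by simp
    show "1 / K * m k * measure M B \<le> measure M (F k ` B) * m 0"
      "measure M (F k ` B) * m 0 \<le> K * m k * measure M B"
      using K(2)[OF B, of k] level_emeasure(2)[of k] level_emeasure(2)[of 0] K(1)
      unfolding e e' eW level_emeasure(1) by (simp_all add: less_imp_le flip: ennreal_mult)
  qed
  show ?thesis
  proof (rule that[of "K * K"])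
    show "0 < K * K" using K by simp
    fix i j B assume B: "B \<in> sets M" "B \<subseteq> level j"
    define B' where "B' = F (- j) ` B"
    have space: "B \<subseteq> space M" using sets.sets_into_space[OF B(1)] .
    have B': "B' \<in> sets M" "B' \<subseteq> W"
    proof -
      show "B' \<in> sets M" unfolding B'_def by (rule F_image_sets[OF B(1)])
      have "B' \<subseteq> F (- j) ` level j" unfolding B'_def using B(2) by blast
      then show "B' \<subseteq> W" using F_image_image[OF W_space, of "- j" j] by simp
    qed
    have FB: "F j ` B' = B" "F i ` B = F (i + j) ` B'"
      unfolding B'_def using F_image_image[OF space] by simp_all
    have FiB: "F i ` B \<in> sets M" "F i ` B \<subseteq> level (i + j)"
      using F_image_sets[OF B(1), of i] B'(2) by (blast, unfold FB(2), blast)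
    note pos = level_emeasure(2)[of 0] level_emeasure(2)[of j] level_emeasure(2)[of "i + j"]
    have 1: "measure M (F i ` B) * m 0 \<le> K * m (i + j) * measure M B'"
      using real(2)[OF B', of "i + j"] FB by simp
    have 2: "1 / K * m j * measure M B' \<le> measure M B * m 0"
      using real(1)[OF B', of j] FB by simp
    then have "measure M B' \<le> K * m 0 / m j * measure M B" using K pos by (simp add: field_simps)
    then have "K * m (i + j) * measure M B' \<le> K * m (i + j) * (K * m 0 / m j * measure M B)"
      using K pos by (intro mult_left_mono) auto
    with 1 have "measure M (F i ` B) * m 0 \<le> (K * K * m (i + j) / m j * measure M B) * m 0"
      by (simp add: algebra_simps)
    then have "measure M (F i ` B) \<le> K * K * m (i + j) / m j * measure M B"
      by (rule mult_right_le_imp_le[OF _ pos(1)])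
    then show "emeasure M (F i ` B) \<le> ennreal (K * K * m (i + j) / m j) * emeasure M B"
      unfolding emeasure_level_subset[OF B] emeasure_level_subset[OF FiB]
      using K pos by (subst ennreal_mult[symmetric]) (auto intro!: ennreal_leI)
  qed
qed

lemma level_unique: "x \<in> level i \<Longrightarrow> x \<in> level j \<Longrightarrow> i = j"
  using dyn.W_disjoint by (auto simp: disjoint_family_on_def)

lemma UN_levels: "B \<subseteq> space M \<Longrightarrow> (\<Union>j. B \<inter> level j) = B"
  by (subst Int_UN_distrib[symmetric]) (simp add: dyn.W_cover[symmetric] Int_absorb2)

lemma emeasure_levels:
  assumes B: "B \<in> sets M"
  shows "emeasure M B = (\<integral>\<^sup>+j. emeasure M (B \<inter> level j) \<partial>count_space UNIV)"
proof -
  have "emeasure M B = emeasure M (\<Union>j. B \<inter> level j)"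
    by (simp only: UN_levels[OF sets.sets_into_space[OF B]])
  also have "\<dots> = (\<integral>\<^sup>+j. emeasure M (B \<inter> level j) \<partial>count_space UNIV)"
  proof (rule emeasure_UN_countable)
    show "disjoint_family (\<lambda>j. B \<inter> level j)"
      unfolding disjoint_family_on_def
    proof (intro ballI impI)
      fix i j :: int assume "i \<noteq> j"
      then show "(B \<inter> level i) \<inter> (B \<inter> level j) = {}" using level_unique[of _ i j] by blast
    qed
  qed (use B level_sets in auto)
  finally show ?thesis .
qed

text \<open>The images of the pieces \<open>B \<inter> level j\<close> stay disjoint by injectivity
  of \<open>F i\<close>, so the bound may be checked piece by piece, and only on levels that
  \<open>B\<close> meets.\<close>

lemma emeasure_shift_le:
  assumes B: "B \<in> sets M"
    and le: "\<And>j. B \<inter> level j \<noteq> {} \<Longrightarrow> emeasure M (F i ` (B \<inter> level j)) \<le> c * emeasure M (B \<inter> level j)"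
  shows "emeasure M (F i ` B) \<le> c * emeasure M B"
proof -
  have BB: "B \<subseteq> space M" using sets.sets_into_space[OF B] .
  have "F i ` B = F i ` (\<Union>j. B \<inter> level j)" by (simp only: UN_levels[OF BB])
  then have "emeasure M (F i ` B) = emeasure M (\<Union>j. F i ` (B \<inter> level j))" by (simp only: image_UN)
  also have "\<dots> = (\<integral>\<^sup>+j. emeasure M (F i ` (B \<inter> level j)) \<partial>count_space UNIV)"
  proof (rule emeasure_UN_countable)
    have eq: "j = k" if "x \<in> B \<inter> level j" "y \<in> B \<inter> level k" "F i x = F i y" for x y j k
    proof -
      have "x = y" using that BB F_cancel(1) by (metis IntD1 subsetD)
      then show ?thesis using that level_unique by blast
    qed
    show "disjoint_family (\<lambda>j. F i ` (B \<inter> level j))"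
      unfolding disjoint_family_on_def
    proof (intro ballI impI equals0I)
      fix j k z assume *: "j \<noteq> k" "z \<in> F i ` (B \<inter> level j) \<inter> F i ` (B \<inter> level k)"
      obtain x where x: "z = F i x" "x \<in> B \<inter> level j" using IntD1[OF *(2)] by (rule imageE)
      obtain y where y: "z = F i y" "y \<in> B \<inter> level k" using IntD2[OF *(2)] by (rule imageE)
      show False using eq[OF x(2) y(2)] x(1) y(1) *(1) by simp
    qed
  qed (use B level_sets F_image_sets in auto)
  also have "\<dots> \<le> (\<integral>\<^sup>+j. c * emeasure M (B \<inter> level j) \<partial>count_space UNIV)"
  proof (rule nn_integral_mono)
    fix j
    show "emeasure M (F i ` (B \<inter> level j)) \<le> c * emeasure M (B \<inter> level j)"
      by (cases "B \<inter> level j = {}") (use le in auto)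
  qed
  also have "\<dots> = c * emeasure M B" unfolding emeasure_levels[OF B] by (rule nn_integral_cmult) simp
  finally show ?thesis .
qed

section \<open>The composition operator of a dissipative system\<close>

lemma comp_f_mem: "\<phi> \<in> \<L> \<Longrightarrow> \<phi> \<circ> f \<in> \<L>" "\<phi> \<in> \<L> \<Longrightarrow> \<phi> \<circ> f' \<in> \<L>"
  using compressing_comp[OF compressing_f(1)] compressing_comp[OF compressing_f(2)] by metis+

lemma T_cl: "\<phi> \<in> \<L> \<Longrightarrow> T (cl \<phi>) = cl (\<phi> \<circ> f)"
  by (rule composition_cl[OF compressing_f(1)])

lemma T_bij: "bij_betw T (carr (Lp M p)) (carr (Lp M p))"
  and inv_T_cl: "\<phi> \<in> \<L> \<Longrightarrow> inv_into (carr (Lp M p)) T (cl \<phi>) = cl (\<phi> \<circ> f')"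
proof -
  let ?T' = "composition_operator M f'"
  have T'_cl: "?T' (cl \<phi>) = cl (\<phi> \<circ> f')" if "\<phi> \<in> \<L>" for \<phi>
    using that by (rule composition_cl[OF compressing_f(2)])
  have 1: "?T' (T (cl \<phi>)) = cl \<phi>" "T (?T' (cl \<phi>)) = cl \<phi>" if \<phi>: "\<phi> \<in> \<L>" for \<phi>
  proof -
    have "cl (\<phi> \<circ> f \<circ> f') = cl \<phi>" "cl (\<phi> \<circ> f' \<circ> f) = cl \<phi>"
      by (rule cl_cong; use \<phi> comp_f_mem self_bij_right_inv[OF dyn.bij] self_bij_left_inv[OF dyn.bij] in \<open>auto intro: \<L>_measurable\<close>)+
    then show "?T' (T (cl \<phi>)) = cl \<phi>" "T (?T' (cl \<phi>)) = cl \<phi>"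
      using \<phi> comp_f_mem by (simp_all only: T_cl T'_cl)
  qed
  show bij: "bij_betw T (carr (Lp M p)) (carr (Lp M p))"
    by (rule bij_betwI[where g = ?T']) (use 1 comp_f_mem in \<open>auto simp: carr_eq T_cl T'_cl\<close>)
  show "inv_into (carr (Lp M p)) T (cl \<phi>) = cl (\<phi> \<circ> f')" if "\<phi> \<in> \<L>"
    using self_bij_left_inv[OF bij, of "?T' (cl \<phi>)"] 1[OF that] that by (simp add: T'_cl cl_mem comp_f_mem)
qed

lemma invertible_T: "invertible_operator (Lp M p) T"
proof -
  have "bounded_operator (Lp M p) (composition_operator M f')"
    by (rule composition_bounded[OF compressing_f(2)])
  moreover have "inv_into (carr (Lp M p)) T \<Phi> = composition_operator M f' \<Phi>" if "\<Phi> \<in> carr (Lp M p)" for \<Phi>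
    using that inv_T_cl composition_cl[OF compressing_f(2)] by (auto elim!: carrE)
  ultimately have "bounded_operator (Lp M p) (inv_into (carr (Lp M p)) T)"
    by (simp add: bounded_operator_def Pi_iff add_mem scale_mem)
  then show ?thesis unfolding invertible_operator_def
    using T_bij composition_bounded[OF compressing_f(1)] by blast
qed

lemma T_funpow: "\<phi> \<in> \<L> \<Longrightarrow> \<phi> \<circ> f ^^ n \<in> \<L> \<and> (T ^^ n) (cl \<phi>) = cl (\<phi> \<circ> f ^^ n)"
proof (induction n)
  case (Suc n)
  have "\<phi> \<circ> f ^^ Suc n = (\<phi> \<circ> f ^^ n) \<circ> f" by (simp only: funpow_Suc_right comp_assoc)
  moreover have "(T ^^ Suc n) (cl \<phi>) = T (cl (\<phi> \<circ> f ^^ n))" using Suc by (simp add: o_def)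
  moreover have "\<phi> \<circ> f ^^ n \<in> \<L>" using Suc by blast
  ultimately show ?case by (simp only: T_cl comp_f_mem(1))
qed simp

lemma inv_T_funpow:
  "\<phi> \<in> \<L> \<Longrightarrow> \<phi> \<circ> f' ^^ n \<in> \<L> \<and> (inv_into (carr (Lp M p)) T ^^ n) (cl \<phi>) = cl (\<phi> \<circ> f' ^^ n)"
proof (induction n)
  case (Suc n)
  have "\<phi> \<circ> f' ^^ Suc n = (\<phi> \<circ> f' ^^ n) \<circ> f'" by (simp only: funpow_Suc_right comp_assoc)
  moreover have "(inv_into (carr (Lp M p)) T ^^ Suc n) (cl \<phi>) = inv_into (carr (Lp M p)) T (cl (\<phi> \<circ> f' ^^ n))" using Suc by (simp add: o_def)
  moreover have "\<phi> \<circ> f' ^^ n \<in> \<L>" using Suc by blast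
  ultimately show ?case by (simp only: inv_T_cl comp_f_mem(2))
qed simp

lemma T_int_iter: "\<phi> \<in> \<L> \<Longrightarrow> \<phi> \<circ> F n \<in> \<L>" "\<phi> \<in> \<L> \<Longrightarrow> int_iter (carr (Lp M p)) T n (cl \<phi>) = cl (\<phi> \<circ> F n)"
  using T_funpow[of \<phi> "nat n"] inv_T_funpow[of \<phi> "nat (- n)"] by (auto simp: int_iter_def)

section \<open>Shadowing read on the weights\<close>

definition u :: "int \<Rightarrow> real" where "u n = 1 / m (- n) powr (1 / p)"

lemma u_pos: "0 < u n" using level_emeasure(2)[of "- n"] by (simp add: u_def)

lemma m_u: "m n = 1 / u (- n) powr p"
  using level_emeasure(2)[of n] p by (simp add: u_def powr_divide powr_powr)

lemma nrm_indicator_level: "(indicator W \<circ> F n) \<in> \<L>" "nrm (indicator W \<circ> F n) = 1 / u n"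
proof -
  have eq: "cmod (indicator W (F n x)) powr p = indicator (level (- n)) x" if "x \<in> space M" for x
    using F_vimage[OF W_space, of n] that by (auto simp: indicator_def)
  have I: "integrable M (indicator (level (- n)) :: 'a \<Rightarrow> real)"
    using level_sets[of "- n"] level_emeasure(1)[of "- n"] by (simp add: integrable_indicator_iff)
  have "integrable M (\<lambda>x. cmod (indicator W (F n x)) powr p)"
    by (subst Bochner_Integration.integrable_cong[where N = M and g = "indicator (level (- n))"])
      (use eq I in simp_all)
  moreover have "(indicator W \<circ> F n :: 'a \<Rightarrow> complex) \<in> borel_measurable M"
    using measurable_comp[OF F_measurable borel_measurable_indicator[OF dyn.W_sets]] .
  ultimately show "(indicator W \<circ> F n) \<in> \<L>" by (simp add: \<L>_def)
  have "(LINT x|M. cmod (indicator W (F n x)) powr p) = (LINT x|M. indicator (level (- n)) x)"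
    by (rule Bochner_Integration.integral_cong[OF refl eq])
  also have "\<dots> = m (- n)" using level_sets[of "- n"] sets.sets_into_space by (simp add: m_def Int_absorb2)
  finally show "nrm (indicator W \<circ> F n) = 1 / u n" by (simp add: nrm_def u_def)
qed

lemma shadowing_scalar_solution:
  assumes "shadowing_property (Lp M p) T"
  obtains e :: "int \<Rightarrow> real" and \<delta> K where "0 < \<delta>" "0 < K"
    "\<And>n. e (n + 1) = e n + \<delta> * u (n + 1)" "\<And>n. \<bar>e n\<bar> \<le> K * u n"
proof -
  let ?g = "indicator W :: 'a \<Rightarrow> complex"
  let ?E = "Lp M p"
  have g: "?g \<in> \<L>" using nrm_indicator_level(1)[of 0] by (simp add: o_def)
  note gn = T_int_iter(1)[OF g]
  \<comment> \<open>Shadowing is used for a single accuracy; the value 1 is as good as any.\<close>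
  have "\<exists>\<delta>>0. \<forall>x :: int \<Rightarrow> _. (\<forall>n. x n \<in> carr ?E) \<and> (\<forall>n. vnorm ?E (vdiff ?E (T (x n)) (x (n + 1))) \<le> \<delta>) \<longrightarrow>
     (\<exists>y\<in>carr ?E. \<forall>n. vnorm ?E (vdiff ?E (int_iter (carr ?E) T n y) (x n)) < 1)"
    by (rule mp[OF spec[OF assms[unfolded shadowing_property_def]] zero_less_one])
  then obtain \<delta> where \<delta>: "0 < \<delta>" and shadow: "\<forall>x :: int \<Rightarrow> _. (\<forall>n. x n \<in> carr ?E) \<and>
      (\<forall>n. vnorm ?E (vdiff ?E (T (x n)) (x (n + 1))) \<le> \<delta>) \<longrightarrow>
     (\<exists>y\<in>carr ?E. \<forall>n. vnorm ?E (vdiff ?E (int_iter (carr ?E) T n y) (x n)) < 1)"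
    by (elim exE conjE)
  obtain s where s: "\<And>n. s (n + 1) = s n + \<delta> * u (n + 1)"
    using int_partial_sums[of "\<lambda>n. \<delta> * u (n + 1)"] by blast
  define \<xi> where "\<xi> n = (\<lambda>x. complex_of_real (s n) * (?g \<circ> F n) x)" for n
  have \<xi>: "\<xi> n \<in> \<L>" for n unfolding \<xi>_def by (rule \<L>_scale[OF gn])
  have "vnorm ?E (vdiff ?E (T (cl (\<xi> n))) (cl (\<xi> (n + 1)))) \<le> \<delta>" for n
  proof -
    \<comment> \<open>The one-step error is a multiple of the next iterate of the indicator, with a
      factor normalised by \<open>u (n + 1)\<close> so that its norm is exactly
      \<open>\<delta>\<close>.\<close>
    have c: "cl (\<lambda>x. (\<xi> n \<circ> f) x - \<xi> (n + 1) x) = cl (\<lambda>x. complex_of_real (- \<delta> * u (n + 1)) * (?g \<circ> F (n + 1)) x)"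
    proof (rule cl_cong)
      show "(\<lambda>x. (\<xi> n \<circ> f) x - \<xi> (n + 1) x) \<in> borel_measurable M"
        using \<L>_diff[OF comp_f_mem(1)[OF \<xi>] \<xi>] by (rule \<L>_measurable)
      fix x assume "x \<in> space M"
      then have F: "F (n + 1) x = F n (f x)" by (rule int_iter_add_1'[OF dyn.bij])
      show "(\<xi> n \<circ> f) x - \<xi> (n + 1) x = complex_of_real (- \<delta> * u (n + 1)) * (?g \<circ> F (n + 1)) x"
        unfolding \<xi>_def o_apply F s by (simp add: algebra_simps)
    qed
    have "vnorm ?E (vdiff ?E (T (cl (\<xi> n))) (cl (\<xi> (n + 1)))) =
        norm (cscale (complex_of_real (- \<delta> * u (n + 1))) (J (cl (?g \<circ> F (n + 1)))))"
      by (simp only: T_cl[OF \<xi>] vdiff_cl[OF comp_f_mem(1)[OF \<xi>] \<xi>] c vnorm_eq[OF cl_mem[OF \<L>_scale[OF gn]]] J_scale_cl[OF gn])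
    also have "\<dots> = \<delta> * u (n + 1) * nrm (?g \<circ> F (n + 1))"
      using \<delta> u_pos[of "n + 1"] by (simp add: J_norm[OF gn] norm_mult)
    also have "\<dots> = \<delta>" using u_pos[of "n + 1"] by (simp add: nrm_indicator_level)
    finally show ?thesis by simp
  qed
  then obtain Y where Y: "Y \<in> carr ?E" "\<And>n. vnorm ?E (vdiff ?E (int_iter (carr ?E) T n Y) (cl (\<xi> n))) < 1"
    using spec[OF shadow, of "\<lambda>n. cl (\<xi> n)"] cl_mem[OF \<xi>] by blast
  obtain y where y: "y \<in> \<L>" "Y = cl y" using Y(1) by (rule carrE)
  note [measurable] = \<L>_measurable[OF y(1)] dyn.W_sets
  have close: "nrm (\<lambda>x. (y \<circ> F n) x - \<xi> n x) < 1" for n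
    using Y(2)[of n] unfolding y(2) T_int_iter(2)[OF y(1)] vdiff_cl[OF T_int_iter(1)[OF y(1)] \<xi>]
      Lp_ops(4)[OF \<L>_diff[OF T_int_iter(1)[OF y(1)] \<xi>]] .
  obtain D where D: "0 < D" "\<And>i j B. B \<in> sets M \<Longrightarrow> B \<subseteq> level j \<Longrightarrow>
    emeasure M (F i ` B) \<le> ennreal (D * m (i + j) / m j) * emeasure M B"
    using shift_bound by blast
  \<comment> \<open>Transport from level \<open>-n\<close> to \<open>W\<close> costs at most
    \<open>D * m 0 / m (- n)\<close> in measure, and the \<open>p\<close>-th root of this is
    \<open>R * u n\<close>.\<close>
  define R where "R = (D * m 0) powr (1 / p)"
  have R: "0 < R" using D level_emeasure(2)[of 0] by (simp add: R_def)
  \<comment> \<open>The shadowing error at time \<open>n\<close>, restricted to level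
    \<open>-n\<close> and carried back to \<open>W\<close> by \<open>F (- n)\<close>. There
    \<open>y \<circ> F n\<close> becomes \<open>y\<close>, and the pseudo-orbit becomes the constant
    \<open>s n\<close>.\<close>
  define \<omega> where "\<omega> n = (\<lambda>x. ?g x * (y x - complex_of_real (s n)))" for n
  have \<omega>: "\<omega> n \<in> \<L>" "nrm (\<omega> n) \<le> R * u n" for n
  proof -
    let ?\<eta> = "\<lambda>x. indicator (level (- n)) x * ((y \<circ> F n) x - \<xi> n x)"
    have d: "(\<lambda>x. (y \<circ> F n) x - \<xi> n x) \<in> \<L>" by (intro \<L>_diff T_int_iter y \<xi>)
    have \<eta>: "?\<eta> \<in> \<L>" by (rule \<L>_indicator[OF d level_sets])
    have \<eta>_le: "nrm ?\<eta> \<le> 1"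
    proof -
      note [measurable] = \<L>_measurable[OF d] level_sets
      have "nn ?\<eta> \<le> nn (\<lambda>x. (y \<circ> F n) x - \<xi> n x)"
        unfolding nn_def using p by (intro nn_integral_mono ennreal_leI) (auto simp: indicator_def)
      also have "\<dots> \<le> ennreal (1 powr p)"
        unfolding nn_eq[OF d] using close[of n] p by (intro ennreal_leI powr_mono2) (auto simp: nrm_nonneg)
      finally show ?thesis by (rule nn_leD(2)[OF \<L>_measurable[OF \<eta>]]) simp
    qed
    have Rp: "(R * u n) powr p = D * m 0 / m (- n)"
      using D level_emeasure(2)[of 0] level_emeasure(2)[of "- n"] p
      by (simp add: R_def powr_mult powr_powr u_def powr_divide)
    have comp: "?\<eta> \<circ> F (- n) \<in> \<L>" "nrm (?\<eta> \<circ> F (- n)) \<le> R * u n * nrm ?\<eta>"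
    proof -
      have le: "emeasure M (F (- n) -` B \<inter> space M) \<le> ennreal ((R * u n) powr p) * emeasure M B"
        if "B \<in> sets M" "B \<subseteq> level (- n)" for B
        using D(2)[OF that, of n] F_vimage[of B "- n"] sets.sets_into_space[OF that(1)] by (simp add: Rp)
      have "0 \<le> R * u n" using R u_pos[of n] by simp
      note * = nn_comp_le[OF F_measurable level_sets \<eta> this le]
      show "?\<eta> \<circ> F (- n) \<in> \<L>" "nrm (?\<eta> \<circ> F (- n)) \<le> R * u n * nrm ?\<eta>"
        using * by (auto simp: indicator_def)
    qed
    have eq: "(?\<eta> \<circ> F (- n)) x = \<omega> n x" if x: "x \<in> space M" for x
    proof -
      have "F (- n) x \<in> level (- n) \<longleftrightarrow> x \<in> W"
      proof
        assume "F (- n) x \<in> level (- n)"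
        then obtain w where w: "w \<in> W" "F (- n) x = F (- n) w" by blast
        then have "x = w" using F_cancel(2)[of x n] F_cancel(2)[of w n] x W_space by (metis subsetD)
        then show "x \<in> W" using w by simp
      qed simp
      then show ?thesis using F_cancel(2)[OF x, of n] by (simp add: \<omega>_def \<xi>_def indicator_def)
    qed
    have [measurable]: "\<omega> n \<in> borel_measurable M" unfolding \<omega>_def by measurable
    have ae: "AE x in M. (?\<eta> \<circ> F (- n)) x = \<omega> n x" by (rule AE_I2[OF eq])
    note c = nrm_cong[OF \<L>_measurable[OF comp(1)] _ ae]
    show "\<omega> n \<in> \<L>" using c(3) comp(1) by (simp add: o_def)
    have "nrm (\<omega> n) \<le> R * u n * nrm ?\<eta>" using c(1) comp(2) by (simp add: o_def)
    also have "\<dots> \<le> R * u n * 1" using \<eta>_le R u_pos[of n] by (intro mult_left_mono) auto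
    finally show "nrm (\<omega> n) \<le> R * u n" by simp
  qed
  define N where "N = nrm ?g"
  have N: "0 < N" using nrm_indicator_level(2)[of 0] u_pos[of 0] by (simp add: N_def o_def)
  \<comment> \<open>On \<open>W\<close> the weight in \<open>Hoelder_powr\<close>, taken for the
    indicator of \<open>W\<close>, is this constant; the inequality thus bounds the integral of
    \<open>\<omega> n\<close> by its norm divided by \<open>q\<close>.\<close>
  define q where "q = (1 / N) powr (p - 1)"
  have q: "0 < q" using N by (simp add: q_def)
  have m0: "measure M W = m 0" by (simp add: m_def)
  have int_\<omega>: "integrable M (\<omega> n)" "cmod (LINT x|M. \<omega> n x) \<le> R * u n / q" for n
  proof -
    note [measurable] = \<L>_measurable[OF \<omega>(1)[of n]]
    note H = Hoelder_powr[OF g \<omega>(1)[of n] _ N, unfolded N_def, simplified]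
    have e: "cmod (\<omega> n x) * (cmod (?g x) / nrm ?g) powr (p - 1) = q * cmod (\<omega> n x)" for x
      by (auto simp: \<omega>_def indicator_def q_def N_def)
    have i: "integrable M (\<lambda>x. q * cmod (\<omega> n x))" using H(1) unfolding e .
    then have i': "integrable M (\<lambda>x. cmod (\<omega> n x))" using q by simp
    then show "integrable M (\<omega> n)" by (simp add: integrable_norm_iff)
    have "q * (LINT x|M. cmod (\<omega> n x)) \<le> nrm (\<omega> n)" using H(2) unfolding e by simp
    then have "q * (LINT x|M. cmod (\<omega> n x)) \<le> R * u n" using \<omega>(2)[of n] by simp
    then have "(LINT x|M. cmod (\<omega> n x)) \<le> R * u n / q" using q by (simp add: field_simps)
    then show "cmod (LINT x|M. \<omega> n x) \<le> R * u n / q" by (rule order_trans[OF integral_norm_bound])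
  qed
  have g_real: "?g = (\<lambda>x. complex_of_real (indicator W x))" by (auto simp: indicator_def)
  have ig: "integrable M ?g"
    unfolding g_real using dyn.W_finite by (intro integrable_of_real) (simp add: integrable_indicator_iff)
  have Ig: "(LINT x|M. ?g x) = complex_of_real (m 0)"
    unfolding g_real integral_complex_of_real using W_space by (simp add: m0 Int_absorb2)
  \<comment> \<open>Since \<open>\<omega> 0\<close> is \<open>y - s 0\<close> on \<open>W\<close>,
    this is the real part of the mean of \<open>y\<close> over \<open>W\<close>. The real part
    suffices because \<open>s\<close> is real.\<close>
  define c where "c = Re (LINT x|M. \<omega> 0 x) / m 0 + s 0"
  have int_eq: "(LINT x|M. \<omega> n x) = (LINT x|M. \<omega> 0 x) - complex_of_real ((s n - s 0) * m 0)" for n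
  proof -
    have "\<omega> n = (\<lambda>x. \<omega> 0 x - complex_of_real (s n - s 0) * ?g x)"
      by (auto simp: \<omega>_def algebra_simps)
    then have "(LINT x|M. \<omega> n x) = (LINT x|M. \<omega> 0 x) - (LINT x|M. complex_of_real (s n - s 0) * ?g x)"
      using int_\<omega>(1)[of 0] ig by (simp only: Bochner_Integration.integral_diff integrable_mult_right)
    also have "(LINT x|M. complex_of_real (s n - s 0) * ?g x) = complex_of_real ((s n - s 0) * m 0)"
      by (simp add: Ig)
    finally show ?thesis .
  qed
  have "\<bar>s n - c\<bar> \<le> R / (q * m 0) * u n" for n
  proof -
    have "Re (LINT x|M. \<omega> n x) = (c - s n) * m 0"
      unfolding int_eq[of n] using level_emeasure(2)[of 0] by (simp add: c_def field_simps)
    then have "\<bar>(c - s n) * m 0\<bar> \<le> R * u n / q"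
      using abs_Re_le_cmod[of "LINT x|M. \<omega> n x"] int_\<omega>(2)[of n] by simp
    then have "\<bar>s n - c\<bar> * m 0 \<le> R * u n / q"
      using level_emeasure(2)[of 0] by (simp add: abs_mult abs_minus_commute)
    then show ?thesis using level_emeasure(2)[of 0] q by (simp add: field_simps)
  qed
  then show ?thesis
    using that[of \<delta> "R / (q * m 0)" "\<lambda>n. s n - c"] \<delta> s R q level_emeasure(2)[of 0] by simp
qed

lemma shadowing_imp_summable_splitting:
  assumes "shadowing_property (Lp M p) T"
  shows "summable_splitting (Lp M p) T"
proof -
  obtain \<delta> K and e :: "int \<Rightarrow> real" where e: "0 < \<delta>" "0 < K"
    "\<And>n. e (n + 1) = e n + \<delta> * u (n + 1)" "\<And>n. \<bar>e n\<bar> \<le> K * u n"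
  proof (rule shadowing_scalar_solution[OF assms])
    fix e :: "int \<Rightarrow> real" and \<delta> K
    assume "0 < \<delta>" "0 < K" "\<And>n. e (n + 1) = e n + \<delta> * u (n + 1)" "\<And>n. \<bar>e n\<bar> \<le> K * u n"
    then show thesis by (rule that)
  qed
  obtain c where c: "0 < c" "\<And>k. m (k - 1) \<le> c * m k" using m_bound by blast
  have u_step: "u n \<le> c powr (1 / p) * u (n + 1)" for n
  proof -
    have "m (- (n + 1)) \<le> c * m (- n)" using c(2)[of "- n"] by simp
    then have "m (- (n + 1)) powr (1 / p) \<le> (c * m (- n)) powr (1 / p)"
      using p level_emeasure(2)[of "- (n + 1)"] by (intro powr_mono2) auto
    then have "m (- (n + 1)) powr (1 / p) \<le> c powr (1 / p) * m (- n) powr (1 / p)" by (simp add: powr_mult)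
    then show ?thesis using level_emeasure(2)[of "- (n + 1)"] level_emeasure(2)[of "- n"]
      by (simp add: u_def field_simps)
  qed
  obtain B \<theta> where B: "0 < B" "0 < \<theta>" "\<theta> < 1"
    "\<And>n k. 0 < e n \<Longrightarrow> u n \<le> B * \<theta> ^ k * u (n + int k)"
    "\<And>n k. e n \<le> 0 \<Longrightarrow> u n \<le> B * \<theta> ^ k * u (n - int k)"
    using scalar_dichotomy[where e = e and u = u and \<delta> = \<delta> and K = K and C = "c powr (1 / p)", OF e(3) e(1) u_pos u_step e(2) e(4)] by blast
  obtain D where D: "0 < D" "\<And>i j B. B \<in> sets M \<Longrightarrow> B \<subseteq> level j \<Longrightarrow>
    emeasure M (F i ` B) \<le> ennreal (D * m (i + j) / m j) * emeasure M B"
    using shift_bound by blast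
  \<comment> \<open>The \<open>p\<close>-th root of the distortion constant times the geometric rate
    of the dichotomy.\<close>
  define a where "a k = D powr (1 / p) * (B * \<theta> ^ k)" for k
  have a: "summable a" "0 \<le> a k" "a k powr p = D * (B * \<theta> ^ k) powr p" for k
  proof -
    show "summable a" unfolding a_def using B by (intro summable_mult summable_geometric) auto
    show "0 \<le> a k" using B by (simp add: a_def)
    show "a k powr p = D * (B * \<theta> ^ k) powr p" using D(1) p by (simp add: a_def powr_mult powr_powr)
  qed
  \<comment> \<open>The measure ratio between two levels is the \<open>p\<close>-th power of a ratio
    of values of \<open>u\<close>, so growth of \<open>u\<close> becomes decay of measures under
    shifts.\<close>
  have ratio: "D * m (i + j) / m j \<le> a k powr p" if "u (- j) \<le> B * \<theta> ^ k * u (- (i + j))" for i j k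
  proof -
    have "u (- j) / u (- (i + j)) \<le> B * \<theta> ^ k" using that u_pos[of "- (i + j)"] by (simp add: field_simps)
    then have "(u (- j) / u (- (i + j))) powr p \<le> (B * \<theta> ^ k) powr p"
      using p u_pos[of "- j"] u_pos[of "- (i + j)"] by (intro powr_mono2) (auto simp: less_imp_le)
    moreover have "m (i + j) / m j = (u (- j) / u (- (i + j))) powr p"
      using u_pos[of "- j"] u_pos[of "- (i + j)"] by (simp add: m_u powr_divide)
    ultimately have "D * (m (i + j) / m j) \<le> D * (B * \<theta> ^ k) powr p"
      using D(1) by (intro mult_left_mono) auto
    then show ?thesis by (simp add: a)
  qed
  \<comment> \<open>Composition with \<open>f\<close> moves a function from level \<open>j\<close>
    to level \<open>j - 1\<close>, so the index \<open>- j\<close> increases with time.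
    \<open>Y\<close> collects the levels from which \<open>u\<close> grows forwards.\<close>
  define Y where "Y = (\<Union>j\<in>{j. 0 < e (- j)}. level j)"
  have Y: "Y \<in> sets M" unfolding Y_def using level_sets by (intro sets.countable_UN'') auto
  have Y_level: "0 < e (- j)" if "x \<in> Y" "x \<in> level j" for x j
    using that level_unique unfolding Y_def by blast
  have Yc_level: "e (- j) \<le> 0" if "x \<in> space M - Y" "x \<in> level j" for x j
    using that unfolding Y_def by (meson DiffD2 UN_I mem_Collect_eq not_le)
  have bound: "emeasure M (F (- i) -` S \<inter> space M) \<le> ennreal (a k powr p) * emeasure M S"
    if S: "S \<in> sets M" "\<And>j. S \<inter> level j \<noteq> {} \<Longrightarrow> u (- j) \<le> B * \<theta> ^ k * u (- (i + j))" for S i k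
  proof -
    have "emeasure M (F i ` S) \<le> ennreal (a k powr p) * emeasure M S"
    proof (rule emeasure_shift_le[OF S(1)])
      fix j assume j: "S \<inter> level j \<noteq> {}"
      have "emeasure M (F i ` (S \<inter> level j)) \<le> ennreal (D * m (i + j) / m j) * emeasure M (S \<inter> level j)"
        using S(1) level_sets by (intro D) auto
      also have "\<dots> \<le> ennreal (a k powr p) * emeasure M (S \<inter> level j)"
        by (intro mult_right_mono ennreal_leI ratio S(2) j) auto
      finally show "emeasure M (F i ` (S \<inter> level j)) \<le> ennreal (a k powr p) * emeasure M (S \<inter> level j)" .
    qed
    then show ?thesis using F_vimage[of S "- i"] sets.sets_into_space[OF S(1)] by simp
  qed
  \<comment> \<open>Positivity of \<open>e\<close> persists as its index increases. Consequently
    \<open>f\<close> maps the complement of \<open>Y\<close> into itself, which is what invariance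
    of functions vanishing there requires.\<close>
  have Ydown: "f' x \<in> Y" if "x \<in> Y" for x
  proof -
    obtain j w where j: "0 < e (- j)" "w \<in> W" "x = F j w" using \<open>x \<in> Y\<close> by (auto simp: Y_def)
    have "f' x = F (j - 1) w" using j(2,3) W_space int_iter_diff_1[OF dyn.bij, of w j] by auto
    moreover have "0 < e (- (j - 1))"
      using j(1) e(3)[of "- j"] mult_pos_pos[OF e(1) u_pos[of "- j + 1"]] by simp
    ultimately show ?thesis using j(2) unfolding Y_def by blast
  qed
  let ?E = "Lp M p" and ?T' = "inv_into (carr (Lp M p)) T"
  have "T ` supported_on Y \<subseteq> supported_on Y"
  proof
    fix \<Psi> assume "\<Psi> \<in> T ` supported_on Y"
    then obtain \<phi> where \<phi>: "\<phi> \<in> \<L>" "\<forall>x\<in>space M - Y. \<phi> x = 0" "\<Psi> = T (cl \<phi>)" by (auto simp: supported_on_def)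
    have "(\<phi> \<circ> f) x = 0" if x: "x \<in> space M - Y" for x
    proof -
      have "f x \<notin> Y" using Ydown[of "f x"] x self_bij_left_inv[OF dyn.bij, of x] by auto
      then show ?thesis using \<phi>(2) x self_bij_mem[OF dyn.bij, of x] by simp
    qed
    then show "\<Psi> \<in> supported_on Y" unfolding supported_on_def \<phi>(3) T_cl[OF \<phi>(1)]
      using comp_f_mem(1)[OF \<phi>(1)] by (intro imageI) (simp add: o_def)
  qed
  moreover have "?T' ` supported_on (space M - Y) \<subseteq> supported_on (space M - Y)"
  proof
    fix \<Psi> assume "\<Psi> \<in> ?T' ` supported_on (space M - Y)"
    then obtain \<phi> where \<phi>: "\<phi> \<in> \<L>" "\<forall>x\<in>space M - (space M - Y). \<phi> x = 0" "\<Psi> = ?T' (cl \<phi>)"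
      by (auto simp: supported_on_def)
    have "(\<phi> \<circ> f') x = 0" if x: "x \<in> space M - (space M - Y)" for x
      using \<phi>(2) x Ydown[of x] self_bij_inv_mem[OF dyn.bij, of x] by simp
    then show "\<Psi> \<in> supported_on (space M - Y)" unfolding supported_on_def \<phi>(3) inv_T_cl[OF \<phi>(1)]
      using comp_f_mem(2)[OF \<phi>(1)] by (intro imageI) (simp add: o_def)
  qed
  moreover have "summable_powers_on ?E (supported_on Y) T"
    unfolding summable_powers_on_def
  proof (intro exI[of _ a] conjI allI ballI a)
    fix n \<Psi> assume "\<Psi> \<in> supported_on Y"
    then obtain \<phi> where \<phi>: "\<phi> \<in> \<L>" "\<forall>x\<in>space M - Y. \<phi> x = 0" "\<Psi> = cl \<phi>" by (auto simp: supported_on_def)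
    have Fn: "F (int n) = f ^^ n" by (simp add: int_iter_of_nat)
    have "nrm (\<phi> \<circ> F (int n)) \<le> a n * nrm \<phi>"
    proof (rule nn_comp_le(2)[OF F_measurable Y \<phi>(1) a(2)])
      fix S assume S: "S \<in> sets M" "S \<subseteq> Y"
      \<comment> \<open>Taking the preimage under \<open>F (int n)\<close> is shifting by
        \<open>- int n\<close>, so the index of \<open>u\<close> moves forward from
        \<open>- j\<close> to \<open>- j + n\<close>.\<close>
      have "u (- j) \<le> B * \<theta> ^ n * u (- (- int n + j))" if "S \<inter> level j \<noteq> {}" for j
        using that S(2) Y_level B(4)[of "- j" n] by (auto simp: algebra_simps)
      from bound[OF S(1) this] show "emeasure M (F (int n) -` S \<inter> space M) \<le> ennreal (a n powr p) * emeasure M S"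
        by simp
    qed (use \<phi> in auto)
    then show "vnorm ?E ((T ^^ n) \<Psi>) \<le> a n * vnorm ?E \<Psi>"
      using T_funpow[OF \<phi>(1), of n] \<phi> by (simp add: Lp_ops Fn)
  qed
  moreover have "summable_powers_on ?E (supported_on (space M - Y)) ?T'"
    unfolding summable_powers_on_def
  proof (intro exI[of _ a] conjI allI ballI a)
    fix n \<Psi> assume "\<Psi> \<in> supported_on (space M - Y)"
    then obtain \<phi> where \<phi>: "\<phi> \<in> \<L>" "\<forall>x\<in>space M - (space M - Y). \<phi> x = 0" "\<Psi> = cl \<phi>" by (auto simp: supported_on_def)
    have Fn: "F (- int n) = f' ^^ n" by (simp add: int_iter_minus_of_nat)
    have "nrm (\<phi> \<circ> F (- int n)) \<le> a n * nrm \<phi>"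
    proof (rule nn_comp_le(2)[OF F_measurable sets.compl_sets[OF Y] \<phi>(1) a(2)])
      fix S assume S: "S \<in> sets M" "S \<subseteq> space M - Y"
      have "u (- j) \<le> B * \<theta> ^ n * u (- (int n + j))" if "S \<inter> level j \<noteq> {}" for j
        using that S(2) Yc_level B(5)[of "- j" n] by (auto simp: algebra_simps)
      from bound[OF S(1) this] show "emeasure M (F (- int n) -` S \<inter> space M) \<le> ennreal (a n powr p) * emeasure M S" .
    qed (use \<phi> in auto)
    then show "vnorm ?E ((?T' ^^ n) \<Psi>) \<le> a n * vnorm ?E \<Psi>"
      using inv_T_funpow[OF \<phi>(1), of n] \<phi> by (simp add: Lp_ops Fn)
  qed
  ultimately show ?thesis
    unfolding summable_splitting_def
    using closed_subspace_supported_on[OF Y] closed_subspace_supported_on[OF sets.compl_sets[OF Y]]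
      direct_sum_supported_on[OF Y] by blast
qed

end

theorem mainTheorem3:
  fixes M :: "'a measure" and f :: "'a \<Rightarrow> 'a" and W :: "'a set" and p :: real
  assumes "1 \<le> p"
    and "dissipative_bounded_distortion M f W"
    and "invertible_composition M f"
  shows "(shadowing_property (Lp M p) (composition_operator M f) \<longleftrightarrow>
            generalized_hyperbolic (Lp M p) (composition_operator M f)) \<and>
         (shadowing_property (Lp M p) (composition_operator M f) \<or>
            generalized_hyperbolic (Lp M p) (composition_operator M f) \<longrightarrow>
          strongly_structurally_stable (Lp M p) (composition_operator M f))"
proof -
  interpret dyn: dissipative_bounded_distortion M f W by (rule assms(2))
  interpret dissipative_Lp M f W p
    by unfold_locales (use assms in auto)
  note inv = invertible_T
  show ?thesis
    using generalized_hyperbolic_iff[OF inv] shadowing_imp_summable_splitting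
      summable_splitting_imp_shadowing[OF inv] summable_splitting_imp_stable[OF inv] by blast
qed

end
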